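(* Let $r\ge1$, let $g_r=\prod_{i=-(r-1)}^{r-1}(q_0+q^i)$, and let $\mathcal Z_{0,g_r}$ be the ring obtained by localizing $\mathbb Z[q,q^{-1},q_0,q_0^{-1}]$ at $g_r$ (so that $g_r$ is invertible). For any commutative $\mathcal Z_{0,g_r}$-algebra $\mathcal Z'$, the algebras $\mathcal S_q^2(r,r;\mathcal Z')$ and $\mathcal S_q^{1_B}(r,r;\mathcal Z')$ are Morita equivalent. In particular, this Morita equivalence holds in the linear prime case.
   Context: Let $W$ be the Weyl group of type $B_r$ with Coxeter generators $s_0,\dots,s_{r-1}$ ($s_0s_1$ of order $4$; $s_is_{i+1}$ of order $3$ for $i\ge1$; other pairs commute), $\bar W=\langle s_1,\dots,s_{r-1}\rangle\cong\mathfrak S_r$, $t_1=s_0$, $t_i=s_{i-1}t_{i-1}s_{i-1}$ for $2\le i\le r$. $\mathcal H'$ is the two-parameter Hecke algebra of $W$ over $\mathcal Z'$, with basis $\{T_w\}_{w\in W}$, $T_{s_i}^2=(q-1)T_{s_i}+q$ for $i\ge1$, $T_{s_0}^2=(q_0-1)T_{s_0}+q_0$, and $T_wT_{w'}=T_{ww'}$ when lengths add. $\Lambda(r,k)$ is the set of compositions of $k$ with $r$ parts (zeros allowed); $\Pi_2=\Pi_2(r,r)=\bigcup_{r_1+r_2=r}\Lambda(r,r_1)\times\Lambda(r,r_2)$, with elements $\lambda=(\lambda^{(1)},\lambda^{(2)})$; $|\lambda^{(i)}|$ is the sum of the parts of $\lambda^{(i)}$; $\Pi_{1_B}=\{\lambda\in\Pi_2:|\lambda^{(1)}|=0\}$.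 $\bar W_\lambda$ is the Young subgroup of $\bar W$ defined by the juxtaposition of $\lambda^{(1)}$ and $\lambda^{(2)}$, $\bar x_\lambda=\sum_{w\in\bar W_\lambda}T_w$, $\pi_0=1$, $\pi_a=\prod_{i=1}^a(q^{i-1}+T_{t_i})$ for $a\ge1$, and $x_\lambda=\pi_{|\lambda^{(1)}|}\bar x_\lambda$. The $q$-Schur$^2$ algebra is $\mathcal S_q^2(r,r;\mathcal Z')=\mathrm{End}_{\mathcal H'}(\bigoplus_{\lambda\in\Pi_2}x_\lambda\mathcal H')$ and the $q$-Schur$^{1_B}$ algebra is $\mathcal S_q^{1_B}(r,r;\mathcal Z')=\mathrm{End}_{\mathcal H'}(\bigoplus_{\lambda\in\Pi_{1_B}}x_\lambda\mathcal H')$ (right modules). The "linear prime case" is the situation studied under that name by Geck–Hiss and Gruber–Hiss for decomposition numbers of finite classical groups: $q$ is a power of a rational prime and is reduced modulo a different prime, which is a linear prime in their sense; there the factors $q_0+q^i$ of $g_r$ are invertible in the base ring, so the base ring is a $\mathcal Z_{0,g_r}$-algebra. *)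

theory Defs
  imports
    "HOL-Algebra.Module"
    "HOL-Algebra.Generated_Groups"
    "HOL-Combinatorics.Transposition"
    "HOL-Combinatorics.Permutations"
    "HOL-Computational_Algebra.Polynomial"
    "HOL-Computational_Algebra.Fraction_Field"
    "HOL-Computational_Algebra.Primes"
    "HOL-Library.FuncSet"
    "HOL-Library.Infinite_Typeclass"
    "HOL-Number_Theory.Pocklington"
begin

section \<open>Right modules over noncommutative rings\<close>

text \<open>As in the library record for modules over commutative rings, the ring record is extended
  only to reuse its additive part; the fields \<open>mult\<close> and \<open>one\<close> of a module are never used.\<close>

record ('a, 'm) rmod = "'m ring" +
  ract :: "'m \<Rightarrow> 'a \<Rightarrow> 'm" (infixl \<open>\<lhd>\<index>\<close> 70)

locale right_module = A: ring A + M: abelian_group M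
  for A :: "('a, 'c) ring_scheme" (structure) and M :: "('a, 'm) rmod" (structure) +
  assumes ract_closed:
      "\<lbrakk>x \<in> carrier M; a \<in> carrier A\<rbrakk> \<Longrightarrow> x \<lhd>\<^bsub>M\<^esub> a \<in> carrier M"
    and ract_add_left:
      "\<lbrakk>x \<in> carrier M; y \<in> carrier M; a \<in> carrier A\<rbrakk>
        \<Longrightarrow> (x \<oplus>\<^bsub>M\<^esub> y) \<lhd>\<^bsub>M\<^esub> a = (x \<lhd>\<^bsub>M\<^esub> a) \<oplus>\<^bsub>M\<^esub> (y \<lhd>\<^bsub>M\<^esub> a)"
    and ract_add_right:
      "\<lbrakk>x \<in> carrier M; a \<in> carrier A; b \<in> carrier A\<rbrakk>
        \<Longrightarrow> x \<lhd>\<^bsub>M\<^esub> (a \<oplus>\<^bsub>A\<^esub> b) = (x \<lhd>\<^bsub>M\<^esub> a) \<oplus>\<^bsub>M\<^esub> (x \<lhd>\<^bsub>M\<^esub> b)"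
    and ract_mult:
      "\<lbrakk>x \<in> carrier M; a \<in> carrier A; b \<in> carrier A\<rbrakk>
        \<Longrightarrow> x \<lhd>\<^bsub>M\<^esub> (a \<otimes>\<^bsub>A\<^esub> b) = (x \<lhd>\<^bsub>M\<^esub> a) \<lhd>\<^bsub>M\<^esub> b"
    and ract_one:
      "x \<in> carrier M \<Longrightarrow> x \<lhd>\<^bsub>M\<^esub> \<one>\<^bsub>A\<^esub> = x"

text \<open>Homomorphisms are extensional, so that equality of functions is equality of homomorphisms.\<close>

definition rmod_hom ::
  "('a, 'c) ring_scheme \<Rightarrow> ('a, 'm) rmod \<Rightarrow> ('a, 'n) rmod \<Rightarrow> ('m \<Rightarrow> 'n) set" where
  "rmod_hom A M N = {f \<in> carrier M \<rightarrow>\<^sub>E carrier N.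
     (\<forall>x\<in>carrier M. \<forall>y\<in>carrier M. f (x \<oplus>\<^bsub>M\<^esub> y) = f x \<oplus>\<^bsub>N\<^esub> f y) \<and>
     (\<forall>x\<in>carrier M. \<forall>a\<in>carrier A. f (x \<lhd>\<^bsub>M\<^esub> a) = f x \<lhd>\<^bsub>N\<^esub> a)}"

definition End_ring :: "('a, 'c) ring_scheme \<Rightarrow> ('a, 'm) rmod \<Rightarrow> ('m \<Rightarrow> 'm) ring" where
  "End_ring A M =
     \<lparr>carrier = rmod_hom A M M,
      mult = (\<lambda>g f. compose (carrier M) g f),
      one = (\<lambda>x\<in>carrier M. x),
      zero = (\<lambda>x\<in>carrier M. \<zero>\<^bsub>M\<^esub>),
      add = (\<lambda>f g. \<lambda>x\<in>carrier M. f x \<oplus>\<^bsub>M\<^esub> g x)\<rparr>"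

text \<open>This is the product of the family; it is only used for finite \<open>I\<close>, where it is the
  direct sum.\<close>

definition direct_sum :: "'i set \<Rightarrow> ('i \<Rightarrow> ('a, 'm) rmod) \<Rightarrow> ('a, 'i \<Rightarrow> 'm) rmod" where
  "direct_sum I M =
     \<lparr>carrier = (\<Pi>\<^sub>E i\<in>I. carrier (M i)),
      mult = undefined,
      one = undefined,
      zero = (\<lambda>i\<in>I. \<zero>\<^bsub>M i\<^esub>),
      add = (\<lambda>u v. \<lambda>i\<in>I. u i \<oplus>\<^bsub>M i\<^esub> v i),
      ract = (\<lambda>u a. \<lambda>i\<in>I. u i \<lhd>\<^bsub>M i\<^esub> a)\<rparr>"

definition right_ideal :: "('a, 'c) ring_scheme \<Rightarrow> 'a \<Rightarrow> ('a, 'a) rmod" where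
  "right_ideal A x =
     \<lparr>carrier = {x \<otimes>\<^bsub>A\<^esub> h | h. h \<in> carrier A},
      mult = undefined,
      one = undefined,
      zero = \<zero>\<^bsub>A\<^esub>,
      add = (\<lambda>y z. y \<oplus>\<^bsub>A\<^esub> z),
      ract = (\<lambda>y a. y \<otimes>\<^bsub>A\<^esub> a)\<rparr>"


section \<open>Equivalence of categories and Morita equivalence\<close>

text \<open>\<open>Comp C X Y Z g f\<close> is the composite of \<open>f : X \<rightarrow> Y\<close> and \<open>g : Y \<rightarrow> Z\<close>.\<close>

record ('o, 'f) cat =
  Obj :: "'o set"
  Hom :: "'o \<Rightarrow> 'o \<Rightarrow> 'f set"
  Ident :: "'o \<Rightarrow> 'f"
  Comp :: "'o \<Rightarrow> 'o \<Rightarrow> 'o \<Rightarrow> 'f \<Rightarrow> 'f \<Rightarrow> 'f"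

text \<open>A functor is given by its object map \<open>Fo\<close> and its maps \<open>Fm X Y\<close> on the morphisms
  \<open>X \<rightarrow> Y\<close>.\<close>

definition is_functor ::
  "('o, 'f) cat \<Rightarrow> ('p, 'g) cat \<Rightarrow> ('o \<Rightarrow> 'p) \<Rightarrow> ('o \<Rightarrow> 'o \<Rightarrow> 'f \<Rightarrow> 'g) \<Rightarrow> bool" where
  "is_functor C D Fo Fm \<longleftrightarrow>
     (\<forall>X\<in>Obj C. Fo X \<in> Obj D) \<and>
     (\<forall>X\<in>Obj C. \<forall>Y\<in>Obj C. \<forall>f\<in>Hom C X Y. Fm X Y f \<in> Hom D (Fo X) (Fo Y)) \<and>
     (\<forall>X\<in>Obj C. Fm X X (Ident C X) = Ident D (Fo X)) \<and>
     (\<forall>X\<in>Obj C. \<forall>Y\<in>Obj C. \<forall>Z\<in>Obj C. \<forall>f\<in>Hom C X Y. \<forall>g\<in>Hom C Y Z.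
        Fm X Z (Comp C X Y Z g f) = Comp D (Fo X) (Fo Y) (Fo Z) (Fm Y Z g) (Fm X Y f))"

definition is_iso :: "('o, 'f) cat \<Rightarrow> 'o \<Rightarrow> 'o \<Rightarrow> 'f \<Rightarrow> bool" where
  "is_iso C X Y f \<longleftrightarrow> f \<in> Hom C X Y \<and>
     (\<exists>g\<in>Hom C Y X. Comp C X Y X g f = Ident C X \<and> Comp C Y X Y f g = Ident C Y)"

definition naturally_isomorphic ::
  "('o, 'f) cat \<Rightarrow> ('p, 'g) cat \<Rightarrow> ('o \<Rightarrow> 'p) \<Rightarrow> ('o \<Rightarrow> 'o \<Rightarrow> 'f \<Rightarrow> 'g)
     \<Rightarrow> ('o \<Rightarrow> 'p) \<Rightarrow> ('o \<Rightarrow> 'o \<Rightarrow> 'f \<Rightarrow> 'g) \<Rightarrow> bool" where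
  "naturally_isomorphic C D Fo Fm Go Gm \<longleftrightarrow>
     (\<exists>\<eta>. (\<forall>X\<in>Obj C. is_iso D (Fo X) (Go X) (\<eta> X)) \<and>
          (\<forall>X\<in>Obj C. \<forall>Y\<in>Obj C. \<forall>f\<in>Hom C X Y.
             Comp D (Fo X) (Fo Y) (Go Y) (\<eta> Y) (Fm X Y f) =
             Comp D (Fo X) (Go X) (Go Y) (Gm X Y f) (\<eta> X)))"

definition equivalent_categories :: "('o, 'f) cat \<Rightarrow> ('p, 'g) cat \<Rightarrow> bool" where
  "equivalent_categories C D \<longleftrightarrow>
     (\<exists>Fo Fm Go Gm. is_functor C D Fo Fm \<and> is_functor D C Go Gm \<and>
        naturally_isomorphic C C (\<lambda>X. Go (Fo X)) (\<lambda>X Y f. Gm (Fo X) (Fo Y) (Fm X Y f))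
          (\<lambda>X. X) (\<lambda>X Y f. f) \<and>
        naturally_isomorphic D D (\<lambda>X. Fo (Go X)) (\<lambda>X Y f. Fm (Go X) (Go Y) (Gm X Y f))
          (\<lambda>X. X) (\<lambda>X Y f. f))"

text \<open>The category of right \<open>A\<close>-modules whose underlying sets are subsets of the type \<open>'u\<close>.\<close>

definition RMod :: "'u itself \<Rightarrow> ('a, 'c) ring_scheme \<Rightarrow> (('a, 'u) rmod, 'u \<Rightarrow> 'u) cat" where
  "RMod U A =
     \<lparr>Obj = {M. right_module A M},
      Hom = rmod_hom A,
      Ident = (\<lambda>M. \<lambda>x\<in>carrier M. x),
      Comp = (\<lambda>L M N g f. compose (carrier L) g f)\<rparr>"

text \<open>Morita equivalence is equivalence of the module categories. HOL cannot quantify over types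
  inside a formula, so the universe \<open>'u\<close> of the modules is a parameter: \<open>RMod TYPE('u) A\<close> contains,
  up to isomorphism, exactly the \<open>A\<close>-modules of cardinality at most that of \<open>'u\<close>. A theorem with
  \<open>'u\<close> left free asserts the equivalence in every infinite universe. Finite universes are
  excluded: they are not closed under finite direct sums.\<close>

definition Morita_equivalent ::
  "'u::infinite itself \<Rightarrow> ('a, 'c) ring_scheme \<Rightarrow> ('b, 'd) ring_scheme \<Rightarrow> bool" where
  "Morita_equivalent U A B \<longleftrightarrow>
     ring A \<and> ring B \<and> equivalent_categories (RMod U A) (RMod U B)"


section \<open>The Weyl group of type B\<close>

text \<open>The group is realised as the group of signed permutations of
  \<open>{-r, \<dots>, -1, 1, \<dots>, r}\<close>, extended by the identity to all integers.\<close>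

definition W_B :: "nat \<Rightarrow> (int \<Rightarrow> int) monoid" where
  "W_B r = \<lparr>carrier = {w. w permutes {i. i \<noteq> 0 \<and> \<bar>i\<bar> \<le> int r} \<and> (\<forall>i. w (- i) = - w i)},
            mult = (\<circ>), one = id\<rparr>"

definition s_B :: "nat \<Rightarrow> int \<Rightarrow> int" where
  "s_B i = (if i = 0 then transpose 1 (- 1)
            else transpose (int i) (int i + 1) \<circ> transpose (- int i) (- int i - 1))"

definition length_B :: "nat \<Rightarrow> (int \<Rightarrow> int) \<Rightarrow> nat" where
  "length_B r w = (LEAST n. \<exists>is. length is = n \<and> set is \<subseteq> {..<r} \<and>
     w = foldr (\<lambda>i v. s_B i \<circ> v) is id)"

fun t_B :: "nat \<Rightarrow> int \<Rightarrow> int" where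
  "t_B 0 = undefined"
| "t_B (Suc 0) = s_B 0"
| "t_B (Suc (Suc i)) = s_B (Suc i) \<circ> t_B (Suc i) \<circ> s_B (Suc i)"

definition Wbar :: "nat \<Rightarrow> (int \<Rightarrow> int) set" where
  "Wbar r = generate (W_B r) (s_B ` {1..<r})"

definition compositions :: "nat \<Rightarrow> nat \<Rightarrow> nat list set" where
  "compositions r k = {\<mu>. length \<mu> = r \<and> sum_list \<mu> = k}"

definition block :: "nat list \<Rightarrow> nat \<Rightarrow> int set" where
  "block \<mu> j = {int (sum_list (take j \<mu>)) + 1..int (sum_list (take (Suc j) \<mu>))}"

definition Young :: "nat \<Rightarrow> nat list \<Rightarrow> (int \<Rightarrow> int) set" where
  "Young r \<mu> = {w \<in> Wbar r. \<forall>j<length \<mu>. w ` block \<mu> j = block \<mu> j}"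

definition Pi2 :: "nat \<Rightarrow> (nat list \<times> nat list) set" where
  "Pi2 r = (\<Union>(r1, r2)\<in>{(a, b). a + b = r}. compositions r r1 \<times> compositions r r2)"

definition Pi1B :: "nat \<Rightarrow> (nat list \<times> nat list) set" where
  "Pi1B r = {\<mu> \<in> Pi2 r. sum_list (fst \<mu>) = 0}"


section \<open>The Hecke algebra and the q-Schur algebras\<close>

text \<open>The axioms determine \<open>H\<close> together with its basis \<open>T\<close> up to unique isomorphism;
  that \<open>T id\<close> is the unit of \<open>H\<close> follows from the length condition.\<close>

locale hecke_algebra_B = module R H + H: ring H
  for r :: nat and R :: "('a, 'c) ring_scheme" (structure) and q :: 'a and q0 :: 'a
    and H :: "('a, 'h, 'd) module_scheme" (structure) and T :: "(int \<Rightarrow> int) \<Rightarrow> 'h" +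
  assumes q_closed: "q \<in> carrier R"
    and q0_closed: "q0 \<in> carrier R"
    and smult_mult_left:
      "\<lbrakk>a \<in> carrier R; x \<in> carrier H; y \<in> carrier H\<rbrakk>
        \<Longrightarrow> (a \<odot>\<^bsub>H\<^esub> x) \<otimes>\<^bsub>H\<^esub> y = a \<odot>\<^bsub>H\<^esub> (x \<otimes>\<^bsub>H\<^esub> y)"
    and smult_mult_right:
      "\<lbrakk>a \<in> carrier R; x \<in> carrier H; y \<in> carrier H\<rbrakk>
        \<Longrightarrow> x \<otimes>\<^bsub>H\<^esub> (a \<odot>\<^bsub>H\<^esub> y) = a \<odot>\<^bsub>H\<^esub> (x \<otimes>\<^bsub>H\<^esub> y)"
    and T_closed: "w \<in> carrier (W_B r) \<Longrightarrow> T w \<in> carrier H"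
    and T_basis:
      "h \<in> carrier H \<Longrightarrow> \<exists>!c. c \<in> carrier (W_B r) \<rightarrow>\<^sub>E carrier R \<and>
         h = (\<Oplus>\<^bsub>H\<^esub> w\<in>carrier (W_B r). c w \<odot>\<^bsub>H\<^esub> T w)"
    and T_quadratic:
      "\<lbrakk>1 \<le> i; i < r\<rbrakk> \<Longrightarrow>
         T (s_B i) \<otimes>\<^bsub>H\<^esub> T (s_B i) = ((q \<ominus>\<^bsub>R\<^esub> \<one>\<^bsub>R\<^esub>) \<odot>\<^bsub>H\<^esub> T (s_B i)) \<oplus>\<^bsub>H\<^esub> (q \<odot>\<^bsub>H\<^esub> \<one>\<^bsub>H\<^esub>)"
    and T_quadratic_0:
      "0 < r \<Longrightarrow>
         T (s_B 0) \<otimes>\<^bsub>H\<^esub> T (s_B 0) = ((q0 \<ominus>\<^bsub>R\<^esub> \<one>\<^bsub>R\<^esub>) \<odot>\<^bsub>H\<^esub> T (s_B 0)) \<oplus>\<^bsub>H\<^esub> (q0 \<odot>\<^bsub>H\<^esub> \<one>\<^bsub>H\<^esub>)"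
    and T_mult:
      "\<lbrakk>v \<in> carrier (W_B r); w \<in> carrier (W_B r);
        length_B r (v \<circ> w) = length_B r v + length_B r w\<rbrakk> \<Longrightarrow> T v \<otimes>\<^bsub>H\<^esub> T w = T (v \<circ> w)"

text \<open>The product is recursive because \<open>H\<close> is not commutative; the factors are taken in
  increasing order of the index.\<close>

primrec pi_elem ::
  "('a, 'c) ring_scheme \<Rightarrow> 'a \<Rightarrow> ('a, 'h, 'd) module_scheme \<Rightarrow> ((int \<Rightarrow> int) \<Rightarrow> 'h) \<Rightarrow> nat \<Rightarrow> 'h"
where
  "pi_elem R q H T 0 = \<one>\<^bsub>H\<^esub>"
| "pi_elem R q H T (Suc a) =
     pi_elem R q H T a \<otimes>\<^bsub>H\<^esub> (((q [^]\<^bsub>R\<^esub> a) \<odot>\<^bsub>H\<^esub> \<one>\<^bsub>H\<^esub>) \<oplus>\<^bsub>H\<^esub> T (t_B (Suc a)))"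

definition xbar_elem ::
  "nat \<Rightarrow> ('a, 'h, 'd) module_scheme \<Rightarrow> ((int \<Rightarrow> int) \<Rightarrow> 'h) \<Rightarrow> nat list \<times> nat list \<Rightarrow> 'h" where
  "xbar_elem r H T \<mu> = (\<Oplus>\<^bsub>H\<^esub> w\<in>Young r (fst \<mu> @ snd \<mu>). T w)"

definition x_elem ::
  "nat \<Rightarrow> ('a, 'c) ring_scheme \<Rightarrow> 'a \<Rightarrow> ('a, 'h, 'd) module_scheme \<Rightarrow> ((int \<Rightarrow> int) \<Rightarrow> 'h)
     \<Rightarrow> nat list \<times> nat list \<Rightarrow> 'h" where
  "x_elem r R q H T \<mu> = pi_elem R q H T (sum_list (fst \<mu>)) \<otimes>\<^bsub>H\<^esub> xbar_elem r H T \<mu>"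

definition qSchur2 ::
  "nat \<Rightarrow> ('a, 'c) ring_scheme \<Rightarrow> 'a \<Rightarrow> ('a, 'h, 'd) module_scheme \<Rightarrow> ((int \<Rightarrow> int) \<Rightarrow> 'h)
     \<Rightarrow> ((nat list \<times> nat list \<Rightarrow> 'h) \<Rightarrow> (nat list \<times> nat list \<Rightarrow> 'h)) ring" where
  "qSchur2 r R q H T =
     End_ring H (direct_sum (Pi2 r) (\<lambda>\<mu>. right_ideal H (x_elem r R q H T \<mu>)))"

definition qSchur1B ::
  "nat \<Rightarrow> ('a, 'c) ring_scheme \<Rightarrow> 'a \<Rightarrow> ('a, 'h, 'd) module_scheme \<Rightarrow> ((int \<Rightarrow> int) \<Rightarrow> 'h)
     \<Rightarrow> ((nat list \<times> nat list \<Rightarrow> 'h) \<Rightarrow> (nat list \<times> nat list \<Rightarrow> 'h)) ring" where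
  "qSchur1B r R q H T =
     End_ring H (direct_sum (Pi1B r) (\<lambda>\<mu>. right_ideal H (x_elem r R q H T \<mu>)))"


section \<open>The base rings\<close>

text \<open>\<open>\<int>[q, q\<inverse>, q\<^sub>0, q\<^sub>0\<inverse>]\<close> and its localization at \<open>g\<^sub>r\<close> are realised inside
  the field of fractions of \<open>\<int>[q][q\<^sub>0]\<close>; the inner polynomial variable is \<open>q\<close>, the outer
  one is \<open>q\<^sub>0\<close>.\<close>

definition q_var :: "int poly poly fract" where
  "q_var = Fract [:[:0, 1:]:] 1"

definition q0_var :: "int poly poly fract" where
  "q0_var = Fract [:0, 1:] 1"

definition Laurent_q_q0 :: "int poly poly fract set" where
  "Laurent_q_q0 = {Fract f 1 * q_var powi m * q0_var powi n | f m n. True}"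

definition g_poly :: "nat \<Rightarrow> int poly poly fract" where
  "g_poly r = (\<Prod>i = - (int r - 1)..int r - 1. q0_var + q_var powi i)"

definition Z0g :: "nat \<Rightarrow> int poly poly fract ring" where
  "Z0g r = \<lparr>carrier = {f / g_poly r ^ n | f n. f \<in> Laurent_q_q0},
            mult = (*), one = 1, zero = 0, add = (+)\<rparr>"

text \<open>The linear prime case. Let \<open>Q\<close> be a power of the prime \<open>p\<close> and let \<open>l \<noteq> p\<close> be a prime.
  The Hecke algebras of type B arising from classical groups over finite fields have the parameters
  \<^item> \<open>q = Q\<close>, \<open>q\<^sub>0 = Q\<^sup>m\<close> for symplectic and orthogonal groups (for the principal series,
    \<open>m = 1\<close> for Sp(2n) and SO(2n+1), and \<open>m = 0, 2\<close> for the even orthogonal groups of plus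
    and minus type);
  \<^item> \<open>q = Q\<^sup>2\<close>, \<open>q\<^sub>0 = Q\<^sup>m\<close> with \<open>m\<close> odd for unitary groups over the field with
    \<open>Q\<^sup>2\<close> elements (for the principal series, \<open>m = 1\<close> for GU(2n) and \<open>m = 3\<close> for
    GU(2n+1)).

  The prime \<open>l\<close> is linear if it is odd and \<open>Q\<close> has odd order modulo \<open>l\<close> in the first case,
  and if it is odd and \<open>- Q\<close> has even order modulo \<open>l\<close> in the second. The residue class of
  \<open>- Q\<close> is represented by the natural number \<open>(l - 1) * Q\<close>. The base ring is an algebra over
  the integers localized at \<open>l\<close>, which covers both the valuation ring and the residue field of
  an \<open>l\<close>-modular system.\<close>

definition linear_prime_case :: "('a, 'c) ring_scheme \<Rightarrow> 'a \<Rightarrow> 'a \<Rightarrow> bool" where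
  "linear_prime_case R q q0 \<longleftrightarrow>
     (\<exists>(p::nat) d (l::nat) (Q::nat). prime p \<and> 0 < d \<and> Q = p ^ d \<and> prime l \<and> l \<noteq> p \<and> odd l \<and>
        (\<forall>n::nat. \<not> l dvd n \<longrightarrow> [n] \<cdot>\<^bsub>R\<^esub> \<one>\<^bsub>R\<^esub> \<in> Units R) \<and>
        (odd (ord l Q) \<and>
           q = [Q] \<cdot>\<^bsub>R\<^esub> \<one>\<^bsub>R\<^esub> \<and> (\<exists>m. q0 = [(Q ^ m)] \<cdot>\<^bsub>R\<^esub> \<one>\<^bsub>R\<^esub>) \<or>
         even (ord l ((l - 1) * Q)) \<and>
           q = [(Q ^ 2)] \<cdot>\<^bsub>R\<^esub> \<one>\<^bsub>R\<^esub> \<and> (\<exists>m. odd m \<and> q0 = [(Q ^ m)] \<cdot>\<^bsub>R\<^esub> \<one>\<^bsub>R\<^esub>)))"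

end

theory Submission
  imports Defs
begin

text \<open>
  Let \<open>a = |\<lambda>\<^sup>(\<^sup>1\<^sup>)|\<close>. The element \<open>\<pi>\<^sub>a\<close> is a quasi-idempotent: since \<open>\<pi>\<^sub>a T\<^sub>0 = q\<^sub>0 \<pi>\<^sub>a\<close> and \<open>\<pi>\<^sub>a\<close> commutes with
  \<open>T\<^sub>i\<close> for \<open>i \<noteq> 0, a\<close>, one gets \<open>\<pi>\<^sub>a\<^sup>2 = \<pi>\<^sub>a \<zeta>\<^sub>a = \<zeta>\<^sub>a \<pi>\<^sub>a\<close>, where \<open>\<zeta>\<^sub>a\<close> is the product of the elements
  \<open>q\<^bsup>i - 1\<^esup> + q\<^sub>0 X\<^sub>i\<close> for \<open>i \<le> a\<close> and \<open>X\<^sub>1 = 1\<close>, \<open>X\<^bsub>i + 1\<^esub> = T\<^sub>i X\<^sub>i T\<^sub>i\<close> are Jucys--Murphy elements of the Hecke algebra of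
  the symmetric group. The intertwiner \<open>T\<^sub>i X\<^sub>i - X\<^sub>i T\<^sub>i\<close> of \<open>X\<^sub>i\<close> and \<open>X\<^bsub>i + 1\<^esub>\<close> shows by induction on \<open>i\<close> that the
  factors of \<open>\<zeta>\<^sub>a\<close> are invertible as soon as the factors of \<open>g\<^sub>r\<close> are. As \<open>\<pi>\<^sub>a\<close> commutes with the sum of the
  \<open>T\<^sub>w\<close> over the Young subgroup of \<open>\<lambda>\<close>, left multiplications by \<open>\<pi>\<^sub>a\<close> and \<open>\<zeta>\<^sub>a\<^sup>-\<^sup>1\<close> exhibit \<open>x\<^sub>\<lambda> H\<close> as a retract of
  \<open>x\<^sub>\<mu> H\<close> for a \<open>\<mu>\<close> with \<open>|\<mu>\<^sup>(\<^sup>1\<^sup>)| = 0\<close> and the same Young subgroup. Hence \<open>S\<^sup>1\<^sup>B\<close> is a full corner of \<open>S\<^sup>2\<close>.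
\<close>

section \<open>Fully faithful and essentially surjective functors\<close>

text \<open>Where \<open>g_r\<close> comes from: generically X_(k+1) has the eigenvalues q^(k+c)
  with |c| \<le> k, so q^k + q_0 X_(k+1) has the eigenvalues q^k (1 + q_0 q^c), and these are, up to
  units, factors of g_r. Over an arbitrary commutative ring there is no spectral argument, and the
  intertwiner itself need not be invertible. The induction therefore writes down a cofactor whose
  product with the element in question is a known unit; it is found by dividing a quadratic
  expression in two commuting elements by a linear one. On the categorical side the obstacle is
  size: the modules over both algebras live in the same type \<open>'u\<close>, whereas the natural
  inverse functor produces spaces of functions. This is why the equivalence is derived from full
  faithfulness and essential surjectivity, and why modules of functions are coded in
  \<open>'u\<close>, which works because \<open>'u\<close> is infinite and finitely many values
  determine each function. Both hypotheses on the base ring enter only through the units q, q_0 +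
  q^n and q_0 q^n + 1 for n < r.\<close>

locale category =
  fixes C :: "('o, 'f) cat"
  assumes Ident_in: "X \<in> Obj C \<Longrightarrow> Ident C X \<in> Hom C X X"
    and Comp_in: "\<lbrakk>X \<in> Obj C; Y \<in> Obj C; Z \<in> Obj C; f \<in> Hom C X Y; g \<in> Hom C Y Z\<rbrakk>
      \<Longrightarrow> Comp C X Y Z g f \<in> Hom C X Z"
    and Comp_Ident_right: "\<lbrakk>X \<in> Obj C; Y \<in> Obj C; f \<in> Hom C X Y\<rbrakk>
      \<Longrightarrow> Comp C X X Y f (Ident C X) = f"
    and Comp_Ident_left: "\<lbrakk>X \<in> Obj C; Y \<in> Obj C; f \<in> Hom C X Y\<rbrakk>
      \<Longrightarrow> Comp C X Y Y (Ident C Y) f = f"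
    and Comp_assoc: "\<lbrakk>W \<in> Obj C; X \<in> Obj C; Y \<in> Obj C; Z \<in> Obj C;
        f \<in> Hom C W X; g \<in> Hom C X Y; h \<in> Hom C Y Z\<rbrakk>
      \<Longrightarrow> Comp C W Y Z h (Comp C W X Y g f) = Comp C W X Z (Comp C X Y Z h g) f"

text \<open>The quasi-inverse is chosen: \<open>Go Y\<close> with an isomorphism
  \<open>\<epsilon> Y\<close> onto \<open>Y\<close>, and on morphisms the lift along
  \<open>Fm\<close> of the conjugate \<open>K X Y h\<close> of \<open>h\<close> by these
  isomorphisms. Then \<open>\<epsilon>\<close> is natural by construction, and functoriality of
  \<open>Gm\<close> follows by cancelling \<open>\<epsilon>\<close> and using faithfulness.\<close>

lemma equivalent_categories_if_fully_faithful_ess_surj: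
  fixes C :: "('o, 'f) cat" and D :: "('p, 'g) cat"
  assumes C: "category C" and D: "category D" and F: "is_functor C D Fo Fm"
    and faithful: "\<And>X Y f g. \<lbrakk>X \<in> Obj C; Y \<in> Obj C; f \<in> Hom C X Y; g \<in> Hom C X Y;
      Fm X Y f = Fm X Y g\<rbrakk> \<Longrightarrow> f = g"
    and full: "\<And>X Y h. \<lbrakk>X \<in> Obj C; Y \<in> Obj C; h \<in> Hom D (Fo X) (Fo Y)\<rbrakk>
      \<Longrightarrow> \<exists>f\<in>Hom C X Y. Fm X Y f = h"
    and ess_surj: "\<And>Y. Y \<in> Obj D \<Longrightarrow> \<exists>X\<in>Obj C. \<exists>h. is_iso D (Fo X) Y h"
  shows "equivalent_categories C D"
proof -
  interpret C: category C by (rule C)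
  interpret D: category D by (rule D)
  have Fo: "X \<in> Obj C \<Longrightarrow> Fo X \<in> Obj D" for X
    using F by (simp add: is_functor_def)
  have Fm: "\<lbrakk>X \<in> Obj C; Y \<in> Obj C; f \<in> Hom C X Y\<rbrakk> \<Longrightarrow> Fm X Y f \<in> Hom D (Fo X) (Fo Y)" for X Y f
    using F by (simp add: is_functor_def)
  have F_id: "X \<in> Obj C \<Longrightarrow> Fm X X (Ident C X) = Ident D (Fo X)" for X
    using F by (simp add: is_functor_def)
  have F_comp: "\<lbrakk>X \<in> Obj C; Y \<in> Obj C; Z \<in> Obj C; f \<in> Hom C X Y; g \<in> Hom C Y Z\<rbrakk>
      \<Longrightarrow> Fm X Z (Comp C X Y Z g f) = Comp D (Fo X) (Fo Y) (Fo Z) (Fm Y Z g) (Fm X Y f)"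
    for X Y Z f g
    using F by (simp add: is_functor_def)
  obtain Go \<epsilon> where Go: "\<And>Y. Y \<in> Obj D \<Longrightarrow> Go Y \<in> Obj C"
    and iso: "\<And>Y. Y \<in> Obj D \<Longrightarrow> is_iso D (Fo (Go Y)) Y (\<epsilon> Y)"
    using ess_surj by metis
  obtain \<delta> where \<epsilon>: "\<And>Y. Y \<in> Obj D \<Longrightarrow> \<epsilon> Y \<in> Hom D (Fo (Go Y)) Y"
    and \<delta>: "\<And>Y. Y \<in> Obj D \<Longrightarrow> \<delta> Y \<in> Hom D Y (Fo (Go Y))"
    and \<delta>\<epsilon>: "\<And>Y. Y \<in> Obj D \<Longrightarrow> Comp D (Fo (Go Y)) Y (Fo (Go Y)) (\<delta> Y) (\<epsilon> Y) = Ident D (Fo (Go Y))"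
    and \<epsilon>\<delta>: "\<And>Y. Y \<in> Obj D \<Longrightarrow> Comp D Y (Fo (Go Y)) Y (\<epsilon> Y) (\<delta> Y) = Ident D Y"
    using iso unfolding is_iso_def by metis
  define K where "K X Y h = Comp D (Fo (Go X)) X (Fo (Go Y)) (Comp D X Y (Fo (Go Y)) (\<delta> Y) h) (\<epsilon> X)"
    for X Y h
  have K_in: "K X Y h \<in> Hom D (Fo (Go X)) (Fo (Go Y))"
    if "X \<in> Obj D" "Y \<in> Obj D" "h \<in> Hom D X Y" for X Y h
    using that by (auto simp: K_def intro!: D.Comp_in Fo Go \<epsilon> \<delta>)
  define Gm where "Gm X Y h = (SOME f. f \<in> Hom C (Go X) (Go Y) \<and> Fm (Go X) (Go Y) f = K X Y h)"
    for X Y h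
  have Gm: "Gm X Y h \<in> Hom C (Go X) (Go Y) \<and> Fm (Go X) (Go Y) (Gm X Y h) = K X Y h"
    if "X \<in> Obj D" "Y \<in> Obj D" "h \<in> Hom D X Y" for X Y h
    unfolding Gm_def by (rule someI_ex) (use full K_in Go that in blast)
  have \<epsilon>_nat: "Comp D (Fo (Go X)) (Fo (Go Y)) Y (\<epsilon> Y) (K X Y h) = Comp D (Fo (Go X)) X Y h (\<epsilon> X)"
    if "X \<in> Obj D" "Y \<in> Obj D" "h \<in> Hom D X Y" for X Y h
  proof -
    have "Comp D (Fo (Go X)) (Fo (Go Y)) Y (\<epsilon> Y) (K X Y h) =
      Comp D (Fo (Go X)) X Y (Comp D X (Fo (Go Y)) Y (\<epsilon> Y) (Comp D X Y (Fo (Go Y)) (\<delta> Y) h)) (\<epsilon> X)"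
      unfolding K_def using that by (intro D.Comp_assoc) (auto intro!: D.Comp_in Fo Go \<epsilon> \<delta>)
    also have "Comp D X (Fo (Go Y)) Y (\<epsilon> Y) (Comp D X Y (Fo (Go Y)) (\<delta> Y) h) =
       Comp D X Y Y (Comp D Y (Fo (Go Y)) Y (\<epsilon> Y) (\<delta> Y)) h"
      using that by (intro D.Comp_assoc) (auto intro!: D.Comp_in Fo Go \<epsilon> \<delta>)
    also have "\<dots> = h" using that by (simp add: \<epsilon>\<delta> D.Comp_Ident_left)
    finally show ?thesis .
  qed
  have \<epsilon>_mono: "u = v" if "Y \<in> Obj D" "X \<in> Obj D" "u \<in> Hom D X (Fo (Go Y))" "v \<in> Hom D X (Fo (Go Y))"
    "Comp D X (Fo (Go Y)) Y (\<epsilon> Y) u = Comp D X (Fo (Go Y)) Y (\<epsilon> Y) v" for X Y u v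
  proof -
    have "Comp D X (Fo (Go Y)) (Fo (Go Y)) (Comp D (Fo (Go Y)) Y (Fo (Go Y)) (\<delta> Y) (\<epsilon> Y)) u =
      Comp D X (Fo (Go Y)) (Fo (Go Y)) (Comp D (Fo (Go Y)) Y (Fo (Go Y)) (\<delta> Y) (\<epsilon> Y)) v"
      using that by (simp add: D.Comp_assoc[symmetric] Fo Go \<epsilon> \<delta>)
    then show ?thesis using that by (simp add: \<delta>\<epsilon> D.Comp_Ident_left Fo Go)
  qed
  have G: "is_functor D C Go Gm"
    unfolding is_functor_def
  proof (intro conjI ballI)
    fix X assume X: "X \<in> Obj D"
    show "Go X \<in> Obj C" by (rule Go[OF X])
    have "K X X (Ident D X) = Ident D (Fo (Go X))"
      using X by (simp add: K_def D.Comp_Ident_right \<delta> \<delta>\<epsilon> Fo Go)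
    then show "Gm X X (Ident D X) = Ident C (Go X)"
      using X Gm[OF X X D.Ident_in[OF X]] by (intro faithful[OF Go[OF X] Go[OF X]]) (auto simp: F_id Go C.Ident_in)
    fix Y assume Y: "Y \<in> Obj D"
    fix f assume f: "f \<in> Hom D X Y"
    show "Gm X Y f \<in> Hom C (Go X) (Go Y)" using Gm[OF X Y f] by simp
    fix Z assume Z: "Z \<in> Obj D"
    fix g assume g: "g \<in> Hom D Y Z"
    have gf: "Comp D X Y Z g f \<in> Hom D X Z" by (rule D.Comp_in[OF X Y Z f g])
    note KK = K_in[OF X Y f] K_in[OF Y Z g] K_in[OF X Z gf]
    have "Comp D (Fo (Go X)) (Fo (Go Z)) Z (\<epsilon> Z) (K X Z (Comp D X Y Z g f)) =
       Comp D (Fo (Go X)) (Fo (Go Z)) Z (\<epsilon> Z) (Comp D (Fo (Go X)) (Fo (Go Y)) (Fo (Go Z)) (K Y Z g) (K X Y f))"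
    proof -
      have "Comp D (Fo (Go X)) (Fo (Go Z)) Z (\<epsilon> Z) (Comp D (Fo (Go X)) (Fo (Go Y)) (Fo (Go Z)) (K Y Z g) (K X Y f))
        = Comp D (Fo (Go X)) (Fo (Go Y)) Z (Comp D (Fo (Go Y)) Y Z g (\<epsilon> Y)) (K X Y f)"
        using X Y Z KK by (simp add: D.Comp_assoc Fo Go \<epsilon> \<epsilon>_nat g)
      also have "\<dots> = Comp D (Fo (Go X)) Y Z g (Comp D (Fo (Go X)) X Y f (\<epsilon> X))"
        using X Y Z KK f g by (simp add: D.Comp_assoc[symmetric] Fo Go \<epsilon> \<epsilon>_nat)
      also have "\<dots> = Comp D (Fo (Go X)) X Z (Comp D X Y Z g f) (\<epsilon> X)"
        using X Y Z f g by (simp add: D.Comp_assoc Fo Go \<epsilon>)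
      finally show ?thesis by (simp add: \<epsilon>_nat X Z gf)
    qed
    then have "K X Z (Comp D X Y Z g f) = Comp D (Fo (Go X)) (Fo (Go Y)) (Fo (Go Z)) (K Y Z g) (K X Y f)"
      by (rule \<epsilon>_mono[of Z "Fo (Go X)", rotated 4]) (use X Y Z KK in \<open>auto intro!: D.Comp_in Fo Go\<close>)
    then show "Gm X Z (Comp D X Y Z g f) = Comp C (Go X) (Go Y) (Go Z) (Gm Y Z g) (Gm X Y f)"
      using X Y Z Gm[OF X Y f] Gm[OF Y Z g] Gm[OF X Z gf]
      by (intro faithful[OF Go[OF X] Go[OF Z]]) (auto simp: F_comp Go intro!: C.Comp_in)
  qed
  have FG: "naturally_isomorphic D D (\<lambda>X. Fo (Go X)) (\<lambda>X Y f. Fm (Go X) (Go Y) (Gm X Y f))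
          (\<lambda>X. X) (\<lambda>X Y f. f)"
    unfolding naturally_isomorphic_def by (intro exI[of _ \<epsilon>]) (simp add: iso Gm \<epsilon>_nat)
  \<comment> \<open>By fullness \<open>\<epsilon> (Fo X)\<close> and its inverse
    \<open>\<delta> (Fo X)\<close> lift to \<open>C\<close>; faithfulness makes the two lifts
    inverse to each other.\<close>
  define \<eta> where "\<eta> X = (SOME f. f \<in> Hom C (Go (Fo X)) X \<and> Fm (Go (Fo X)) X f = \<epsilon> (Fo X))" for X
  define \<theta> where "\<theta> X = (SOME f. f \<in> Hom C X (Go (Fo X)) \<and> Fm X (Go (Fo X)) f = \<delta> (Fo X))" for X
  have \<eta>: "\<eta> X \<in> Hom C (Go (Fo X)) X \<and> Fm (Go (Fo X)) X (\<eta> X) = \<epsilon> (Fo X)" if "X \<in> Obj C" for X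
    unfolding \<eta>_def by (rule someI_ex) (use full[of "Go (Fo X)" X "\<epsilon> (Fo X)"] \<epsilon> Fo Go that in blast)
  have \<theta>: "\<theta> X \<in> Hom C X (Go (Fo X)) \<and> Fm X (Go (Fo X)) (\<theta> X) = \<delta> (Fo X)" if "X \<in> Obj C" for X
    unfolding \<theta>_def by (rule someI_ex) (use full[of X "Go (Fo X)" "\<delta> (Fo X)"] \<delta> Fo Go that in blast)
  have \<eta>_iso: "is_iso C (Go (Fo X)) X (\<eta> X)" if X: "X \<in> Obj C" for X
    unfolding is_iso_def
  proof (intro conjI bexI[of _ "\<theta> X"])
    note [simp] = X Fo Go F_comp F_id \<delta>\<epsilon> \<epsilon>\<delta> \<eta>[OF X] \<theta>[OF X]
    show "Comp C (Go (Fo X)) X (Go (Fo X)) (\<theta> X) (\<eta> X) = Ident C (Go (Fo X))"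
      by (intro faithful[of "Go (Fo X)" "Go (Fo X)"]) (auto intro!: C.Comp_in[of _ X] C.Ident_in)
    show "Comp C X (Go (Fo X)) X (\<eta> X) (\<theta> X) = Ident C X"
      by (intro faithful[of X X]) (auto intro!: C.Comp_in[of _ "Go (Fo X)"] C.Ident_in)
  qed (use \<eta>[OF X] \<theta>[OF X] in auto)
  have "naturally_isomorphic C C (\<lambda>X. Go (Fo X)) (\<lambda>X Y f. Gm (Fo X) (Fo Y) (Fm X Y f))
          (\<lambda>X. X) (\<lambda>X Y f. f)"
    unfolding naturally_isomorphic_def
  proof (intro exI[of _ \<eta>] conjI ballI)
    fix X assume X: "X \<in> Obj C"
    show "is_iso C (Go (Fo X)) X (\<eta> X)" by (rule \<eta>_iso[OF X])
    fix Y f assume Y: "Y \<in> Obj C" and f: "f \<in> Hom C X Y"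
    note G = Gm[OF Fo Fo Fm, OF X Y X Y f]
    show "Comp C (Go (Fo X)) (Go (Fo Y)) Y (\<eta> Y) (Gm (Fo X) (Fo Y) (Fm X Y f)) =
       Comp C (Go (Fo X)) X Y f (\<eta> X)"
      using X Y f G \<eta>[OF X] \<eta>[OF Y]
      by (intro faithful[of "Go (Fo X)" Y])
        (auto simp: F_comp Fo Go Fm \<epsilon>_nat intro!: C.Comp_in[of _ X] C.Comp_in[of _ "Go (Fo Y)"])
  qed
  with F G FG show ?thesis unfolding equivalent_categories_def by blast
qed

section \<open>Modules\<close>

text \<open>Additivity is asked only on a submonoid \<open>S\<close>, because some maps below are
  additive on part of the ambient group, such as homomorphisms on Me or on Ae. That the sum stays in
  \<open>S\<close> belongs to the same induction, whose additivity step needs it.\<close>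

lemma finsum_additive_on:
  assumes G: "abelian_monoid G" and H: "abelian_monoid H"
    and S: "S \<subseteq> carrier G" "\<zero>\<^bsub>G\<^esub> \<in> S" "\<And>x y. \<lbrakk>x \<in> S; y \<in> S\<rbrakk> \<Longrightarrow> x \<oplus>\<^bsub>G\<^esub> y \<in> S"
    and f: "f \<in> S \<rightarrow> carrier H" "f \<zero>\<^bsub>G\<^esub> = \<zero>\<^bsub>H\<^esub>"
      "\<And>x y. \<lbrakk>x \<in> S; y \<in> S\<rbrakk> \<Longrightarrow> f (x \<oplus>\<^bsub>G\<^esub> y) = f x \<oplus>\<^bsub>H\<^esub> f y"
    and K: "finite K" "g \<in> K \<rightarrow> S"
  shows "finsum G g K \<in> S" and "f (finsum G g K) = finsum H (\<lambda>k. f (g k)) K"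
proof -
  interpret G: abelian_monoid G by (rule G)
  interpret H: abelian_monoid H by (rule H)
  have "finsum G g K \<in> S \<and> f (finsum G g K) = finsum H (\<lambda>k. f (g k)) K"
    using K
  proof (induction K)
    case (insert k K)
    then have "g \<in> K \<rightarrow> carrier G" "g k \<in> carrier G" "(\<lambda>k. f (g k)) \<in> K \<rightarrow> carrier H" "f (g k) \<in> carrier H"
      using S f(1) by auto
    with insert show ?case by (auto simp: S f)
  qed (use S f in auto)
  then show "finsum G g K \<in> S" "f (finsum G g K) = finsum H (\<lambda>k. f (g k)) K" by auto
qed

context right_module
begin

lemma ract_zero_left: "a \<in> carrier A \<Longrightarrow> \<zero>\<^bsub>M\<^esub> \<lhd>\<^bsub>M\<^esub> a = \<zero>\<^bsub>M\<^esub>"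
  using ract_add_left[of "\<zero>\<^bsub>M\<^esub>" "\<zero>\<^bsub>M\<^esub>" a]
  by (metis M.add.l_cancel_one M.l_zero M.zero_closed ract_closed)

lemma ract_zero_right: "x \<in> carrier M \<Longrightarrow> x \<lhd>\<^bsub>M\<^esub> \<zero>\<^bsub>A\<^esub> = \<zero>\<^bsub>M\<^esub>"
  using ract_add_right[of x "\<zero>\<^bsub>A\<^esub>" "\<zero>\<^bsub>A\<^esub>"]
  by (metis A.zero_closed M.add.l_cancel_one A.l_zero ract_closed)

lemma ract_minus_left:
  assumes "x \<in> carrier M" "a \<in> carrier A"
  shows "(\<ominus>\<^bsub>M\<^esub> x) \<lhd>\<^bsub>M\<^esub> a = \<ominus>\<^bsub>M\<^esub> (x \<lhd>\<^bsub>M\<^esub> a)"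
  using ract_add_left[of "\<ominus>\<^bsub>M\<^esub> x" x a] assms
  by (simp add: M.l_neg ract_zero_left M.minus_equality ract_closed)

lemma ract_finsum:
  assumes "x \<in> carrier M" "finite K" "g \<in> K \<rightarrow> carrier A"
  shows "x \<lhd>\<^bsub>M\<^esub> finsum A g K = finsum M (\<lambda>k. x \<lhd>\<^bsub>M\<^esub> g k) K"
  using assms
  by (intro finsum_additive_on(2)[where S = "carrier A" and f = "\<lambda>a. x \<lhd>\<^bsub>M\<^esub> a"])
    (auto simp: A.abelian_monoid_axioms M.abelian_monoid_axioms ract_closed ract_zero_right ract_add_right)

end

lemma right_moduleI:
  fixes A :: "('a, 'c) ring_scheme" and M :: "('a, 'm) rmod"
  assumes "ring A"
    and "\<And>x y. \<lbrakk>x \<in> carrier M; y \<in> carrier M\<rbrakk> \<Longrightarrow> x \<oplus>\<^bsub>M\<^esub> y \<in> carrier M"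
    and "\<zero>\<^bsub>M\<^esub> \<in> carrier M"
    and "\<And>x y z. \<lbrakk>x \<in> carrier M; y \<in> carrier M; z \<in> carrier M\<rbrakk>
      \<Longrightarrow> (x \<oplus>\<^bsub>M\<^esub> y) \<oplus>\<^bsub>M\<^esub> z = x \<oplus>\<^bsub>M\<^esub> (y \<oplus>\<^bsub>M\<^esub> z)"
    and "\<And>x y. \<lbrakk>x \<in> carrier M; y \<in> carrier M\<rbrakk> \<Longrightarrow> x \<oplus>\<^bsub>M\<^esub> y = y \<oplus>\<^bsub>M\<^esub> x"
    and "\<And>x. x \<in> carrier M \<Longrightarrow> \<zero>\<^bsub>M\<^esub> \<oplus>\<^bsub>M\<^esub> x = x"
    and "\<And>x. x \<in> carrier M \<Longrightarrow> \<exists>y\<in>carrier M. y \<oplus>\<^bsub>M\<^esub> x = \<zero>\<^bsub>M\<^esub>"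
    and "\<And>x a. \<lbrakk>x \<in> carrier M; a \<in> carrier A\<rbrakk> \<Longrightarrow> x \<lhd>\<^bsub>M\<^esub> a \<in> carrier M"
    and "\<And>x y a. \<lbrakk>x \<in> carrier M; y \<in> carrier M; a \<in> carrier A\<rbrakk>
      \<Longrightarrow> (x \<oplus>\<^bsub>M\<^esub> y) \<lhd>\<^bsub>M\<^esub> a = (x \<lhd>\<^bsub>M\<^esub> a) \<oplus>\<^bsub>M\<^esub> (y \<lhd>\<^bsub>M\<^esub> a)"
    and "\<And>x a b. \<lbrakk>x \<in> carrier M; a \<in> carrier A; b \<in> carrier A\<rbrakk>
      \<Longrightarrow> x \<lhd>\<^bsub>M\<^esub> (a \<oplus>\<^bsub>A\<^esub> b) = (x \<lhd>\<^bsub>M\<^esub> a) \<oplus>\<^bsub>M\<^esub> (x \<lhd>\<^bsub>M\<^esub> b)"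
    and "\<And>x a b. \<lbrakk>x \<in> carrier M; a \<in> carrier A; b \<in> carrier A\<rbrakk>
      \<Longrightarrow> x \<lhd>\<^bsub>M\<^esub> (a \<otimes>\<^bsub>A\<^esub> b) = (x \<lhd>\<^bsub>M\<^esub> a) \<lhd>\<^bsub>M\<^esub> b"
    and "\<And>x. x \<in> carrier M \<Longrightarrow> x \<lhd>\<^bsub>M\<^esub> \<one>\<^bsub>A\<^esub> = x"
  shows "right_module A M"
  by (intro right_module.intro abelian_groupI right_module_axioms.intro) (fact assms)+

section \<open>Module homomorphisms and the category of modules\<close>

lemma rmod_homI:
  assumes "f \<in> carrier M \<rightarrow>\<^sub>E carrier N"
    and "\<And>x y. \<lbrakk>x \<in> carrier M; y \<in> carrier M\<rbrakk> \<Longrightarrow> f (x \<oplus>\<^bsub>M\<^esub> y) = f x \<oplus>\<^bsub>N\<^esub> f y"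
    and "\<And>x a. \<lbrakk>x \<in> carrier M; a \<in> carrier A\<rbrakk> \<Longrightarrow> f (x \<lhd>\<^bsub>M\<^esub> a) = f x \<lhd>\<^bsub>N\<^esub> a"
  shows "f \<in> rmod_hom A M N"
  using assms by (auto simp: rmod_hom_def)

lemma rmod_hom_closed: "\<lbrakk>f \<in> rmod_hom A M N; x \<in> carrier M\<rbrakk> \<Longrightarrow> f x \<in> carrier N"
  by (auto simp: rmod_hom_def)

lemma rmod_hom_add:
  "\<lbrakk>f \<in> rmod_hom A M N; x \<in> carrier M; y \<in> carrier M\<rbrakk> \<Longrightarrow> f (x \<oplus>\<^bsub>M\<^esub> y) = f x \<oplus>\<^bsub>N\<^esub> f y"
  by (auto simp: rmod_hom_def)

lemma rmod_hom_ract: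
  "\<lbrakk>f \<in> rmod_hom A M N; x \<in> carrier M; a \<in> carrier A\<rbrakk> \<Longrightarrow> f (x \<lhd>\<^bsub>M\<^esub> a) = f x \<lhd>\<^bsub>N\<^esub> a"
  by (auto simp: rmod_hom_def)

lemma rmod_hom_PiE: "f \<in> rmod_hom A M N \<Longrightarrow> f \<in> carrier M \<rightarrow>\<^sub>E carrier N"
  by (auto simp: rmod_hom_def)

lemma rmod_hom_eqI:
  assumes "f \<in> rmod_hom A M N" "g \<in> rmod_hom A M N" "\<And>x. x \<in> carrier M \<Longrightarrow> f x = g x"
  shows "f = g"
  using PiE_ext[OF assms(1,2)[THEN rmod_hom_PiE]] assms(3) by blast

lemma rmod_hom_zero:
  assumes "right_module A M" "right_module A N" "f \<in> rmod_hom A M N"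
  shows "f \<zero>\<^bsub>M\<^esub> = \<zero>\<^bsub>N\<^esub>"
proof -
  interpret M: right_module A M by fact
  interpret N: right_module A N by fact
  have "f \<zero>\<^bsub>M\<^esub> \<oplus>\<^bsub>N\<^esub> f \<zero>\<^bsub>M\<^esub> = f \<zero>\<^bsub>M\<^esub>"
    using rmod_hom_add[OF assms(3), of "\<zero>\<^bsub>M\<^esub>" "\<zero>\<^bsub>M\<^esub>"] by simp
  then show ?thesis using rmod_hom_closed[OF assms(3), of "\<zero>\<^bsub>M\<^esub>"] by simp
qed

lemma rmod_hom_compose:
  assumes "right_module A L" "f \<in> rmod_hom A L M" "g \<in> rmod_hom A M N"
  shows "compose (carrier L) g f \<in> rmod_hom A L N"
proof -
  interpret L: right_module A L by fact
  show ?thesis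
    by (rule rmod_homI)
      (use assms in \<open>auto simp: compose_def rmod_hom_closed rmod_hom_add rmod_hom_ract L.ract_closed\<close>)
qed

lemma rmod_hom_id:
  assumes "right_module A M"
  shows "(\<lambda>x\<in>carrier M. x) \<in> rmod_hom A M M"
proof -
  interpret M: right_module A M by fact
  show ?thesis by (rule rmod_homI) (auto simp: M.ract_closed)
qed

lemma category_RMod: "category (RMod U A)"
proof
  fix W X Y Z f g h assume "f \<in> Hom (RMod U A) W X" "g \<in> Hom (RMod U A) X Y" "h \<in> Hom (RMod U A) Y Z"
  then show "Comp (RMod U A) W Y Z h (Comp (RMod U A) W X Y g f)
      = Comp (RMod U A) W X Z (Comp (RMod U A) X Y Z h g) f"
    by (auto simp: RMod_def compose_def rmod_hom_closed)
qed (auto simp: RMod_def rmod_hom_id rmod_hom_compose PiE_def intro!: compose_Id Id_compose dest: rmod_hom_PiE)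

lemma is_iso_inverse: "is_iso C X Y f \<Longrightarrow> \<exists>g. is_iso C Y X g"
  unfolding is_iso_def by blast

text \<open>As \<open>f\<close> is onto, \<open>N_add\<close> and \<open>N_act\<close> express the
  operations of \<open>N\<close> through \<open>f\<close>, which reduces linearity of the inverse
  map to the module laws of \<open>M\<close>.\<close>

lemma is_iso_RModI:
  assumes M: "right_module A M" and f: "f \<in> rmod_hom A M N" and bij: "bij_betw f (carrier M) (carrier N)"
  shows "is_iso (RMod U A) M N f"
proof -
  interpret M: right_module A M by (rule M)
  let ?g = "\<lambda>y\<in>carrier N. inv_into (carrier M) f y"
  have g: "y \<in> carrier N \<Longrightarrow> inv_into (carrier M) f y \<in> carrier M" for y
    using bij by (simp add: bij_betw_def inv_into_into)
  have fg: "y \<in> carrier N \<Longrightarrow> f (inv_into (carrier M) f y) = y" for y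
    using bij by (simp add: bij_betw_inv_into_right)
  have gf: "x \<in> carrier M \<Longrightarrow> inv_into (carrier M) f (f x) = x" for x
    using bij by (simp add: bij_betw_inv_into_left)
  have N_add: "\<lbrakk>x \<in> carrier N; y \<in> carrier N\<rbrakk> \<Longrightarrow>
      x \<oplus>\<^bsub>N\<^esub> y = f (inv_into (carrier M) f x \<oplus>\<^bsub>M\<^esub> inv_into (carrier M) f y)" for x y
    by (simp add: rmod_hom_add[OF f] g fg)
  have N_act: "\<lbrakk>x \<in> carrier N; a \<in> carrier A\<rbrakk> \<Longrightarrow>
      x \<lhd>\<^bsub>N\<^esub> a = f (inv_into (carrier M) f x \<lhd>\<^bsub>M\<^esub> a)" for x a
    by (simp add: rmod_hom_ract[OF f] g fg)
  have "?g \<in> rmod_hom A N M"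
    by (intro rmod_homI) (auto simp: g N_add N_act gf M.ract_closed rmod_hom_closed[OF f])
  moreover have "compose (carrier M) ?g f = (\<lambda>x\<in>carrier M. x)" "compose (carrier N) f ?g = (\<lambda>x\<in>carrier N. x)"
    by (auto simp: compose_def gf fg rmod_hom_closed[OF f])
  ultimately show ?thesis
    unfolding is_iso_def RMod_def using f by (auto intro!: bexI[of _ ?g])
qed

text \<open>Transport of structure along an injection: it brings a module whose elements are
  functions back into the universe type.\<close>

definition transport :: "('m \<Rightarrow> 'n) \<Rightarrow> ('a, 'm) rmod \<Rightarrow> ('a, 'n) rmod" where
  "transport c M =
     \<lparr>carrier = c ` carrier M, mult = undefined, one = undefined, zero = c \<zero>\<^bsub>M\<^esub>,
      add = (\<lambda>x y. c (inv_into (carrier M) c x \<oplus>\<^bsub>M\<^esub> inv_into (carrier M) c y)),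
      ract = (\<lambda>x a. c (inv_into (carrier M) c x \<lhd>\<^bsub>M\<^esub> a))\<rparr>"

lemma carrier_transport: "carrier (transport c M) = c ` carrier M"
  by (simp add: transport_def)

lemma transport_add:
  "\<lbrakk>inj_on c (carrier M); x \<in> carrier M; y \<in> carrier M\<rbrakk>
    \<Longrightarrow> c x \<oplus>\<^bsub>transport c M\<^esub> c y = c (x \<oplus>\<^bsub>M\<^esub> y)"
  by (simp add: transport_def)

lemma transport_ract:
  "\<lbrakk>inj_on c (carrier M); x \<in> carrier M\<rbrakk> \<Longrightarrow> c x \<lhd>\<^bsub>transport c M\<^esub> a = c (x \<lhd>\<^bsub>M\<^esub> a)"
  by (simp add: transport_def)

lemma right_module_transport:
  assumes "right_module A M" and c: "inj_on c (carrier M)"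
  shows "right_module A (transport c M)"
proof -
  interpret M: right_module A M by fact
  have zero: "\<zero>\<^bsub>transport c M\<^esub> = c \<zero>\<^bsub>M\<^esub>" by (simp add: transport_def)
  note [simp] = carrier_transport transport_add[OF c] transport_ract[OF c] M.ract_closed zero
  show ?thesis
    by (rule right_moduleI)
      (auto simp: M.A.ring_axioms M.M.a_ac M.M.r_neg M.ract_add_left M.ract_add_right M.ract_mult
        M.ract_one intro!: imageI bexI[of _ "\<ominus>\<^bsub>M\<^esub> _"] M.M.l_neg arg_cong[where f = c])
qed

section \<open>Endomorphism rings, direct sums and principal right ideals\<close>

lemma ring_End_ring:
  assumes "right_module A M"
  shows "ring (End_ring A M)"
proof -
  interpret M: right_module A M by fact
  note [simp] = rmod_hom_closed M.ract_closed
  have add: "(\<lambda>x\<in>carrier M. f x \<oplus>\<^bsub>M\<^esub> g x) \<in> rmod_hom A M M" if f: "f \<in> rmod_hom A M M" and g: "g \<in> rmod_hom A M M" for f g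
    by (rule rmod_homI) (use f g in \<open>auto simp: rmod_hom_add rmod_hom_ract M.ract_add_left M.M.a_ac\<close>)
  have zero: "(\<lambda>x\<in>carrier M. \<zero>\<^bsub>M\<^esub>) \<in> rmod_hom A M M"
    by (rule rmod_homI) (auto simp: M.ract_zero_left)
  have neg: "(\<lambda>x\<in>carrier M. \<ominus>\<^bsub>M\<^esub> f x) \<in> rmod_hom A M M" if f: "f \<in> rmod_hom A M M" for f
    by (rule rmod_homI) (use f in \<open>auto simp: rmod_hom_add rmod_hom_ract M.ract_minus_left M.M.minus_add\<close>)
  show ?thesis
  proof (rule ringI)
    show "abelian_group (End_ring A M)"
    proof (rule abelian_groupI)
      fix f assume f: "f \<in> carrier (End_ring A M)"
      show "\<exists>g\<in>carrier (End_ring A M). g \<oplus>\<^bsub>End_ring A M\<^esub> f = \<zero>\<^bsub>End_ring A M\<^esub>"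
        using f by (intro bexI[of _ "\<lambda>x\<in>carrier M. \<ominus>\<^bsub>M\<^esub> f x"])
          (auto simp: End_ring_def neg M.M.l_neg intro!: restrict_ext)
      show "\<zero>\<^bsub>End_ring A M\<^esub> \<oplus>\<^bsub>End_ring A M\<^esub> f = f"
        using f add[OF zero, of f]
        by (intro rmod_hom_eqI[of _ A M M]) (auto simp: End_ring_def zero)
    qed (auto simp: End_ring_def add zero M.M.a_ac intro!: restrict_ext)
    show "monoid (End_ring A M)"
    proof (rule monoidI)
      fix f g h assume "f \<in> carrier (End_ring A M)" "g \<in> carrier (End_ring A M)" "h \<in> carrier (End_ring A M)"
      then show "(f \<otimes>\<^bsub>End_ring A M\<^esub> g) \<otimes>\<^bsub>End_ring A M\<^esub> h = f \<otimes>\<^bsub>End_ring A M\<^esub> (g \<otimes>\<^bsub>End_ring A M\<^esub> h)"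
        by (auto simp: End_ring_def compose_def)
    qed (auto simp: End_ring_def rmod_hom_compose rmod_hom_id assms PiE_def
        intro!: compose_Id Id_compose dest: rmod_hom_PiE)
  qed (auto simp: End_ring_def compose_def rmod_hom_add intro!: restrict_ext)
qed

lemma right_module_direct_sum:
  assumes A: "ring A" and M: "\<And>i. i \<in> I \<Longrightarrow> right_module A (M i)"
  shows "right_module A (direct_sum I M)"
proof -
  have ab: "abelian_group (M i)" if "i \<in> I" for i
    using M[OF that] by (rule right_module.axioms)
  have mem: "u i \<in> carrier (M i)" if "u \<in> carrier (direct_sum I M)" "i \<in> I" for u i
    using that by (auto simp: direct_sum_def)
  note [simp] = abelian_monoid.a_closed[OF abelian_group.axioms(1)[OF ab]]
    abelian_monoid.zero_closed[OF abelian_group.axioms(1)[OF ab]]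
    abelian_monoid.l_zero[OF abelian_group.axioms(1)[OF ab]]
    right_module.ract_closed[OF M]
  show ?thesis
  proof (rule right_moduleI)
    fix u assume u: "u \<in> carrier (direct_sum I M)"
    note [simp] = mem[OF u]
    show "\<exists>v\<in>carrier (direct_sum I M). v \<oplus>\<^bsub>direct_sum I M\<^esub> u = \<zero>\<^bsub>direct_sum I M\<^esub>"
      using u by (intro bexI[of _ "\<lambda>i\<in>I. \<ominus>\<^bsub>M i\<^esub> u i"])
        (auto simp: direct_sum_def abelian_group.l_neg[OF ab] abelian_group.a_inv_closed[OF ab]
          intro!: restrict_ext)
  next
    fix u v assume "u \<in> carrier (direct_sum I M)" "v \<in> carrier (direct_sum I M)"
    from this[THEN mem] show "u \<oplus>\<^bsub>direct_sum I M\<^esub> v = v \<oplus>\<^bsub>direct_sum I M\<^esub> u"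
      by (auto simp: direct_sum_def intro!: restrict_ext abelian_monoid.a_comm[OF abelian_group.axioms(1)[OF ab]])
  next
    fix u assume u: "u \<in> carrier (direct_sum I M)"
    note [simp] = mem[OF u]
    show "\<zero>\<^bsub>direct_sum I M\<^esub> \<oplus>\<^bsub>direct_sum I M\<^esub> u = u" "u \<lhd>\<^bsub>direct_sum I M\<^esub> \<one>\<^bsub>A\<^esub> = u"
      using u by (auto simp: direct_sum_def right_module.ract_one[OF M] PiE_iff intro!: extensionalityI[of _ I])
  qed (auto simp: direct_sum_def PiE_iff A right_module.ract_add_left[OF M] right_module.ract_add_right[OF M]
      right_module.ract_mult[OF M] abelian_monoid.a_assoc[OF abelian_group.axioms(1)[OF ab]]
      intro!: restrict_ext)
qed

lemma right_module_right_ideal: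
  assumes "ring A" "x \<in> carrier A"
  shows "right_module A (right_ideal A x)"
proof -
  interpret A: ring A by fact
  show ?thesis
  proof (rule right_moduleI)
    fix y assume "y \<in> carrier (right_ideal A x)"
    then obtain h where "h \<in> carrier A" "y = x \<otimes>\<^bsub>A\<^esub> h" by (auto simp: right_ideal_def)
    then show "\<exists>z\<in>carrier (right_ideal A x). z \<oplus>\<^bsub>right_ideal A x\<^esub> y = \<zero>\<^bsub>right_ideal A x\<^esub>"
      using assms(2) by (intro bexI[of _ "x \<otimes>\<^bsub>A\<^esub> (\<ominus>\<^bsub>A\<^esub> h)"])
        (auto simp: right_ideal_def A.r_distr[symmetric] A.l_neg)
  next
    show "\<zero>\<^bsub>right_ideal A x\<^esub> \<in> carrier (right_ideal A x)"
      using assms(2) by (auto simp: right_ideal_def intro: A.r_null[symmetric])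
  next
    fix y z assume "y \<in> carrier (right_ideal A x)" "z \<in> carrier (right_ideal A x)"
    then show "y \<oplus>\<^bsub>right_ideal A x\<^esub> z \<in> carrier (right_ideal A x)"
      using assms(2) by (auto simp: right_ideal_def intro!: A.r_distr[symmetric])
  next
    fix y a assume "y \<in> carrier (right_ideal A x)" "a \<in> carrier A"
    then show "y \<lhd>\<^bsub>right_ideal A x\<^esub> a \<in> carrier (right_ideal A x)"
      using assms(2) by (auto simp: right_ideal_def intro!: A.m_assoc)
  qed (use assms(2) in \<open>auto simp: right_ideal_def A.ring_axioms A.a_ac A.m_assoc A.l_distr A.r_distr\<close>)
qed

section \<open>Full corners\<close>

text \<open>Hessenberg's theorem on squares of infinite cardinals, in the form of a pairing
  function.\<close>

lemma infinite_inj_prod: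
  assumes "infinite (UNIV :: 'u set)"
  obtains p :: "'u \<times> 'u \<Rightarrow> 'u" where "inj p"
proof -
  obtain p where "bij_betw p ((UNIV :: 'u set) \<times> (UNIV :: 'u set)) (UNIV :: 'u set)"
    using card_of_Times_same_infinite[OF assms] card_of_ordIso by blast
  then have "inj p" by (simp add: bij_betw_def)
  then show ?thesis by (rule that)
qed

text \<open>Finite tuples over an infinite type are coded by single elements; each further index is
  absorbed by one use of the pairing function.\<close>

lemma infinite_inj_on_extensional:
  assumes "finite K" and "infinite (UNIV :: 'u set)"
  shows "\<exists>c :: ('k \<Rightarrow> 'u) \<Rightarrow> 'u. inj_on c (extensional K)"
  using assms(1)
proof (induction K)
  case empty
  then show ?case by auto
next
  case (insert k K)
  then obtain c :: "('k \<Rightarrow> 'u) \<Rightarrow> 'u" where c: "inj_on c (extensional K)" by blast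
  obtain p :: "'u \<times> 'u \<Rightarrow> 'u" where p: "inj p" using infinite_inj_prod[OF assms(2)] .
  have "inj_on (\<lambda>f. p (f k, c (restrict f K))) (extensional (insert k K))"
  proof (rule inj_onI)
    fix f g assume f: "f \<in> extensional (insert k K)" and g: "g \<in> extensional (insert k K)"
      and "p (f k, c (restrict f K)) = p (g k, c (restrict g K))"
    from injD[OF p this(3)]
    have "f k = g k" and "c (restrict f K) = c (restrict g K)" by simp_all
    moreover from this(2) have "restrict f K = restrict g K" by (rule inj_onD[OF c]) simp_all
    ultimately have "f k = g k" "restrict f K = restrict g K" by simp_all
    then show "f = g"
      by (intro extensionalityI[OF f g]) (metis insert_iff restrict_apply')
  qed
  then show ?case by blast
qed

text \<open>\<open>B\<close> is identified through \<open>j\<close> with the corner \<open>eAe\<close>, where \<open>e = j 1\<close>. The corner is full: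
  \<open>1\<close> is a sum of products \<open>a\<^sub>k b\<^sub>k\<close> with \<open>a\<^sub>k \<in> Ae\<close> and \<open>b\<^sub>k \<in> eA\<close>.\<close>

locale full_corner = A: ring A + B: ring B
  for A :: "('a, 'c) ring_scheme" and B :: "('b, 'd) ring_scheme" +
  fixes j :: "'b \<Rightarrow> 'a" and e :: 'a and K :: "'k set" and a b :: "'k \<Rightarrow> 'a"
  assumes j_closed: "u \<in> carrier B \<Longrightarrow> j u \<in> carrier A"
    and j_inj: "inj_on j (carrier B)"
    and j_add: "\<lbrakk>u \<in> carrier B; v \<in> carrier B\<rbrakk> \<Longrightarrow> j (u \<oplus>\<^bsub>B\<^esub> v) = j u \<oplus>\<^bsub>A\<^esub> j v"
    and j_mult: "\<lbrakk>u \<in> carrier B; v \<in> carrier B\<rbrakk> \<Longrightarrow> j (u \<otimes>\<^bsub>B\<^esub> v) = j u \<otimes>\<^bsub>A\<^esub> j v"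
    and j_one: "j \<one>\<^bsub>B\<^esub> = e"
    and j_range: "x \<in> carrier A \<Longrightarrow> e \<otimes>\<^bsub>A\<^esub> x \<otimes>\<^bsub>A\<^esub> e \<in> j ` carrier B"
    and finite_K: "finite K"
    and a_closed: "k \<in> K \<Longrightarrow> a k \<in> carrier A"
    and b_closed: "k \<in> K \<Longrightarrow> b k \<in> carrier A"
    and a_e: "k \<in> K \<Longrightarrow> a k \<otimes>\<^bsub>A\<^esub> e = a k"
    and e_b: "k \<in> K \<Longrightarrow> e \<otimes>\<^bsub>A\<^esub> b k = b k"
    and sum_ab: "(\<Oplus>\<^bsub>A\<^esub> k\<in>K. a k \<otimes>\<^bsub>A\<^esub> b k) = \<one>\<^bsub>A\<^esub>"
begin

lemma e_closed: "e \<in> carrier A"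
  using j_closed[OF B.one_closed] by (simp add: j_one)

lemma j_e: "x \<in> carrier B \<Longrightarrow> j x \<otimes>\<^bsub>A\<^esub> e = j x"
  using j_mult[of x "\<one>\<^bsub>B\<^esub>"] by (simp add: j_one)

lemma e_j: "x \<in> carrier B \<Longrightarrow> e \<otimes>\<^bsub>A\<^esub> j x = j x"
  using j_mult[of "\<one>\<^bsub>B\<^esub>" x] by (simp add: j_one)

lemma e_e: "e \<otimes>\<^bsub>A\<^esub> e = e"
  using j_e[of "\<one>\<^bsub>B\<^esub>"] by (simp add: j_one)

text \<open>The Peirce projection x -> exe onto the corner, read in \<open>B\<close>. It is
  \<open>B\<close>-linear on both sides, and on Ae it amounts to left multiplication by
  \<open>e\<close>.\<close>

definition p :: "'a \<Rightarrow> 'b" where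
  "p x = inv_into (carrier B) j (e \<otimes>\<^bsub>A\<^esub> x \<otimes>\<^bsub>A\<^esub> e)"

lemma p_closed: "x \<in> carrier A \<Longrightarrow> p x \<in> carrier B"
  unfolding p_def by (rule inv_into_into[OF j_range])

lemma j_p: "x \<in> carrier A \<Longrightarrow> j (p x) = e \<otimes>\<^bsub>A\<^esub> x \<otimes>\<^bsub>A\<^esub> e"
  unfolding p_def by (rule f_inv_into_f[OF j_range])

lemma p_eqI: "\<lbrakk>x \<in> carrier A; y \<in> carrier B; j y = e \<otimes>\<^bsub>A\<^esub> x \<otimes>\<^bsub>A\<^esub> e\<rbrakk> \<Longrightarrow> p x = y"
  using j_inj[THEN inj_onD, of "p x" y] by (simp add: p_closed j_p)

lemma p_e: "p e = \<one>\<^bsub>B\<^esub>"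
  by (rule p_eqI) (simp_all add: e_closed e_e j_one)

lemma p_add: "\<lbrakk>x \<in> carrier A; y \<in> carrier A\<rbrakk> \<Longrightarrow> p (x \<oplus>\<^bsub>A\<^esub> y) = p x \<oplus>\<^bsub>B\<^esub> p y"
  by (rule p_eqI) (simp_all add: p_closed j_add j_p e_closed A.l_distr A.r_distr)

lemma p_j_mult: "\<lbrakk>x \<in> carrier A; y \<in> carrier B\<rbrakk> \<Longrightarrow> p (j y \<otimes>\<^bsub>A\<^esub> x) = y \<otimes>\<^bsub>B\<^esub> p x"
  by (rule p_eqI)
    (simp_all add: p_closed j_mult j_closed j_p e_closed A.m_assoc[symmetric] j_e e_j)

lemma p_mult_j: "\<lbrakk>x \<in> carrier A; y \<in> carrier B\<rbrakk> \<Longrightarrow> p (x \<otimes>\<^bsub>A\<^esub> j y) = p x \<otimes>\<^bsub>B\<^esub> y"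
  by (rule p_eqI) (simp_all add: p_closed j_mult j_closed j_p e_closed A.m_assoc j_e e_j)

text \<open>The functor M -> Me, which is Hom_A(eA, M) and also the tensor product of M with Ae over
  A.\<close>

definition corner_mod :: "('a, 'u) rmod \<Rightarrow> ('b, 'u) rmod" where
  "corner_mod M = \<lparr>carrier = {x \<in> carrier M. x \<lhd>\<^bsub>M\<^esub> e = x}, mult = undefined, one = undefined,
     zero = \<zero>\<^bsub>M\<^esub>, add = add M, ract = (\<lambda>x y. x \<lhd>\<^bsub>M\<^esub> j y)\<rparr>"

lemma right_module_corner_mod:
  assumes "right_module A M"
  shows "right_module B (corner_mod M)"
proof -
  interpret M: right_module A M by fact
  note [simp] = corner_mod_def e_closed j_closed M.ract_closed
  show ?thesis
  proof (rule right_moduleI)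
    fix x assume "x \<in> carrier (corner_mod M)"
    then show "\<exists>y\<in>carrier (corner_mod M). y \<oplus>\<^bsub>corner_mod M\<^esub> x = \<zero>\<^bsub>corner_mod M\<^esub>"
      by (intro bexI[of _ "\<ominus>\<^bsub>M\<^esub> x"]) (auto simp: M.M.l_neg M.ract_minus_left)
  next
    fix x y assume "x \<in> carrier (corner_mod M)" "y \<in> carrier B"
    then show "x \<lhd>\<^bsub>corner_mod M\<^esub> y \<in> carrier (corner_mod M)"
      by (auto simp: M.ract_mult[symmetric] j_e)
  qed (auto simp: M.M.a_ac M.ract_zero_left M.ract_add_left M.ract_add_right M.ract_mult j_add j_mult
      B.ring_axioms j_one)
qed

lemma ract_mem_corner_mod:
  assumes "right_module A M" "x \<in> carrier M" "c \<in> carrier A" "c \<otimes>\<^bsub>A\<^esub> e = c"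
  shows "x \<lhd>\<^bsub>M\<^esub> c \<in> carrier (corner_mod M)"
proof -
  interpret M: right_module A M by fact
  show ?thesis using assms(2-) by (simp add: corner_mod_def M.ract_closed e_closed M.ract_mult[symmetric])
qed

lemma is_functor_corner_mod:
  "is_functor (RMod TYPE('u) A) (RMod TYPE('u) B) corner_mod (\<lambda>M N f. restrict f (carrier (corner_mod M)))"
proof -
  have hom: "restrict f (carrier (corner_mod M)) \<in> rmod_hom B (corner_mod M) (corner_mod N)"
    if M: "right_module A M" and N: "right_module A N" and f: "f \<in> rmod_hom A M N"
    for f and M N :: "('a, 'u) rmod"
  proof -
    interpret M: right_module A M by fact
    interpret cM: right_module B "corner_mod M" by (rule right_module_corner_mod[OF M])
    have "f x \<lhd>\<^bsub>N\<^esub> e = f x" if "x \<in> carrier M" "x \<lhd>\<^bsub>M\<^esub> e = x" for x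
      using rmod_hom_ract[OF f that(1) e_closed] that by simp
    then show ?thesis
      by (intro rmod_homI) (use f cM.ract_closed cM.M.a_closed in
        \<open>auto simp: corner_mod_def rmod_hom_closed rmod_hom_add rmod_hom_ract j_closed\<close>)
  qed
  show ?thesis
    unfolding is_functor_def
  proof (intro conjI ballI)
    fix X :: "('a, 'u) rmod" assume X: "X \<in> Obj (RMod TYPE('u) A)"
    then show "corner_mod X \<in> Obj (RMod TYPE('u) B)" by (simp add: RMod_def right_module_corner_mod)
    show "restrict (Ident (RMod TYPE('u) A) X) (carrier (corner_mod X)) = Ident (RMod TYPE('u) B) (corner_mod X)"
      by (auto simp: RMod_def corner_mod_def)
    fix Y :: "('a, 'u) rmod" and f assume Y: "Y \<in> Obj (RMod TYPE('u) A)" and f: "f \<in> Hom (RMod TYPE('u) A) X Y"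
    show rf: "restrict f (carrier (corner_mod X)) \<in> Hom (RMod TYPE('u) B) (corner_mod X) (corner_mod Y)"
      using X Y f by (simp add: RMod_def hom)
    fix Z g
    have "f x \<in> carrier (corner_mod Y)" if "x \<in> carrier (corner_mod X)" for x
      using rmod_hom_closed[of _ B, OF _ that] rf that by (fastforce simp: RMod_def)
    moreover have "carrier (corner_mod X) \<subseteq> carrier X" by (auto simp: corner_mod_def)
    ultimately show "restrict (Comp (RMod TYPE('u) A) X Y Z g f) (carrier (corner_mod X)) =
        Comp (RMod TYPE('u) B) (corner_mod X) (corner_mod Y) (corner_mod Z)
          (restrict g (carrier (corner_mod Y))) (restrict f (carrier (corner_mod X)))"
      by (intro ext, case_tac "x \<in> carrier (corner_mod X)") (auto simp: RMod_def compose_def)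
  qed
qed

text \<open>Here fullness of the corner enters: x is the sum of the (x a_k) b_k, and the a_k lie in
  Ae.\<close>

lemma corner_separates:
  assumes "right_module A M" "x \<in> carrier M" "y \<in> carrier M"
    and "\<And>c. \<lbrakk>c \<in> carrier A; c \<otimes>\<^bsub>A\<^esub> e = c\<rbrakk> \<Longrightarrow> x \<lhd>\<^bsub>M\<^esub> c = y \<lhd>\<^bsub>M\<^esub> c"
  shows "x = y"
proof -
  interpret M: right_module A M by fact
  have "z = (\<Oplus>\<^bsub>M\<^esub> k\<in>K. (z \<lhd>\<^bsub>M\<^esub> a k) \<lhd>\<^bsub>M\<^esub> b k)" if z: "z \<in> carrier M" for z
  proof -
    have "z = z \<lhd>\<^bsub>M\<^esub> (\<Oplus>\<^bsub>A\<^esub> k\<in>K. a k \<otimes>\<^bsub>A\<^esub> b k)" using z by (simp add: sum_ab M.ract_one)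
    also have "\<dots> = (\<Oplus>\<^bsub>M\<^esub> k\<in>K. z \<lhd>\<^bsub>M\<^esub> (a k \<otimes>\<^bsub>A\<^esub> b k))"
      using z by (intro M.ract_finsum finite_K) (auto simp: a_closed b_closed)
    also have "\<dots> = (\<Oplus>\<^bsub>M\<^esub> k\<in>K. (z \<lhd>\<^bsub>M\<^esub> a k) \<lhd>\<^bsub>M\<^esub> b k)"
      using z by (intro M.M.finsum_cong') (auto simp: a_closed b_closed M.ract_mult M.ract_closed)
    finally show ?thesis .
  qed
  note this[OF assms(2)] this[OF assms(3)]
  moreover have "(\<Oplus>\<^bsub>M\<^esub> k\<in>K. (x \<lhd>\<^bsub>M\<^esub> a k) \<lhd>\<^bsub>M\<^esub> b k) = (\<Oplus>\<^bsub>M\<^esub> k\<in>K. (y \<lhd>\<^bsub>M\<^esub> a k) \<lhd>\<^bsub>M\<^esub> b k)"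
    using assms(2,3) by (intro M.M.finsum_cong') (auto simp: assms(4) a_closed b_closed a_e M.ract_closed)
  ultimately show ?thesis by simp
qed

lemma corner_mod_faithful:
  assumes "right_module A M" "right_module A N" and f: "f \<in> rmod_hom A M N" and g: "g \<in> rmod_hom A M N"
    and eq: "restrict f (carrier (corner_mod M)) = restrict g (carrier (corner_mod M))"
  shows "f = g"
proof (rule rmod_hom_eqI[OF f g])
  interpret M: right_module A M by fact
  fix x assume x: "x \<in> carrier M"
  show "f x = g x"
  proof (rule corner_separates[OF assms(2)])
    fix c assume c: "c \<in> carrier A" "c \<otimes>\<^bsub>A\<^esub> e = c"
    have "f (x \<lhd>\<^bsub>M\<^esub> c) = g (x \<lhd>\<^bsub>M\<^esub> c)"
      using ract_mem_corner_mod[OF assms(1) x c] eq by (metis restrict_apply')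
    then show "f x \<lhd>\<^bsub>N\<^esub> c = g x \<lhd>\<^bsub>N\<^esub> c" using f g c x by (simp add: rmod_hom_ract)
  qed (use f g x in \<open>auto simp: rmod_hom_closed\<close>)
qed

text \<open>Decomposing x along the a_k b_k shows that the sum of the h(x a_k) b_k is the only
  possible extension of \<open>h\<close>. Everything else rests on \<open>f_c\<close>, the rule f(x)
  c = h(x c) for c in Ae: since products with Ae separate elements, additivity and linearity of
  \<open>f\<close> follow from it without touching the sum again.\<close>

lemma corner_mod_full:
  assumes M: "right_module A M" and N: "right_module A N"
    and h: "h \<in> rmod_hom B (corner_mod M) (corner_mod N)"
  shows "\<exists>f\<in>rmod_hom A M N. restrict f (carrier (corner_mod M)) = h"
proof -
  interpret M: right_module A M by fact
  interpret N: right_module A N by fact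
  interpret cM: right_module B "corner_mod M" by (rule right_module_corner_mod[OF M])
  interpret cN: right_module B "corner_mod N" by (rule right_module_corner_mod[OF N])
  note cM = ract_mem_corner_mod[OF M]
  have hN: "h x \<in> carrier N" if "x \<in> carrier (corner_mod M)" for x
    using rmod_hom_closed[OF h that] by (simp add: corner_mod_def)
  have h_e: "h x \<lhd>\<^bsub>N\<^esub> e = h x" if "x \<in> carrier (corner_mod M)" for x
    using rmod_hom_closed[OF h that] by (simp add: corner_mod_def)
  have h_add: "h (x \<oplus>\<^bsub>M\<^esub> y) = h x \<oplus>\<^bsub>N\<^esub> h y"
    if "x \<in> carrier (corner_mod M)" "y \<in> carrier (corner_mod M)" for x y
    using rmod_hom_add[OF h that] by (simp add: corner_mod_def)
  have h_j: "h (x \<lhd>\<^bsub>M\<^esub> j y) = h x \<lhd>\<^bsub>N\<^esub> j y" if "x \<in> carrier (corner_mod M)" "y \<in> carrier B" for x y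
    using rmod_hom_ract[OF h that] by (simp add: corner_mod_def)
  have h_zero: "h \<zero>\<^bsub>M\<^esub> = \<zero>\<^bsub>N\<^esub>"
    using rmod_hom_zero[OF cM.right_module_axioms cN.right_module_axioms h] by (simp add: corner_mod_def)
  have cM_zero: "\<zero>\<^bsub>M\<^esub> \<in> carrier (corner_mod M)" and cM_add: "\<lbrakk>x \<in> carrier (corner_mod M);
      y \<in> carrier (corner_mod M)\<rbrakk> \<Longrightarrow> x \<oplus>\<^bsub>M\<^esub> y \<in> carrier (corner_mod M)" for x y
    using cM.M.zero_closed cM.M.a_closed[of x y] by (simp_all add: corner_mod_def)
  have cM_sub: "x \<in> carrier (corner_mod M) \<Longrightarrow> x \<in> carrier M" for x
    by (simp add: corner_mod_def)
  define f where "f = (\<lambda>x\<in>carrier M. \<Oplus>\<^bsub>N\<^esub> k\<in>K. h (x \<lhd>\<^bsub>M\<^esub> a k) \<lhd>\<^bsub>N\<^esub> b k)"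
  have f_closed: "f x \<in> carrier N" if "x \<in> carrier M" for x
    using that by (auto simp: f_def intro!: N.M.finsum_closed N.ract_closed hN cM a_closed b_closed a_e)
  have f_c: "f x \<lhd>\<^bsub>N\<^esub> c = h (x \<lhd>\<^bsub>M\<^esub> c)" if x: "x \<in> carrier M" and c: "c \<in> carrier A" "c \<otimes>\<^bsub>A\<^esub> e = c" for x c
  proof -
    have bc: "e \<otimes>\<^bsub>A\<^esub> (b k \<otimes>\<^bsub>A\<^esub> c) \<otimes>\<^bsub>A\<^esub> e = b k \<otimes>\<^bsub>A\<^esub> c" if "k \<in> K" for k
      using that c by (simp add: A.m_assoc b_closed e_closed)
        (simp add: A.m_assoc[symmetric] b_closed e_closed e_b)
    have mem: "x \<lhd>\<^bsub>M\<^esub> a k \<lhd>\<^bsub>M\<^esub> (b k \<otimes>\<^bsub>A\<^esub> c) \<in> carrier (corner_mod M)" if "k \<in> K" for k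
      using that c x by (intro cM) (auto simp: a_closed b_closed M.ract_closed A.m_assoc e_closed)
    have "f x \<lhd>\<^bsub>N\<^esub> c = (\<Oplus>\<^bsub>N\<^esub> k\<in>K. (h (x \<lhd>\<^bsub>M\<^esub> a k) \<lhd>\<^bsub>N\<^esub> b k) \<lhd>\<^bsub>N\<^esub> c)"
      unfolding f_def using x c
      by (simp, intro finsum_additive_on(2)[where S = "carrier N" and f = "\<lambda>y. y \<lhd>\<^bsub>N\<^esub> c"])
        (auto simp: N.M.abelian_monoid_axioms N.ract_closed N.ract_zero_left N.ract_add_left finite_K
          hN cM a_closed b_closed a_e)
    also have "\<dots> = (\<Oplus>\<^bsub>N\<^esub> k\<in>K. h (x \<lhd>\<^bsub>M\<^esub> a k \<lhd>\<^bsub>M\<^esub> (b k \<otimes>\<^bsub>A\<^esub> c)))"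
    proof (rule N.M.finsum_cong')
      fix k assume k: "k \<in> K"
      \<comment> \<open>The element b_k c lies in eAe, hence is the image under \<open>j\<close> of
        an element of \<open>B\<close>, so the \<open>B\<close>-linearity of \<open>h\<close>
        applies to it.\<close>
      have "h (x \<lhd>\<^bsub>M\<^esub> a k \<lhd>\<^bsub>M\<^esub> j (p (b k \<otimes>\<^bsub>A\<^esub> c))) = h (x \<lhd>\<^bsub>M\<^esub> a k) \<lhd>\<^bsub>N\<^esub> j (p (b k \<otimes>\<^bsub>A\<^esub> c))"
        using k x c by (intro h_j cM p_closed) (auto simp: a_closed b_closed a_e)
      then show "(h (x \<lhd>\<^bsub>M\<^esub> a k) \<lhd>\<^bsub>N\<^esub> b k) \<lhd>\<^bsub>N\<^esub> c = h (x \<lhd>\<^bsub>M\<^esub> a k \<lhd>\<^bsub>M\<^esub> (b k \<otimes>\<^bsub>A\<^esub> c))"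
        using k x c by (simp add: j_p bc a_closed b_closed N.ract_mult hN cM a_e)
    qed (use mem hN in auto)
    also have "\<dots> = h (\<Oplus>\<^bsub>M\<^esub> k\<in>K. x \<lhd>\<^bsub>M\<^esub> a k \<lhd>\<^bsub>M\<^esub> (b k \<otimes>\<^bsub>A\<^esub> c))"
      using mem by (intro finsum_additive_on(2)[where S = "carrier (corner_mod M)", symmetric])
        (auto simp: N.M.abelian_monoid_axioms M.M.abelian_monoid_axioms cM_zero cM_add h_zero h_add finite_K hN
          cM_sub)
    also have "(\<Oplus>\<^bsub>M\<^esub> k\<in>K. x \<lhd>\<^bsub>M\<^esub> a k \<lhd>\<^bsub>M\<^esub> (b k \<otimes>\<^bsub>A\<^esub> c)) = (\<Oplus>\<^bsub>M\<^esub> k\<in>K. x \<lhd>\<^bsub>M\<^esub> (a k \<otimes>\<^bsub>A\<^esub> b k \<otimes>\<^bsub>A\<^esub> c))"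
      using x c by (intro M.M.finsum_cong')
        (auto simp: a_closed b_closed M.ract_mult M.ract_closed A.m_assoc)
    also have "\<dots> = x \<lhd>\<^bsub>M\<^esub> (\<Oplus>\<^bsub>A\<^esub> k\<in>K. a k \<otimes>\<^bsub>A\<^esub> b k \<otimes>\<^bsub>A\<^esub> c)"
      using x c by (intro M.ract_finsum[symmetric] finite_K) (auto simp: a_closed b_closed)
    also have "(\<Oplus>\<^bsub>A\<^esub> k\<in>K. a k \<otimes>\<^bsub>A\<^esub> b k \<otimes>\<^bsub>A\<^esub> c) = (\<Oplus>\<^bsub>A\<^esub> k\<in>K. a k \<otimes>\<^bsub>A\<^esub> b k) \<otimes>\<^bsub>A\<^esub> c"
      using c by (intro A.finsum_ldistr[symmetric] finite_K) (auto simp: a_closed b_closed)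
    finally show ?thesis using c by (simp add: sum_ab)
  qed
  have "f \<in> rmod_hom A M N"
  proof (rule rmod_homI)
    show "f \<in> carrier M \<rightarrow>\<^sub>E carrier N" using f_closed by (auto simp: f_def)
  next
    fix x y assume "x \<in> carrier M" "y \<in> carrier M"
    with cM show "f (x \<oplus>\<^bsub>M\<^esub> y) = f x \<oplus>\<^bsub>N\<^esub> f y"
      by (rule_tac corner_separates[OF N]) (simp_all add: f_closed f_c N.ract_add_left M.ract_add_left h_add)
  next
    fix x y assume "x \<in> carrier M" "y \<in> carrier A"
    then show "f (x \<lhd>\<^bsub>M\<^esub> y) = f x \<lhd>\<^bsub>N\<^esub> y"
      by (rule_tac corner_separates[OF N])
        (simp_all add: f_closed f_c N.ract_mult[symmetric] M.ract_mult[symmetric] M.ract_closed N.ract_closed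
          A.m_assoc e_closed)
  qed
  moreover have "restrict f (carrier (corner_mod M)) = h"
  proof (rule extensionalityI)
    fix x assume x: "x \<in> carrier (corner_mod M)"
    then have x': "x \<in> carrier M" "x \<lhd>\<^bsub>M\<^esub> e = x" by (auto simp: corner_mod_def)
    show "restrict f (carrier (corner_mod M)) x = h x"
    proof -
      have "f x = f (x \<lhd>\<^bsub>M\<^esub> e)" using x' by simp
      also have "\<dots> = f x \<lhd>\<^bsub>N\<^esub> e"
        using x' e_closed by (intro rmod_hom_ract[OF \<open>f \<in> rmod_hom A M N\<close>])
      also have "\<dots> = h x" using f_c[OF x'(1) e_closed e_e] x' by simp
      finally show ?thesis using x by simp
    qed
  qed (use rmod_hom_PiE[OF h] in \<open>auto simp: PiE_def\<close>)
  ultimately show ?thesis by blast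
qed

text \<open>The inverse functor is \<open>V \<mapsto> Hom\<^sub>B(Ae, V)\<close>, which is isomorphic to \<open>V \<otimes>\<^sub>B eA\<close>. A homomorphism on \<open>Ae\<close> is
  determined by its values at the finitely many \<open>a\<^sub>k\<close>, so this module can be coded in the universe of \<open>V\<close>.\<close>

definition coind :: "('b, 'u) rmod \<Rightarrow> ('a, 'a \<Rightarrow> 'u) rmod" where
  "coind V = (let Ae = {x \<in> carrier A. x \<otimes>\<^bsub>A\<^esub> e = x} in
     \<lparr>carrier = {f \<in> Ae \<rightarrow>\<^sub>E carrier V.
        (\<forall>x\<in>Ae. \<forall>y\<in>Ae. f (x \<oplus>\<^bsub>A\<^esub> y) = f x \<oplus>\<^bsub>V\<^esub> f y) \<and>
        (\<forall>x\<in>Ae. \<forall>y\<in>carrier B. f (x \<otimes>\<^bsub>A\<^esub> j y) = f x \<lhd>\<^bsub>V\<^esub> y)},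
      mult = undefined, one = undefined, zero = (\<lambda>x\<in>Ae. \<zero>\<^bsub>V\<^esub>),
      add = (\<lambda>f g. \<lambda>x\<in>Ae. f x \<oplus>\<^bsub>V\<^esub> g x),
      ract = (\<lambda>f y. \<lambda>x\<in>Ae. f (y \<otimes>\<^bsub>A\<^esub> x))\<rparr>)"

lemma right_module_coind:
  assumes "right_module B V"
  shows "right_module A (coind V)"
proof -
  interpret V: right_module B V by fact
  define Ae where "Ae = {x \<in> carrier A. x \<otimes>\<^bsub>A\<^esub> e = x}"
  have Ae: "x \<in> Ae \<Longrightarrow> x \<in> carrier A" "\<lbrakk>x \<in> Ae; y \<in> Ae\<rbrakk> \<Longrightarrow> x \<oplus>\<^bsub>A\<^esub> y \<in> Ae"
    "\<lbrakk>x \<in> Ae; y \<in> carrier A\<rbrakk> \<Longrightarrow> y \<otimes>\<^bsub>A\<^esub> x \<in> Ae" "\<lbrakk>x \<in> Ae; z \<in> carrier B\<rbrakk> \<Longrightarrow> x \<otimes>\<^bsub>A\<^esub> j z \<in> Ae" for x y z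
    by (auto simp: Ae_def A.l_distr e_closed A.m_assoc j_closed j_e)
  note [simp] = Ae PiE_iff V.ract_closed Let_def coind_def Ae_def[symmetric]
  show ?thesis
  proof (rule right_moduleI)
    fix f assume "f \<in> carrier (coind V)"
    then show "\<exists>g\<in>carrier (coind V). g \<oplus>\<^bsub>coind V\<^esub> f = \<zero>\<^bsub>coind V\<^esub>"
      by (intro bexI[of _ "\<lambda>x\<in>Ae. \<ominus>\<^bsub>V\<^esub> f x"])
        (auto simp: V.M.l_neg V.M.minus_add V.ract_minus_left intro!: restrict_ext)
  next
    fix f assume f: "f \<in> carrier (coind V)"
    show "\<zero>\<^bsub>coind V\<^esub> \<oplus>\<^bsub>coind V\<^esub> f = f" "f \<lhd>\<^bsub>coind V\<^esub> \<one>\<^bsub>A\<^esub> = f"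
      using f by (auto simp: PiE_iff intro!: extensionalityI[of _ Ae])
  next
    fix f g assume f: "f \<in> carrier (coind V)" and g: "g \<in> carrier (coind V)"
    then show "f \<oplus>\<^bsub>coind V\<^esub> g \<in> carrier (coind V)"
      by (auto simp: V.M.a_ac V.ract_add_left)
    show "f \<oplus>\<^bsub>coind V\<^esub> g = g \<oplus>\<^bsub>coind V\<^esub> f"
      using f g by (auto simp: V.M.a_comm intro!: restrict_ext)
  next
    fix f y assume f: "f \<in> carrier (coind V)" and y: "y \<in> carrier A"
    then show "f \<lhd>\<^bsub>coind V\<^esub> y \<in> carrier (coind V)"
      by (auto simp: A.r_distr A.m_assoc[symmetric] j_closed)
  next
    fix f x y assume f: "f \<in> carrier (coind V)" and y: "x \<in> carrier A" "y \<in> carrier A"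
    show "f \<lhd>\<^bsub>coind V\<^esub> (x \<oplus>\<^bsub>A\<^esub> y) = (f \<lhd>\<^bsub>coind V\<^esub> x) \<oplus>\<^bsub>coind V\<^esub> (f \<lhd>\<^bsub>coind V\<^esub> y)"
      using f y by (auto simp: A.l_distr intro!: restrict_ext)
    show "f \<lhd>\<^bsub>coind V\<^esub> (x \<otimes>\<^bsub>A\<^esub> y) = (f \<lhd>\<^bsub>coind V\<^esub> x) \<lhd>\<^bsub>coind V\<^esub> y"
      using f y by (auto simp: A.m_assoc intro!: restrict_ext)
  qed (auto simp: V.M.a_assoc V.ract_zero_left A.ring_axioms intro!: restrict_ext)
qed

text \<open>The a_k generate Ae as a right \<open>B\<close>-module: x is the sum of the a_k (b_k x),
  and b_k x lies in eAe for x in Ae.\<close>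

lemma coind_eqI:
  assumes V: "right_module B V" and f: "f \<in> carrier (coind V)" and g: "g \<in> carrier (coind V)"
    and eq: "\<And>k. k \<in> K \<Longrightarrow> f (a k) = g (a k)"
  shows "f = g"
proof -
  interpret V: right_module B V by fact
  define Ae where "Ae = {x \<in> carrier A. x \<otimes>\<^bsub>A\<^esub> e = x}"
  have zero_V: "u = \<zero>\<^bsub>V\<^esub>" if "u \<in> carrier V" "u \<oplus>\<^bsub>V\<^esub> u = u" for u
    using that V.M.add.l_cancel_one by simp
  have Ae_add: "\<lbrakk>x \<in> Ae; y \<in> Ae\<rbrakk> \<Longrightarrow> x \<oplus>\<^bsub>A\<^esub> y \<in> Ae" and Ae_zero: "\<zero>\<^bsub>A\<^esub> \<in> Ae" for x y
    by (auto simp: Ae_def A.l_distr e_closed)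
  have exp: "h x = (\<Oplus>\<^bsub>V\<^esub> k\<in>K. h (a k) \<lhd>\<^bsub>V\<^esub> p (b k \<otimes>\<^bsub>A\<^esub> x))"
    if h: "h \<in> carrier (coind V)" and x: "x \<in> Ae" for h x
  proof -
    have hcl: "\<And>y. y \<in> Ae \<Longrightarrow> h y \<in> carrier V"
      and hadd: "\<And>y z. \<lbrakk>y \<in> Ae; z \<in> Ae\<rbrakk> \<Longrightarrow> h (y \<oplus>\<^bsub>A\<^esub> z) = h y \<oplus>\<^bsub>V\<^esub> h z"
      and hj: "\<And>y z. \<lbrakk>y \<in> Ae; z \<in> carrier B\<rbrakk> \<Longrightarrow> h (y \<otimes>\<^bsub>A\<^esub> j z) = h y \<lhd>\<^bsub>V\<^esub> z"
      using h by (auto simp: coind_def Let_def Ae_def[symmetric])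
    have xA: "x \<in> carrier A" "x \<otimes>\<^bsub>A\<^esub> e = x" using x by (auto simp: Ae_def)
    have abx: "a k \<otimes>\<^bsub>A\<^esub> b k \<otimes>\<^bsub>A\<^esub> x = a k \<otimes>\<^bsub>A\<^esub> j (p (b k \<otimes>\<^bsub>A\<^esub> x))" if "k \<in> K" for k
    proof -
      have "j (p (b k \<otimes>\<^bsub>A\<^esub> x)) = (e \<otimes>\<^bsub>A\<^esub> b k) \<otimes>\<^bsub>A\<^esub> (x \<otimes>\<^bsub>A\<^esub> e)"
        using that xA(1) by (simp add: j_p b_closed e_closed A.m_assoc)
      then show ?thesis using that xA by (simp add: e_b a_closed b_closed A.m_assoc)
    qed
    have aAe: "a k \<in> Ae" if "k \<in> K" for k using that by (simp add: Ae_def a_closed a_e)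
    have mem: "a k \<otimes>\<^bsub>A\<^esub> b k \<otimes>\<^bsub>A\<^esub> x \<in> Ae" if "k \<in> K" for k
      using that xA by (simp add: Ae_def a_closed b_closed A.m_assoc e_closed)
    have "x = (\<Oplus>\<^bsub>A\<^esub> k\<in>K. a k \<otimes>\<^bsub>A\<^esub> b k) \<otimes>\<^bsub>A\<^esub> x" using xA by (simp add: sum_ab)
    also have "\<dots> = (\<Oplus>\<^bsub>A\<^esub> k\<in>K. a k \<otimes>\<^bsub>A\<^esub> b k \<otimes>\<^bsub>A\<^esub> x)"
      using xA by (intro A.finsum_ldistr finite_K) (auto simp: a_closed b_closed)
    finally have "h x = h (\<Oplus>\<^bsub>A\<^esub> k\<in>K. a k \<otimes>\<^bsub>A\<^esub> b k \<otimes>\<^bsub>A\<^esub> x)" by simp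
    also have "\<dots> = (\<Oplus>\<^bsub>V\<^esub> k\<in>K. h (a k \<otimes>\<^bsub>A\<^esub> b k \<otimes>\<^bsub>A\<^esub> x))"
      using mem hadd[of "\<zero>\<^bsub>A\<^esub>" "\<zero>\<^bsub>A\<^esub>"]
      by (intro finsum_additive_on(2)[where S = Ae])
        (auto simp: hcl hadd Ae_add Ae_zero finite_K A.abelian_monoid_axioms V.M.abelian_monoid_axioms
          intro: zero_V, auto simp: Ae_def)
    also have "\<dots> = (\<Oplus>\<^bsub>V\<^esub> k\<in>K. h (a k) \<lhd>\<^bsub>V\<^esub> p (b k \<otimes>\<^bsub>A\<^esub> x))"
      using xA by (intro V.M.finsum_cong')
        (auto simp: abx hj aAe hcl p_closed b_closed intro!: V.ract_closed)
    finally show ?thesis .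
  qed
  show ?thesis
  proof (rule extensionalityI[of _ Ae])
    fix x assume "x \<in> Ae"
    moreover from this have "(\<Oplus>\<^bsub>V\<^esub> k\<in>K. f (a k) \<lhd>\<^bsub>V\<^esub> p (b k \<otimes>\<^bsub>A\<^esub> x)) = (\<Oplus>\<^bsub>V\<^esub> k\<in>K. g (a k) \<lhd>\<^bsub>V\<^esub> p (b k \<otimes>\<^bsub>A\<^esub> x))"
      using g by (intro V.M.finsum_cong')
        (auto simp: eq a_closed b_closed a_e p_closed Ae_def coind_def Let_def PiE_iff intro!: V.ract_closed)
    ultimately show "f x = g x" using exp[OF f] exp[OF g] by simp
  qed (use f g in \<open>auto simp: coind_def Let_def Ae_def[symmetric] PiE_iff\<close>)
qed

text \<open>The isomorphism from V to Hom_B(Ae, V)e sends v to the map x -> v (ex), with inverse the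
  evaluation at \<open>e\<close>. The map \<open>c\<close> codes a homomorphism by the tuple of its
  values at the a_k and so moves the coinduced module into \<open>'u\<close>.\<close>

lemma corner_mod_ess_surj:
  fixes V :: "('b, 'u::infinite) rmod"
  assumes V: "right_module B V"
  shows "\<exists>M::('a, 'u) rmod. right_module A M \<and> (\<exists>h. is_iso (RMod U B) (corner_mod M) V h)"
proof -
  interpret V: right_module B V by fact
  interpret N: right_module A "coind V" by (rule right_module_coind[OF V])
  define Ae where "Ae = {x \<in> carrier A. x \<otimes>\<^bsub>A\<^esub> e = x}"
  have Ae_add: "\<lbrakk>x \<in> Ae; y \<in> Ae\<rbrakk> \<Longrightarrow> x \<oplus>\<^bsub>A\<^esub> y \<in> Ae" and Ae_mult: "\<lbrakk>x \<in> Ae; y \<in> carrier A\<rbrakk> \<Longrightarrow> y \<otimes>\<^bsub>A\<^esub> x \<in> Ae"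
    and Ae_A: "x \<in> Ae \<Longrightarrow> x \<in> carrier A" and Ae_j: "\<lbrakk>x \<in> Ae; z \<in> carrier B\<rbrakk> \<Longrightarrow> x \<otimes>\<^bsub>A\<^esub> j z \<in> Ae"
    and Ae_e: "e \<in> Ae" for x y z
    by (auto simp: Ae_def A.l_distr e_closed A.m_assoc j_closed j_e e_e)
  obtain c0 :: "('k \<Rightarrow> 'u) \<Rightarrow> 'u" where c0: "inj_on c0 (extensional K)"
    using infinite_inj_on_extensional[OF finite_K infinite_UNIV] by blast
  define c where "c f = c0 (\<lambda>k\<in>K. f (a k))" for f :: "'a \<Rightarrow> 'u"
  have c: "inj_on c (carrier (coind V))"
  proof (rule inj_onI)
    fix f g assume f: "f \<in> carrier (coind V)" and g: "g \<in> carrier (coind V)" and "c f = c g"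
    then have "(\<lambda>k\<in>K. f (a k)) = (\<lambda>k\<in>K. g (a k))"
      using c0 by (auto simp: c_def inj_on_def)
    then show "f = g" by (intro coind_eqI[OF V f g]) (metis restrict_apply')
  qed
  define M where "M = transport c (coind V)"
  define F where "F v = (\<lambda>x\<in>Ae. v \<lhd>\<^bsub>V\<^esub> p x)" for v
  have F: "F v \<in> carrier (coind V)" if "v \<in> carrier V" for v
    using that by (auto simp: F_def coind_def Let_def Ae_def[symmetric] V.ract_closed p_closed Ae_A
      Ae_add Ae_j p_add V.ract_add_right p_mult_j V.ract_mult)
  have M: "right_module A M" unfolding M_def by (rule right_module_transport[OF N.right_module_axioms c])
  have F_ract: "F v \<lhd>\<^bsub>coind V\<^esub> j y = F (v \<lhd>\<^bsub>V\<^esub> y)" if "v \<in> carrier V" "y \<in> carrier B" for v y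
    using that by (auto simp: F_def coind_def Let_def Ae_def[symmetric] Ae_mult Ae_A j_closed p_j_mult
      V.ract_mult p_closed intro!: restrict_ext)
  have F_e: "F v \<lhd>\<^bsub>coind V\<^esub> e = F v" if "v \<in> carrier V" for v
    using F_ract[OF that B.one_closed] that by (simp add: j_one V.ract_one)
  have F_mem: "c (F v) \<in> carrier (corner_mod M)" if "v \<in> carrier V" for v
    using that by (simp add: M_def corner_mod_def carrier_transport transport_ract[OF c] F F_e)
  have hom: "(\<lambda>v\<in>carrier V. c (F v)) \<in> rmod_hom B V (corner_mod M)"
  proof (rule rmod_homI)
    fix u v assume uv: "u \<in> carrier V" "v \<in> carrier V"
    have "F u \<oplus>\<^bsub>coind V\<^esub> F v = F (u \<oplus>\<^bsub>V\<^esub> v)"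
      using uv by (auto simp: F_def coind_def Let_def Ae_def[symmetric] Ae_A V.ract_add_left p_closed intro!: restrict_ext)
    then show "(\<lambda>v\<in>carrier V. c (F v)) (u \<oplus>\<^bsub>V\<^esub> v) =
        (\<lambda>v\<in>carrier V. c (F v)) u \<oplus>\<^bsub>corner_mod M\<^esub> (\<lambda>v\<in>carrier V. c (F v)) v"
      using uv by (simp add: corner_mod_def M_def transport_add[OF c] F)
  qed (simp_all add: F_mem V.ract_closed, simp add: corner_mod_def M_def transport_ract[OF c] F F_ract)
  have "bij_betw (\<lambda>v\<in>carrier V. c (F v)) (carrier V) (carrier (corner_mod M))"
  proof (rule bij_betw_imageI)
    show "inj_on (\<lambda>v\<in>carrier V. c (F v)) (carrier V)"
    proof (rule inj_onI)
      fix u v assume uv: "u \<in> carrier V" "v \<in> carrier V"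
        and "(\<lambda>v\<in>carrier V. c (F v)) u = (\<lambda>v\<in>carrier V. c (F v)) v"
      then have "F u = F v" using c F by (simp add: inj_on_def)
      then have "F u e = F v e" by simp
      then show "u = v" using uv by (simp add: F_def Ae_e p_e V.ract_one)
    qed
    have "y \<in> (\<lambda>v\<in>carrier V. c (F v)) ` carrier V" if "y \<in> carrier (corner_mod M)" for y
    proof -
      from that obtain f where f: "f \<in> carrier (coind V)" "y = c f" "c (f \<lhd>\<^bsub>coind V\<^esub> e) = c f"
        by (auto simp: corner_mod_def M_def carrier_transport transport_ract[OF c])
      have f_e: "f \<lhd>\<^bsub>coind V\<^esub> e = f" using inj_onD[OF c, OF f(3)] f(1) N.ract_closed[OF _ e_closed] by blast
      have fe: "f e \<in> carrier V" using f(1) Ae_e by (auto simp: coind_def Let_def Ae_def[symmetric])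
      have "f = F (f e)"
      proof (rule extensionalityI[of _ Ae])
        fix x assume x: "x \<in> Ae"
        have "f x = (f \<lhd>\<^bsub>coind V\<^esub> e) x" by (simp add: f_e)
        also have "\<dots> = f (e \<otimes>\<^bsub>A\<^esub> x)" using x by (simp add: coind_def Let_def Ae_def[symmetric])
        \<comment> \<open>Since ex = e (ex) with ex in eAe, \<open>B\<close>-linearity computes the
          value at ex from the value at \<open>e\<close>.\<close>
        also have "e \<otimes>\<^bsub>A\<^esub> x = e \<otimes>\<^bsub>A\<^esub> j (p x)"
        proof -
          have "x \<otimes>\<^bsub>A\<^esub> e = x" using x by (simp add: Ae_def)
          then have "j (p x) = e \<otimes>\<^bsub>A\<^esub> x" using Ae_A[OF x] by (simp add: j_p A.m_assoc e_closed)
          then show ?thesis using Ae_A[OF x] by (simp add: A.m_assoc[symmetric] e_closed e_e)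
        qed
        also have "f \<dots> = f e \<lhd>\<^bsub>V\<^esub> p x"
          using f(1) Ae_e p_closed[OF Ae_A[OF x]] by (auto simp: coind_def Let_def Ae_def[symmetric])
        finally show "f x = F (f e) x" using x by (simp add: F_def)
      qed (use f(1) in \<open>auto simp: F_def coind_def Let_def Ae_def[symmetric] PiE_iff\<close>)
      then show ?thesis using fe f(2) by (intro image_eqI[of _ _ "f e"]) auto
    qed
    then show "(\<lambda>v\<in>carrier V. c (F v)) ` carrier V = carrier (corner_mod M)"
      using F_mem by auto
  qed
  from is_iso_inverse[OF is_iso_RModI[OF V hom this]] M show ?thesis by blast
qed

theorem Morita_equivalent_corner: "Morita_equivalent TYPE('u::infinite) A B"
proof -
  have "equivalent_categories (RMod TYPE('u) A) (RMod TYPE('u) B)"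
  proof (rule equivalent_categories_if_fully_faithful_ess_surj[OF category_RMod category_RMod
        is_functor_corner_mod])
    fix Y assume "Y \<in> Obj (RMod TYPE('u) B)"
    then show "\<exists>X\<in>Obj (RMod TYPE('u) A). \<exists>h. is_iso (RMod TYPE('u) B) (corner_mod X) Y h"
      using corner_mod_ess_surj by (auto simp: RMod_def)
  qed (use corner_mod_faithful corner_mod_full in \<open>auto simp: RMod_def\<close>)
  then show ?thesis by (simp add: Morita_equivalent_def A.ring_axioms B.ring_axioms)
qed

end

section \<open>Corners of endomorphism rings\<close>

lemma End_ring_simps:
  "carrier (End_ring H M) = rmod_hom H M M"
  "f \<otimes>\<^bsub>End_ring H M\<^esub> g = compose (carrier M) f g"
  "f \<oplus>\<^bsub>End_ring H M\<^esub> g = (\<lambda>x\<in>carrier M. f x \<oplus>\<^bsub>M\<^esub> g x)"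
  "\<one>\<^bsub>End_ring H M\<^esub> = (\<lambda>x\<in>carrier M. x)"
  "\<zero>\<^bsub>End_ring H M\<^esub> = (\<lambda>x\<in>carrier M. \<zero>\<^bsub>M\<^esub>)"
  by (simp_all add: End_ring_def)

lemma finsum_End_ring_apply:
  assumes M: "right_module H M" and K: "finite K" and F: "F \<in> K \<rightarrow> rmod_hom H M M" and x: "x \<in> carrier M"
  shows "finsum (End_ring H M) F K x = (\<Oplus>\<^bsub>M\<^esub> k\<in>K. F k x)"
proof -
  interpret M: right_module H M by fact
  interpret E: ring "End_ring H M" by (rule ring_End_ring[OF M])
  show ?thesis
    using K F x
    by (intro finsum_additive_on(2)[where S = "rmod_hom H M M" and f = "\<lambda>\<phi>. \<phi> x"])
      (auto simp: E.abelian_monoid_axioms M.M.abelian_monoid_axioms End_ring_simps rmod_hom_closed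
        E.zero_closed[unfolded End_ring_simps] E.a_closed[unfolded End_ring_simps])
qed

text \<open>\<open>N\<close> is a retract of \<open>M\<close>, and the \<open>f k\<close> and
  \<open>g k\<close> make \<open>M\<close> a retract of a finite sum of copies of \<open>N\<close>.
  With e = \<iota>\<rho>, the map \<phi> -> \<iota>\<phi>\<rho> identifies End(N) with the corner of
  End(M) at e. The corner is full because \<rho>\<iota> = 1 turns (f_k \<rho>)(\<iota> g_k) into f_k
  g_k.\<close>

lemma Morita_equivalent_End_ring:
  fixes M :: "('a, 'm) rmod" and N :: "('a, 'n) rmod"
  assumes M: "right_module H M" and N: "right_module H N"
    and \<iota>: "\<iota> \<in> rmod_hom H N M" and \<rho>: "\<rho> \<in> rmod_hom H M N"
    and \<rho>\<iota>: "\<And>x. x \<in> carrier N \<Longrightarrow> \<rho> (\<iota> x) = x"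
    and K: "finite K"
    and f: "\<And>k. k \<in> K \<Longrightarrow> f k \<in> rmod_hom H N M" and g: "\<And>k. k \<in> K \<Longrightarrow> g k \<in> rmod_hom H M N"
    and sum: "\<And>x. x \<in> carrier M \<Longrightarrow> (\<Oplus>\<^bsub>M\<^esub> k\<in>K. f k (g k x)) = x"
  shows "Morita_equivalent TYPE('u::infinite) (End_ring H M) (End_ring H N)"
proof -
  interpret M: right_module H M by fact
  interpret N: right_module H N by fact
  interpret EM: ring "End_ring H M" by (rule ring_End_ring[OF M])
  interpret EN: ring "End_ring H N" by (rule ring_End_ring[OF N])
  note closed [simp] = rmod_hom_closed[OF \<iota>] rmod_hom_closed[OF \<rho>] rmod_hom_closed[OF f] rmod_hom_closed[OF g]
  have comp: "(\<lambda>x\<in>carrier L. v (u x)) \<in> rmod_hom H L Q"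
    if "right_module H L" "u \<in> rmod_hom H L P" "v \<in> rmod_hom H P Q"
    for L :: "('a, 'x) rmod" and P :: "('a, 'y) rmod" and Q :: "('a, 'z) rmod" and u v
    using rmod_hom_compose[OF that] by (simp add: compose_def)
  define j where "j \<phi> = (\<lambda>x\<in>carrier M. \<iota> (\<phi> (\<rho> x)))" for \<phi>
  define e where "e = (\<lambda>x\<in>carrier M. \<iota> (\<rho> x))"
  define a where "a k = (\<lambda>x\<in>carrier M. f k (\<rho> x))" for k
  define b where "b k = (\<lambda>x\<in>carrier M. \<iota> (g k x))" for k
  have j: "j \<phi> \<in> rmod_hom H M M" if "\<phi> \<in> rmod_hom H N N" for \<phi>
    using comp[OF M comp[OF M \<rho> that] \<iota>] by (simp add: j_def restrict_def cong: if_cong)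
  have a: "a k \<in> rmod_hom H M M" if "k \<in> K" for k
    unfolding a_def by (rule comp[OF M \<rho> f[OF that]])
  have b: "b k \<in> rmod_hom H M M" if "k \<in> K" for k
    unfolding b_def by (rule comp[OF M g[OF that] \<iota>])
  have "full_corner (End_ring H M) (End_ring H N) j e K a b"
  proof (unfold_locales, goal_cases)
    case (1 \<phi>)
    then show ?case using j by (simp add: End_ring_simps)
  next
    case 2
    show ?case
    proof (rule inj_onI)
      fix \<phi> \<psi> assume \<phi>: "\<phi> \<in> carrier (End_ring H N)" and \<psi>: "\<psi> \<in> carrier (End_ring H N)" and eq: "j \<phi> = j \<psi>"
      show "\<phi> = \<psi>"
      proof (rule rmod_hom_eqI)
        fix x assume x: "x \<in> carrier N"
        have "\<rho> (j \<phi> (\<iota> x)) = \<rho> (j \<psi> (\<iota> x))" by (simp add: eq)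
        then show "\<phi> x = \<psi> x"
          using x \<phi> \<psi> by (simp add: j_def \<rho>\<iota> End_ring_simps rmod_hom_closed)
      qed (use \<phi> \<psi> in \<open>simp_all add: End_ring_simps\<close>)
    qed
  next
    case (3 \<phi> \<psi>)
    then show ?case
      by (auto simp: End_ring_simps j_def rmod_hom_closed rmod_hom_add[OF \<iota>] intro!: restrict_ext)
  next
    case (4 \<phi> \<psi>)
    then show ?case
      by (auto simp: End_ring_simps j_def compose_def rmod_hom_closed \<rho>\<iota> intro!: restrict_ext)
  next
    case 5
    then show ?case by (auto simp: End_ring_simps j_def e_def intro!: restrict_ext)
  next
    case (6 \<phi>)
    then have \<phi>: "\<phi> \<in> rmod_hom H M M" by (simp add: End_ring_simps)
    have "(\<lambda>x\<in>carrier N. \<rho> (\<phi> (\<iota> x))) \<in> rmod_hom H N N"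
      using comp[OF N comp[OF N \<iota> \<phi>] \<rho>] by (simp add: restrict_def cong: if_cong)
    moreover have "e \<otimes>\<^bsub>End_ring H M\<^esub> \<phi> \<otimes>\<^bsub>End_ring H M\<^esub> e = j (\<lambda>x\<in>carrier N. \<rho> (\<phi> (\<iota> x)))"
      using \<phi> by (auto simp: End_ring_simps j_def e_def compose_def rmod_hom_closed intro!: restrict_ext)
    ultimately show ?case by (auto simp: End_ring_simps)
  next
    case 7
    show ?case by (rule K)
  next
    case (8 k)
    then show ?case using a by (simp add: End_ring_simps)
  next
    case (9 k)
    then show ?case using b by (simp add: End_ring_simps)
  next
    case (10 k)
    then show ?case by (auto simp: End_ring_simps compose_def a_def e_def \<rho>\<iota> intro!: restrict_ext)
  next
    case (11 k)
    then show ?case by (auto simp: End_ring_simps compose_def b_def e_def \<rho>\<iota> intro!: restrict_ext)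
  next
    case 12
    have ab: "a k \<otimes>\<^bsub>End_ring H M\<^esub> b k = (\<lambda>x\<in>carrier M. f k (g k x))" if "k \<in> K" for k
      using that by (auto simp: End_ring_simps a_def b_def compose_def \<rho>\<iota> intro!: restrict_ext)
    have ab_hom: "(\<lambda>k. a k \<otimes>\<^bsub>End_ring H M\<^esub> b k) \<in> K \<rightarrow> carrier (End_ring H M)"
      using a b by (auto simp: End_ring_simps(1) intro!: EM.m_closed[unfolded End_ring_simps(1)])
    show ?case
    proof (rule rmod_hom_eqI)
      fix x assume x: "x \<in> carrier M"
      have "(\<Oplus>\<^bsub>End_ring H M\<^esub> k\<in>K. a k \<otimes>\<^bsub>End_ring H M\<^esub> b k) x = (\<Oplus>\<^bsub>M\<^esub> k\<in>K. f k (g k x))"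
        using ab_hom x
        by (subst finsum_End_ring_apply[OF M K]) (auto simp: End_ring_simps(1) ab intro!: M.M.finsum_cong')
      then show "(\<Oplus>\<^bsub>End_ring H M\<^esub> k\<in>K. a k \<otimes>\<^bsub>End_ring H M\<^esub> b k) x = \<one>\<^bsub>End_ring H M\<^esub> x"
        using x by (simp add: sum End_ring_simps)
    qed (use EM.finsum_closed[OF ab_hom] EM.one_closed in \<open>simp_all only: End_ring_simps(1)\<close>)
  qed
  then interpret full_corner "End_ring H M" "End_ring H N" j e K a b .
  show ?thesis by (rule Morita_equivalent_corner)
qed

text \<open>\<open>F k\<close> and \<open>G k\<close> factor the projection to the coordinate
  \<open>k\<close> through the coordinate \<open>m k\<close> of the small sum, and the coordinate
  projections add up to the identity. Different \<open>k\<close> may share the same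
  \<open>m k\<close>.\<close>

lemma Morita_equivalent_direct_sum_retracts:
  fixes M :: "'i \<Rightarrow> ('a, 'm) rmod"
  assumes H: "ring H" and M: "\<And>i. i \<in> I \<Longrightarrow> right_module H (M i)" and I: "finite I" and J: "J \<subseteq> I"
    and m: "\<And>i. i \<in> I \<Longrightarrow> m i \<in> J"
    and f: "\<And>i. i \<in> I \<Longrightarrow> f i \<in> rmod_hom H (M (m i)) (M i)"
    and g: "\<And>i. i \<in> I \<Longrightarrow> g i \<in> rmod_hom H (M i) (M (m i))"
    and fg: "\<And>i x. \<lbrakk>i \<in> I; x \<in> carrier (M i)\<rbrakk> \<Longrightarrow> f i (g i x) = x"
  shows "Morita_equivalent TYPE('u::infinite) (End_ring H (direct_sum I M)) (End_ring H (direct_sum J M))"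
proof -
  have ab: "abelian_monoid (M i)" if "i \<in> I" for i
    using M[OF that] by (intro abelian_group.axioms(1)) (rule right_module.axioms)
  have mI: "m i \<in> I" if "i \<in> I" for i using m[OF that] J by blast
  have MI: "right_module H (direct_sum I M)" by (rule right_module_direct_sum[OF H M])
  have MJ: "right_module H (direct_sum J M)" by (rule right_module_direct_sum[OF H M]) (use J in blast)
  note zero [simp] = abelian_monoid.zero_closed[OF ab] abelian_monoid.l_zero[OF ab]
    right_module.ract_zero_left[OF M]
  define \<iota> where "\<iota> = (\<lambda>u\<in>carrier (direct_sum J M). \<lambda>i\<in>I. if i \<in> J then u i else \<zero>\<^bsub>M i\<^esub>)"
  define \<rho> where "\<rho> = (\<lambda>u\<in>carrier (direct_sum I M). restrict u J)"
  define F where "F k = (\<lambda>u\<in>carrier (direct_sum J M). \<lambda>i\<in>I. if i = k then f k (u (m k)) else \<zero>\<^bsub>M i\<^esub>)" for k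
  define G where "G k = (\<lambda>u\<in>carrier (direct_sum I M). \<lambda>i\<in>J. if i = m k then g k (u k) else \<zero>\<^bsub>M i\<^esub>)" for k
  have ds: "carrier (direct_sum S M) = (\<Pi>\<^sub>E i\<in>S. carrier (M i))"
    "u \<oplus>\<^bsub>direct_sum S M\<^esub> v = (\<lambda>i\<in>S. u i \<oplus>\<^bsub>M i\<^esub> v i)"
    "u \<lhd>\<^bsub>direct_sum S M\<^esub> x = (\<lambda>i\<in>S. u i \<lhd>\<^bsub>M i\<^esub> x)"
    "\<zero>\<^bsub>direct_sum S M\<^esub> = (\<lambda>i\<in>S. \<zero>\<^bsub>M i\<^esub>)" for S u v x
    by (simp_all add: direct_sum_def)
  note MI_closed = right_module.ract_closed[OF MI]
    abelian_monoid.a_closed[OF abelian_group.axioms(1)[OF right_module.axioms(2)[OF MI]]]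
  note MJ_closed = right_module.ract_closed[OF MJ]
    abelian_monoid.a_closed[OF abelian_group.axioms(1)[OF right_module.axioms(2)[OF MJ]]]
  have \<iota>: "\<iota> \<in> rmod_hom H (direct_sum J M) (direct_sum I M)"
    by (rule rmod_homI; simp add: \<iota>_def MJ_closed)
      (use J in \<open>auto simp: ds PiE_iff intro!: restrict_ext\<close>)
  have \<rho>: "\<rho> \<in> rmod_hom H (direct_sum I M) (direct_sum J M)"
    by (rule rmod_homI; simp add: \<rho>_def MI_closed)
      (use J in \<open>auto simp: ds PiE_iff Int_absorb1 intro!: restrict_ext\<close>)
  have F: "F k \<in> rmod_hom H (direct_sum J M) (direct_sum I M)" if k: "k \<in> I" for k
    by (rule rmod_homI; simp add: F_def MJ_closed)
      (use k m[OF k] in \<open>auto simp: ds PiE_iff rmod_hom_closed[OF f] rmod_hom_add[OF f] rmod_hom_ract[OF f]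
        intro!: restrict_ext\<close>)
  have G: "G k \<in> rmod_hom H (direct_sum I M) (direct_sum J M)" if k: "k \<in> I" for k
    by (rule rmod_homI; simp add: G_def MI_closed)
      (use k m[OF k] J in \<open>auto simp: ds PiE_iff rmod_hom_closed[OF g] rmod_hom_add[OF g] rmod_hom_ract[OF g]
        subset_iff intro!: restrict_ext\<close>)
  have FG: "F k (G k u) = (\<lambda>i\<in>I. if i = k then u i else \<zero>\<^bsub>M i\<^esub>)"
    if "k \<in> I" "u \<in> carrier (direct_sum I M)" for k u
    using that rmod_hom_closed[OF G[OF that(1)] that(2)]
    by (auto simp: F_def G_def m fg ds PiE_iff intro!: restrict_ext)
  have sum: "(\<Oplus>\<^bsub>direct_sum I M\<^esub> k\<in>S. F k (G k u)) = (\<lambda>i\<in>I. if i \<in> S then u i else \<zero>\<^bsub>M i\<^esub>)"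
    if S: "S \<subseteq> I" and u: "u \<in> carrier (direct_sum I M)" for S u
    using finite_subset[OF S I] S
  proof (induction S)
    case empty
    have "abelian_monoid (direct_sum I M)"
      using MI by (intro abelian_group.axioms(1)) (rule right_module.axioms)
    then show ?case by (simp add: abelian_monoid.finsum_empty ds fun_eq_iff)
  next
    case (insert k S)
    have "(\<lambda>k. F k (G k u)) \<in> S \<rightarrow> carrier (direct_sum I M)" "F k (G k u) \<in> carrier (direct_sum I M)"
      using insert.prems u by (auto intro!: rmod_hom_closed[OF F] rmod_hom_closed[OF G])
    then have "(\<Oplus>\<^bsub>direct_sum I M\<^esub> k\<in>insert k S. F k (G k u)) =
        F k (G k u) \<oplus>\<^bsub>direct_sum I M\<^esub> (\<Oplus>\<^bsub>direct_sum I M\<^esub> k\<in>S. F k (G k u))"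
      using insert.hyps
      by (intro abelian_monoid.finsum_insert abelian_group.axioms(1) right_module.axioms(2)[OF MI]) auto
    also have "\<dots> = (\<lambda>i\<in>I. if i \<in> insert k S then u i else \<zero>\<^bsub>M i\<^esub>)"
      using insert u by (auto simp: FG ds PiE_iff abelian_monoid.r_zero[OF ab] intro!: restrict_ext)
    finally show ?case .
  qed
  show ?thesis
  proof (rule Morita_equivalent_End_ring[OF MI MJ \<iota> \<rho> _ I F G])
    fix u assume u: "u \<in> carrier (direct_sum J M)"
    then show "\<rho> (\<iota> u) = u"
      using rmod_hom_closed[OF \<iota> u] J
      by (auto simp: \<iota>_def \<rho>_def ds PiE_iff subset_iff intro!: extensionalityI[of _ J])
  next
    fix u assume u: "u \<in> carrier (direct_sum I M)"
    show "(\<Oplus>\<^bsub>direct_sum I M\<^esub> k\<in>I. F k (G k u)) = u"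
      using sum[OF subset_refl u] u by (auto simp: ds PiE_iff intro!: extensionalityI[of _ I])
  qed
qed

section \<open>Lengths of signed permutations\<close>

definition signed_points :: "nat \<Rightarrow> int set" where
  "signed_points r = {i. i \<noteq> 0 \<and> \<bar>i\<bar> \<le> int r}"

lemma W_B_iff: "w \<in> carrier (W_B r) \<longleftrightarrow> w permutes signed_points r \<and> (\<forall>i. w (- i) = - w i)"
  by (simp add: W_B_def signed_points_def)

lemma id_W_B: "id \<in> carrier (W_B r)"
  by (simp add: W_B_iff permutes_id)

lemma comp_W_B: "\<lbrakk>v \<in> carrier (W_B r); w \<in> carrier (W_B r)\<rbrakk> \<Longrightarrow> v \<circ> w \<in> carrier (W_B r)"
  by (simp add: W_B_iff permutes_compose)

lemma W_B_inj: "w \<in> carrier (W_B r) \<Longrightarrow> w x = w y \<longleftrightarrow> x = y"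
  by (auto simp: W_B_iff dest: permutes_inj injD)

lemma W_B_uminus: "w \<in> carrier (W_B r) \<Longrightarrow> w (- i) = - w i"
  by (simp add: W_B_iff)

lemma W_B_zero: "w \<in> carrier (W_B r) \<Longrightarrow> w 0 = 0"
  using W_B_uminus[of w r 0] by simp

lemma s_B_zero: "s_B 0 x = (if x = 1 then - 1 else if x = - 1 then 1 else x)"
  by (auto simp: s_B_def transpose_def)

lemma s_B_pos:
  "0 < i \<Longrightarrow> s_B i x = (if x = int i then int i + 1 else if x = int i + 1 then int i
     else if x = - int i then - int i - 1 else if x = - int i - 1 then - int i else x)"
  by (auto simp: s_B_def transpose_def)

lemma s_B_s_B: "s_B i \<circ> s_B i = id"
  by (cases "i = 0") (auto simp: fun_eq_iff s_B_zero s_B_pos)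

lemma s_B_W_B: "i < r \<Longrightarrow> s_B i \<in> carrier (W_B r)"
proof -
  assume i: "i < r"
  have "s_B i permutes signed_points r"
    unfolding s_B_def signed_points_def using i
    by (auto intro!: permutes_compose permutes_swap_id)
  moreover have "s_B i (- x) = - s_B i x" for x
    by (cases "i = 0") (auto simp: s_B_zero s_B_pos)
  ultimately show ?thesis by (simp add: W_B_iff)
qed

text \<open>Every root is counted twice: the roots \<open>e\<^sub>j \<plusminus> e\<^sub>i\<close> by pairs \<open>(i, j)\<close> and \<open>(- j, - i)\<close> of nonzero
  points, the root \<open>e\<^sub>i\<close> by the pairs \<open>(- i, i)\<close> and \<open>(- i, 0)\<close>.\<close>

definition inversions :: "nat \<Rightarrow> (int \<Rightarrow> int) \<Rightarrow> (int \<times> int) set" where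
  "inversions r w = {(i, j). i \<in> signed_points r \<and> j \<in> {- int r..int r} \<and> i < j \<and> w j < w i}"

lemma finite_inversions: "finite (inversions r w)"
  by (rule finite_subset[of _ "{- int r..int r} \<times> {- int r..int r}"])
    (auto simp: inversions_def signed_points_def)

lemma inversions_id [simp]: "inversions r id = {}" "inversions r (\<lambda>x. x) = {}"
  by (auto simp: inversions_def)

text \<open>\<open>w\<close> sends the simple root of \<open>s_B i\<close> to a positive root, the
  simple root being e_1 for i = 0 and e_(i+1) - e_i otherwise; equivalently, right multiplication by
  \<open>s_B i\<close> lengthens \<open>w\<close>.\<close>

definition ascent :: "(int \<Rightarrow> int) \<Rightarrow> nat \<Rightarrow> bool" where
  "ascent w i \<longleftrightarrow> (if i = 0 then 0 < w 1 else w (int i) < w (int i + 1))"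

text \<open>Applying s_i to both entries compares the inversions of w s_i with those of w. Among
  increasing pairs with nonzero first entry, s_i reverses exactly those in \<open>E'\<close>,
  sending them to \<open>E\<close>. As w ascends at i, the pairs in \<open>E'\<close> are not
  inversions of w, while those in \<open>E\<close> are gained. There are two of them because both
  count the one simple root of s_i.\<close>

lemma card_inversions_ascent:
  assumes w: "w \<in> carrier (W_B r)" and i: "i < r" and asc: "ascent w i"
  shows "card (inversions r (w \<circ> s_B i)) = card (inversions r w) + 2"
proof -
  let ?s = "s_B i"
  have s: "?s \<in> carrier (W_B r)" by (rule s_B_W_B[OF i])
  have ss: "?s (?s x) = x" for x using s_B_s_B[of i] by (simp add: fun_eq_iff)
  have s_pts: "?s x \<in> signed_points r \<longleftrightarrow> x \<in> signed_points r" for x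
    using s by (auto simp: W_B_iff permutes_in_image)
  have s_int: "?s x \<in> {- int r..int r} \<longleftrightarrow> x \<in> {- int r..int r}" for x
    using s_pts[of x] W_B_zero[OF s] W_B_inj[OF s, of x 0] by (auto simp: signed_points_def)
  define E where "E = (if i = 0 then {(1 :: int, - 1 :: int), (1, 0)} else {(int i + 1, int i), (- int i, - int i - 1)})"
  define E' where "E' = (if i = 0 then {(- 1 :: int, 1 :: int), (- 1, 0)} else {(int i, int i + 1), (- int i - 1, - int i)})"
  have w_asc: "if i = 0 then w (- 1) < w 0 \<and> w 0 < w 1 \<and> w (- 1) < w 1
    else w (int i) < w (int i + 1) \<and> w (- int i - 1) < w (- int i)"
    using asc W_B_zero[OF w] W_B_uminus[OF w, of 1] W_B_uminus[OF w, of "int i"] W_B_uminus[OF w, of "int i + 1"]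
    by (auto simp: ascent_def)
  have "map_prod ?s ?s ` inversions r (w \<circ> ?s) = inversions r w \<union> E"
  proof -
    have "map_prod ?s ?s ` inversions r (w \<circ> ?s) =
        {(x, y). x \<in> signed_points r \<and> y \<in> {- int r..int r} \<and> ?s x < ?s y \<and> w y < w x}"
    proof (intro equalityI subsetI, goal_cases)
      case (1 z)
      then show ?case by (auto simp: inversions_def s_pts s_int ss simp del: atLeastAtMost_iff)
    next
      case (2 z)
      then have "map_prod ?s ?s z \<in> inversions r (w \<circ> ?s)"
        by (auto simp: inversions_def s_pts s_int ss simp del: atLeastAtMost_iff)
      moreover have "z = map_prod ?s ?s (map_prod ?s ?s z)" by (cases z) (simp add: ss)
      ultimately show ?case by blast
    qed
    also have "\<dots> = inversions r w \<union> E"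
    proof -
      have key: "?s x < ?s y \<longleftrightarrow> x < y \<and> (x, y) \<notin> E' \<or> (x, y) \<in> E" if "x \<noteq> 0" for x y
        using that by (cases "i = 0") (simp_all add: E_def E'_def s_B_zero s_B_pos, presburger+)
      have E_in: "x \<in> signed_points r \<and> y \<in> {- int r..int r} \<and> w y < w x" if "(x, y) \<in> E" for x y
        using that w_asc i by (auto simp: E_def signed_points_def split: if_splits)
      have E'_less: "w x < w y" if "(x, y) \<in> E'" for x y
        using that w_asc by (auto simp: E'_def split: if_splits)
      have "x \<in> signed_points r \<and> y \<in> {- int r..int r} \<and> ?s x < ?s y \<and> w y < w x \<longleftrightarrow>
          (x, y) \<in> inversions r w \<union> E" for x y
      proof (cases "x \<in> signed_points r")
        case True
        then have "x \<noteq> 0" by (simp add: signed_points_def)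
        then show ?thesis
          unfolding key[OF \<open>x \<noteq> 0\<close>] inversions_def using True E_in[of x y] E'_less[of x y] by auto
      next
        case False
        then show ?thesis using E_in[of x y] by (auto simp: inversions_def)
      qed
      then show ?thesis by (intro equalityI subrelI) simp_all
    qed
    finally show ?thesis .
  qed
  moreover have "inj_on (map_prod ?s ?s) (inversions r (w \<circ> ?s))"
    using W_B_inj[OF s] by (auto simp: inj_on_def)
  moreover have "card (inversions r w \<union> E) = card (inversions r w) + 2"
  proof -
    have "inversions r w \<inter> E = {}" by (auto simp: inversions_def E_def split: if_splits)
    moreover have "card E = 2" "finite E" by (auto simp: E_def)
    ultimately show ?thesis by (simp add: card_Un_disjoint finite_inversions)
  qed
  ultimately show ?thesis by (metis card_image)
qed

lemma ascent_s_B: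
  assumes w: "w \<in> carrier (W_B r)" and i: "i < r"
  shows "ascent (w \<circ> s_B i) i \<longleftrightarrow> \<not> ascent w i"
proof (cases "i = 0")
  case True
  have "w 1 \<noteq> 0" using W_B_inj[OF w, of 1 0] W_B_zero[OF w] by simp
  then show ?thesis using True W_B_uminus[OF w, of 1] by (auto simp: ascent_def s_B_zero)
next
  case False
  then show ?thesis using W_B_inj[OF w, of "int i" "int i + 1"] by (auto simp: ascent_def s_B_pos)
qed

text \<open>An increasing self-map of {1..r} is squeezed: induction from below gives i \<le> w(i),
  induction from above w(i) \<le> i. Invariance of {1..r} stands in place of an ascent at 0, which
  suits elements of the symmetric group.\<close>

lemma increasing_imp_id_on:
  assumes w: "w \<in> carrier (W_B r)" and "w ` {1..int r} \<subseteq> {1..int r}"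
    and asc: "\<And>i. \<lbrakk>1 \<le> i; i < r\<rbrakk> \<Longrightarrow> ascent w i"
  shows "w = id"
proof -
  have lower: "int i \<le> w (int i)" if "1 \<le> i" "i \<le> r" for i
    using that
  proof (induction i rule: dec_induct)
    case base
    then show ?case using assms(2) by (force simp: image_subset_iff)
  next
    case (step i)
    then show ?case using asc[of i] by (auto simp: ascent_def add.commute)
  qed
  have upper: "w (int i) \<le> int i" if "1 \<le> i" "i \<le> r" for i
    using that(2,1)
  proof (induction i rule: inc_induct)
    case base
    then show ?case using assms(2) by (force simp: image_subset_iff)
  next
    case (step i)
    then show ?case using asc[of i] by (auto simp: ascent_def add.commute)
  qed
  have pos: "w x = x" if "1 \<le> x" "x \<le> int r" for x
    using lower[of "nat x"] upper[of "nat x"] that by (simp add: nat_le_iff le_nat_iff)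
  have "w x = x" for x
  proof (cases "x \<in> signed_points r")
    case True
    then show ?thesis
      using pos[of x] pos[of "- x"] W_B_uminus[OF w, of x] by (cases "0 < x") (auto simp: signed_points_def)
  next
    case False
    then show ?thesis using w permutes_not_in[of w "signed_points r" x] by (simp add: W_B_iff)
  qed
  then show ?thesis by auto
qed

text \<open>The ascent at 0 starts a chain 0 < w(1) < ... < w(r), so the positive points are
  preserved.\<close>

lemma no_descent_imp_id:
  assumes w: "w \<in> carrier (W_B r)" and asc: "\<And>i. i < r \<Longrightarrow> ascent w i"
  shows "w = id"
proof (rule increasing_imp_id_on[OF w])
  show "w ` {1..int r} \<subseteq> {1..int r}"
  proof
    fix y assume "y \<in> w ` {1..int r}"
    then obtain x where x: "1 \<le> x" "x \<le> int r" "y = w x" by auto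
    have "0 < w (int i)" if "1 \<le> i" "i \<le> r" for i
      using that
    proof (induction i rule: dec_induct)
      case base
      then show ?case using asc[of 0] by (simp add: ascent_def)
    next
      case (step i)
      then show ?case using asc[of i] by (auto simp: ascent_def add.commute)
    qed
    from this[of "nat x"] have "0 < y" using x by simp
    moreover have "y \<in> signed_points r"
      using w x by (simp add: W_B_iff permutes_in_image) (simp add: signed_points_def)
    ultimately show "y \<in> {1..int r}" by (auto simp: signed_points_def)
  qed
qed (use asc in auto)

section \<open>Words in the generators and the length function\<close>

definition word_B :: "nat list \<Rightarrow> int \<Rightarrow> int" where
  "word_B is = foldr (\<lambda>i v. s_B i \<circ> v) is id"

lemma word_B_simps [simp]: "word_B [] = id" "word_B (i # is) = s_B i \<circ> word_B is"
  by (simp_all add: word_B_def)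

lemma word_B_append: "word_B (is @ js) = word_B is \<circ> word_B js"
  by (induction "is") (auto simp: comp_assoc)

lemma word_B_W_B: "set is \<subseteq> {..<r} \<Longrightarrow> word_B is \<in> carrier (W_B r)"
  by (induction "is") (auto simp: id_W_B intro!: comp_W_B s_B_W_B)

lemma card_inversions_step:
  assumes w: "w \<in> carrier (W_B r)" and i: "i < r"
  shows "card (inversions r (w \<circ> s_B i)) \<le> card (inversions r w) + 2"
proof (cases "ascent w i")
  case True
  then show ?thesis using card_inversions_ascent[OF w i] by simp
next
  case False
  then have "card (inversions r (w \<circ> s_B i \<circ> s_B i)) = card (inversions r (w \<circ> s_B i)) + 2"
    by (intro card_inversions_ascent comp_W_B w s_B_W_B i) (simp add: ascent_s_B[OF w i])
  then show ?thesis by (simp add: comp_assoc s_B_s_B)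
qed

lemma card_inversions_word_B: "set is \<subseteq> {..<r} \<Longrightarrow> card (inversions r (word_B is)) \<le> 2 * length is"
proof (induction "is" rule: rev_induct)
  case Nil
  then show ?case by simp
next
  case (snoc i "is")
  then have IH: "card (inversions r (word_B is)) \<le> 2 * length is" by simp
  have eq: "word_B (is @ [i]) = word_B is \<circ> s_B i" unfolding word_B_append by simp
  have "card (inversions r (word_B is \<circ> s_B i)) \<le> card (inversions r (word_B is)) + 2"
    using snoc.prems by (intro card_inversions_step word_B_W_B) auto
  with IH have "card (inversions r (word_B (is @ [i]))) \<le> 2 * length is + 2" unfolding eq by linarith
  then show ?case by simp
qed

text \<open>Greedy construction: multiplying by a descent on the right removes two inversions, and
  the identity is the only element without descents.\<close>

lemma reduced_word_B:
  assumes "w \<in> carrier (W_B r)"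
  shows "\<exists>is. set is \<subseteq> {..<r} \<and> w = word_B is \<and> card (inversions r w) = 2 * length is"
  using assms
proof (induction "card (inversions r w)" arbitrary: w rule: less_induct)
  case less
  show ?case
  proof (cases "\<forall>i<r. ascent w i")
    case True
    then have "w = id" using no_descent_imp_id[OF less.prems] by blast
    then show ?thesis by (intro exI[of _ "[]"]) simp
  next
    case False
    then obtain i where i: "i < r" "\<not> ascent w i" by blast
    let ?v = "w \<circ> s_B i"
    have v: "?v \<in> carrier (W_B r)" by (intro comp_W_B less.prems s_B_W_B i)
    have w: "w = ?v \<circ> s_B i" by (simp add: comp_assoc s_B_s_B)
    have "card (inversions r (?v \<circ> s_B i)) = card (inversions r ?v) + 2"
      using i by (intro card_inversions_ascent v) (simp_all add: ascent_s_B[OF less.prems])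
    then have card: "card (inversions r w) = card (inversions r ?v) + 2" by (simp add: w[symmetric])
    then obtain "is" where "is": "set is \<subseteq> {..<r}" "?v = word_B is" "card (inversions r ?v) = 2 * length is"
      using less.hyps[OF _ v] by auto
    have "w = word_B (is @ [i])" using w "is"(2) by (simp add: word_B_append)
    then show ?thesis using "is" i card by (intro exI[of _ "is @ [i]"]) auto
  qed
qed

text \<open>No word is shorter, since each letter adds at most two inversions, and the greedy word
  attains this bound.\<close>

lemma length_B_inversions:
  assumes w: "w \<in> carrier (W_B r)"
  shows "2 * length_B r w = card (inversions r w)"
proof -
  obtain "is" where "is": "set is \<subseteq> {..<r}" "w = word_B is" "card (inversions r w) = 2 * length is"
    using reduced_word_B[OF w] by blast
  have "length_B r w = length is"
    unfolding length_B_def word_B_def[symmetric]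
  proof (rule Least_equality)
    fix n assume "\<exists>js. length js = n \<and> set js \<subseteq> {..<r} \<and> w = word_B js"
    then obtain js where "length js = n" "set js \<subseteq> {..<r}" "w = word_B js" by blast
    then show "length is \<le> n" using card_inversions_word_B[of js r] "is"(3) by simp
  qed (use "is" in blast)
  then show ?thesis using "is"(3) by simp
qed

lemma length_B_ascent:
  assumes "w \<in> carrier (W_B r)" "i < r" "ascent w i"
  shows "length_B r (w \<circ> s_B i) = length_B r w + 1"
  using card_inversions_ascent[OF assms] length_B_inversions[OF assms(1)]
    length_B_inversions[OF comp_W_B[OF assms(1) s_B_W_B[OF assms(2)]]] by simp

lemma length_B_s_B: "i < r \<Longrightarrow> length_B r (s_B i) = 1"
proof -
  assume i: "i < r"
  have "length_B r id = 0" using length_B_inversions[OF id_W_B, of r] by simp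
  moreover have "length_B r (id \<circ> s_B i) = length_B r id + 1"
    by (intro length_B_ascent id_W_B i) (simp add: ascent_def)
  ultimately show ?thesis by simp
qed

lemma word_B_rev: "word_B (rev is) \<circ> word_B is = id"
proof (induction "is")
  case (Cons i "is")
  show ?case
  proof
    fix x
    have "s_B i (s_B i y) = y" for y using s_B_s_B[of i] by (simp add: fun_eq_iff)
    moreover have "word_B (rev is) (word_B is x) = x" using fun_cong[OF Cons, of x] by simp
    ultimately show "(word_B (rev (i # is)) \<circ> word_B (i # is)) x = id x" by (simp add: word_B_append)
  qed
qed simp

text \<open>A reduced word of \<open>v\<close>, reversed, is a word of its inverse. Ascents govern
  right multiplication; this transfers information to left multiplication.\<close>

lemma length_B_inverse_le:
  assumes "v \<in> carrier (W_B r)" "v \<circ> w = id"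
  shows "length_B r w \<le> length_B r v"
proof -
  obtain "is" where "is": "set is \<subseteq> {..<r}" "v = word_B is" "card (inversions r v) = 2 * length is"
    using reduced_word_B[OF assms(1)] by blast
  have "w = word_B (rev is) \<circ> word_B is \<circ> w" by (simp add: word_B_rev)
  also have "\<dots> = word_B (rev is)" using assms(2) "is"(2) by (simp add: comp_assoc)
  finally have "length_B r w \<le> length is"
    unfolding length_B_def word_B_def[symmetric] using "is"(1) by (intro Least_le exI[of _ "rev is"]) simp
  then show ?thesis using length_B_inversions[OF assms(1)] "is"(3) by simp
qed

section \<open>The reflections t_i\<close>

lemma t_B_eq: "1 \<le> i \<Longrightarrow> t_B i = transpose (int i) (- int i)"
proof (induction i rule: nat_induct_at_least)
  case base
  show ?case by (simp add: s_B_def)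
next
  case (Suc i)
  then obtain k where k: "i = Suc k" by (cases i) auto
  from Suc.IH show ?case unfolding k t_B.simps(3) by (auto simp: fun_eq_iff s_B_pos transpose_def)
qed

lemma t_B_W_B: "\<lbrakk>1 \<le> i; i \<le> r\<rbrakk> \<Longrightarrow> t_B i \<in> carrier (W_B r)"
  by (auto simp: t_B_eq W_B_iff signed_points_def transpose_def intro!: permutes_swap_id)

text \<open>Since s_i and t_i are involutions, s_i t_i and t_i s_i are mutually inverse and equally
  long. The length of t_i s_i follows from an ascent, as t_i(i) = -i < i + 1 = t_i(i + 1).\<close>

lemma length_B_s_B_t_B:
  assumes "1 \<le> i" "i < r"
  shows "length_B r (s_B i \<circ> t_B i) = length_B r (t_B i) + 1"
proof -
  have t: "t_B i \<in> carrier (W_B r)" using t_B_W_B assms by simp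
  have s: "s_B i \<in> carrier (W_B r)" using s_B_W_B assms by simp
  have tt: "t_B i \<circ> t_B i = id" using assms by (simp add: t_B_eq)
  have asc: "ascent (t_B i) i" using assms by (auto simp: ascent_def t_B_eq transpose_def)
  have 1: "(s_B i \<circ> t_B i) \<circ> (t_B i \<circ> s_B i) = id"
    using tt s_B_s_B[of i] by (simp add: fun_eq_iff)
  have 2: "(t_B i \<circ> s_B i) \<circ> (s_B i \<circ> t_B i) = id"
    using tt s_B_s_B[of i] by (simp add: fun_eq_iff)
  have "length_B r (s_B i \<circ> t_B i) = length_B r (t_B i \<circ> s_B i)"
    by (intro antisym length_B_inverse_le comp_W_B s t 1 2)
  then show ?thesis using length_B_ascent[OF t assms(2) asc] by simp
qed

section \<open>A quadratic relation in a noncommutative ring\<close>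

context ring
begin

text \<open>The hypotheses provide a right and a left inverse, which agree by associativity.\<close>

lemma Units_if_mult_both:
  assumes "x \<in> carrier R" "a \<in> carrier R" "b \<in> carrier R" "x \<otimes> a \<in> Units R" "b \<otimes> x \<in> Units R"
  shows "x \<in> Units R"
proof -
  let ?a = "a \<otimes> inv (x \<otimes> a)" and ?b = "inv (b \<otimes> x) \<otimes> b"
  have ab: "?a \<in> carrier R" "?b \<in> carrier R" using assms by auto
  have xa: "x \<otimes> ?a = \<one>" using assms by (simp add: m_assoc[symmetric])
  have bx: "?b \<otimes> x = \<one>" using assms by (simp add: m_assoc)
  have "?b = ?b \<otimes> (x \<otimes> ?a)" using ab xa by simp
  also have "\<dots> = ?a" using ab bx assms(1) by (simp add: m_assoc[symmetric])
  finally show ?thesis using ab xa bx assms(1) by (auto simp: Units_def)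
qed

text \<open>Clears subtractions, so that identities can be decided by normalizing sums of
  monomials.\<close>

lemma minus_eq_minusI:
  "\<lbrakk>a \<in> carrier R; b \<in> carrier R; c \<in> carrier R; d \<in> carrier R; a \<oplus> d = c \<oplus> b\<rbrakk> \<Longrightarrow> a \<ominus> b = c \<ominus> d"
  by (metis a_assoc a_comm a_minus_def add.inv_closed add.inv_solve_right' add.m_closed r_neg1)

text \<open>In the following \<open>T\<close> satisfies the quadratic relation of a generator of a Hecke algebra with
  parameter \<open>Q = P + 1\<close>; writing \<open>Q\<close> like this keeps the computations free of subtractions.\<close>

lemma braid_quadratic_identities:
  assumes [simp]: "T \<in> carrier R" "X \<in> carrier R" "P \<in> carrier R"
    and PT: "T \<otimes> P = P \<otimes> T" and PX: "X \<otimes> P = P \<otimes> X"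
    and TT: "T \<otimes> T = P \<otimes> T \<oplus> (P \<oplus> \<one>)"
    and braid: "T \<otimes> X \<otimes> T \<otimes> X = X \<otimes> T \<otimes> X \<otimes> T"
  defines "Q \<equiv> P \<oplus> \<one>" and "Z \<equiv> T \<otimes> X \<otimes> T" and "\<phi> \<equiv> T \<otimes> X \<ominus> X \<otimes> T"
  shows "Z \<otimes> \<phi> = Q \<otimes> \<phi> \<otimes> X" and "\<phi> \<otimes> Z = Q \<otimes> X \<otimes> \<phi>"
    and "Q \<otimes> (\<phi> \<otimes> \<phi>) = (Q \<otimes> Q \<oplus> \<one>) \<otimes> (X \<otimes> Z) \<ominus> (Z \<otimes> Z \<oplus> Q \<otimes> Q \<otimes> (X \<otimes> X))"
    and "\<And>p. \<lbrakk>p \<in> carrier R; T \<otimes> p = p \<otimes> T; X \<otimes> p = p \<otimes> X; P \<otimes> p = p \<otimes> P\<rbrakk> \<Longrightarrow>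
      T \<otimes> ((p \<oplus> X) \<otimes> (Q \<otimes> p \<oplus> Z)) = (p \<oplus> X) \<otimes> (Q \<otimes> p \<oplus> Z) \<otimes> T"
proof -
  have PT': "T \<otimes> (P \<otimes> y) = P \<otimes> (T \<otimes> y)" and PX': "X \<otimes> (P \<otimes> y) = P \<otimes> (X \<otimes> y)"
    and TT': "T \<otimes> (T \<otimes> y) = P \<otimes> (T \<otimes> y) \<oplus> (P \<otimes> y \<oplus> y)"
    and braid': "T \<otimes> (X \<otimes> (T \<otimes> (X \<otimes> y))) = X \<otimes> (T \<otimes> (X \<otimes> (T \<otimes> y)))"
    if [simp]: "y \<in> carrier R" for y
  proof -
    show "T \<otimes> (P \<otimes> y) = P \<otimes> (T \<otimes> y)" by (simp add: PT m_assoc[symmetric])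
    show "X \<otimes> (P \<otimes> y) = P \<otimes> (X \<otimes> y)" by (simp add: PX m_assoc[symmetric])
    have "T \<otimes> (T \<otimes> y) = T \<otimes> T \<otimes> y" by (simp add: m_assoc)
    then show "T \<otimes> (T \<otimes> y) = P \<otimes> (T \<otimes> y) \<oplus> (P \<otimes> y \<oplus> y)" by (simp add: TT l_distr m_assoc)
    show "T \<otimes> (X \<otimes> (T \<otimes> (X \<otimes> y))) = X \<otimes> (T \<otimes> (X \<otimes> (T \<otimes> y)))"
      using braid by (simp add: m_assoc[symmetric])
  qed
  have braid0: "T \<otimes> (X \<otimes> (T \<otimes> X)) = X \<otimes> (T \<otimes> (X \<otimes> T))" using braid by (simp add: m_assoc)
  \<comment> \<open>Normal form of monomials: P moves to the left, squares of T are expanded by the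
    quadratic relation, and TXTX is replaced by XTXT.\<close>
  note norm = l_distr r_distr m_assoc PT PX PT' PX' TT TT' braid0 braid' a_ac
  have [simp]: "Q \<in> carrier R" "Z \<in> carrier R" "\<phi> \<in> carrier R" by (simp_all add: Q_def Z_def \<phi>_def)
  have ld: "(a \<ominus> b) \<otimes> c = a \<otimes> c \<ominus> b \<otimes> c" and rd: "c \<otimes> (a \<ominus> b) = c \<otimes> a \<ominus> c \<otimes> b"
    if "a \<in> carrier R" "b \<in> carrier R" "c \<in> carrier R" for a b c
    using that by (simp_all add: a_minus_def l_distr r_distr l_minus r_minus)
  show "Z \<otimes> \<phi> = Q \<otimes> \<phi> \<otimes> X"
    unfolding \<phi>_def by (simp add: ld rd, rule minus_eq_minusI) (simp_all add: Q_def Z_def norm)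
  show "\<phi> \<otimes> Z = Q \<otimes> X \<otimes> \<phi>"
    unfolding \<phi>_def by (simp add: ld rd, rule minus_eq_minusI) (simp_all add: Q_def Z_def norm)
  have "\<phi> \<otimes> \<phi> = (T \<otimes> X \<otimes> T \<otimes> X \<oplus> X \<otimes> T \<otimes> X \<otimes> T) \<ominus> (T \<otimes> X \<otimes> X \<otimes> T \<oplus> X \<otimes> T \<otimes> T \<otimes> X)"
    unfolding \<phi>_def by (simp add: a_minus_def l_distr r_distr l_minus r_minus m_assoc minus_add a_ac)
  then show "Q \<otimes> (\<phi> \<otimes> \<phi>) = (Q \<otimes> Q \<oplus> \<one>) \<otimes> (X \<otimes> Z) \<ominus> (Z \<otimes> Z \<oplus> Q \<otimes> Q \<otimes> (X \<otimes> X))"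
    by (simp add: rd, intro minus_eq_minusI) (simp_all add: Q_def Z_def norm)
  fix p assume p [simp]: "p \<in> carrier R" and Tp: "T \<otimes> p = p \<otimes> T" and Xp: "X \<otimes> p = p \<otimes> X"
    and Pp: "P \<otimes> p = p \<otimes> P"
  have Tp': "T \<otimes> (p \<otimes> y) = p \<otimes> (T \<otimes> y)" and Xp': "X \<otimes> (p \<otimes> y) = p \<otimes> (X \<otimes> y)"
    and Pp': "P \<otimes> (p \<otimes> y) = p \<otimes> (P \<otimes> y)" if [simp]: "y \<in> carrier R" for y
    by (simp_all add: Tp Xp Pp m_assoc[symmetric])
  show "T \<otimes> ((p \<oplus> X) \<otimes> (Q \<otimes> p \<oplus> Z)) = (p \<oplus> X) \<otimes> (Q \<otimes> p \<oplus> Z) \<otimes> T"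
    by (simp add: Q_def Z_def norm Tp Xp Pp Tp' Xp' Pp')
qed

text \<open>X and Z = TXT commute, so the identity for Q\<phi>^2 reads Q\<phi>^2 = -(Z - X)(Z - Q^2
  X). If \<phi> were a unit, (Z + u)\<phi> = Q\<phi>(X + Qc) would make Z + u conjugate to a unit;
  in general it is not. Instead, the quadratic takes the value -V at Z = -u, where V = Q^2 (X + c)(X
  + u) is a unit by hypothesis. Hence Z + u divides Q\<phi>^2 + V; by the intertwining relation it
  also divides Q\<phi>^2, and therefore it divides V.\<close>

lemma conjugate_plus_central_Units:
  assumes [simp]: "T \<in> carrier R" "X \<in> carrier R" "Q \<in> carrier R" "c \<in> carrier R"
    and Q: "Q \<in> Units R" "\<And>x. x \<in> carrier R \<Longrightarrow> x \<otimes> Q = Q \<otimes> x"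
    and c: "\<And>x. x \<in> carrier R \<Longrightarrow> x \<otimes> c = c \<otimes> x"
    and TT: "T \<otimes> T = (Q \<ominus> \<one>) \<otimes> T \<oplus> Q"
    and braid: "T \<otimes> X \<otimes> T \<otimes> X = X \<otimes> T \<otimes> X \<otimes> T"
    and units: "X \<oplus> c \<in> Units R" "X \<oplus> Q \<otimes> c \<in> Units R" "X \<oplus> Q \<otimes> Q \<otimes> c \<in> Units R"
  shows "T \<otimes> X \<otimes> T \<oplus> Q \<otimes> Q \<otimes> c \<in> Units R"
proof -
  define P where "P = Q \<ominus> \<one>"
  define Z where "Z = T \<otimes> X \<otimes> T"
  define \<phi> where "\<phi> = T \<otimes> X \<ominus> X \<otimes> T"
  define u where "u = Q \<otimes> Q \<otimes> c"
  have P [simp]: "P \<in> carrier R" by (simp add: P_def)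
  have QP: "Q = P \<oplus> \<one>" by (simp add: P_def a_minus_def a_assoc l_neg)
  have Pc: "x \<otimes> P = P \<otimes> x" if "x \<in> carrier R" for x
    using that by (simp add: P_def a_minus_def l_distr r_distr l_minus r_minus Q(2)[of x])
  have TT': "T \<otimes> T = P \<otimes> T \<oplus> (P \<oplus> \<one>)" using TT by (simp add: P_def[symmetric] QP[symmetric])
  note ids = braid_quadratic_identities[OF _ _ P Pc Pc TT' braid, folded QP Z_def \<phi>_def, simplified]
  have [simp]: "Z \<in> carrier R" "\<phi> \<in> carrier R" "u \<in> carrier R"
    by (simp_all add: Z_def \<phi>_def u_def)
  have ZX: "Z \<otimes> X = X \<otimes> Z" using braid by (simp add: Z_def m_assoc)
  have u: "x \<otimes> u = u \<otimes> x" if [simp]: "x \<in> carrier R" for x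
  proof -
    have xQ: "x \<otimes> (Q \<otimes> y) = Q \<otimes> (x \<otimes> y)" if "y \<in> carrier R" for y
      using that Q(2)[of x] by (metis m_assoc assms(3) \<open>x \<in> carrier R\<close>)
    show ?thesis by (simp add: u_def m_assoc xQ c[of x])
  qed
  define w where "w = inv (X \<oplus> Q \<otimes> c)"
  have w [simp]: "w \<in> carrier R" using units(2) by (simp add: w_def)
  have uQ: "Q \<otimes> (X \<oplus> Q \<otimes> c) = Q \<otimes> X \<oplus> u" by (simp add: u_def r_distr m_assoc)
  have left: "(Z \<oplus> u) \<otimes> \<phi> = Q \<otimes> \<phi> \<otimes> (X \<oplus> Q \<otimes> c)"
  proof -
    have "(Z \<oplus> u) \<otimes> \<phi> = Q \<otimes> \<phi> \<otimes> X \<oplus> \<phi> \<otimes> u" by (simp add: l_distr ids(1) u)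
    also have "\<dots> = \<phi> \<otimes> (Q \<otimes> X \<oplus> u)"
      by (simp add: r_distr Q(2)[symmetric, of \<phi>] m_assoc)
    also have "\<dots> = Q \<otimes> \<phi> \<otimes> (X \<oplus> Q \<otimes> c)" by (simp add: uQ[symmetric] m_assoc[symmetric] Q(2)[of \<phi>])
    finally show ?thesis .
  qed
  have right: "\<phi> \<otimes> (Z \<oplus> u) = Q \<otimes> (X \<oplus> Q \<otimes> c) \<otimes> \<phi>"
    by (simp add: r_distr l_distr ids(2) u uQ)
  have 1: "(Z \<oplus> u) \<otimes> (\<phi> \<otimes> w \<otimes> \<phi>) = Q \<otimes> (\<phi> \<otimes> \<phi>)"
  proof -
    have "(Z \<oplus> u) \<otimes> (\<phi> \<otimes> w \<otimes> \<phi>) = (Z \<oplus> u) \<otimes> \<phi> \<otimes> w \<otimes> \<phi>" by (simp add: m_assoc)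
    also have "\<dots> = Q \<otimes> \<phi> \<otimes> ((X \<oplus> Q \<otimes> c) \<otimes> w) \<otimes> \<phi>" by (simp add: left m_assoc)
    finally show ?thesis using units(2) by (simp add: w_def m_assoc)
  qed
  have 2: "(\<phi> \<otimes> w \<otimes> \<phi>) \<otimes> (Z \<oplus> u) = Q \<otimes> (\<phi> \<otimes> \<phi>)"
  proof -
    have "(\<phi> \<otimes> w \<otimes> \<phi>) \<otimes> (Z \<oplus> u) = \<phi> \<otimes> w \<otimes> (Q \<otimes> (X \<oplus> Q \<otimes> c) \<otimes> \<phi>)" by (simp add: m_assoc right)
    also have "\<dots> = (\<phi> \<otimes> w \<otimes> Q) \<otimes> (X \<oplus> Q \<otimes> c) \<otimes> \<phi>" by (simp add: m_assoc)
    also have "\<dots> = Q \<otimes> \<phi> \<otimes> (w \<otimes> (X \<oplus> Q \<otimes> c)) \<otimes> \<phi>" by (simp add: Q(2)[of "\<phi> \<otimes> w"]) (simp add: m_assoc)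
    finally show ?thesis using units(2) by (simp add: w_def m_assoc)
  qed
  define V where "V = Q \<otimes> Q \<otimes> ((X \<oplus> c) \<otimes> (X \<oplus> u))"
  have V: "V \<in> Units R" unfolding V_def u_def using Q(1) units by (simp add: Units_m_closed)
  \<comment> \<open>\<open>E\<close> is the quotient of Q\<phi>^2 + V by Z + u, obtained by
    polynomial division in Z.\<close>
  define E where "E = (u \<oplus> (Q \<otimes> Q \<otimes> X \<oplus> X)) \<ominus> Z"
  have [simp]: "E \<in> carrier R" "V \<in> carrier R" using Units_closed[OF V] by (simp_all add: E_def)
  have 3: "(Z \<oplus> u) \<otimes> E = E \<otimes> (Z \<oplus> u)"
  proof -
    have xQ: "x \<otimes> (Q \<otimes> y) = Q \<otimes> (x \<otimes> y)" if "x \<in> carrier R" "y \<in> carrier R" for x y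
      using that Q(2)[of x] by (metis m_assoc assms(3))
    have WX: "(Z \<oplus> u) \<otimes> X = X \<otimes> (Z \<oplus> u)" by (simp add: l_distr r_distr ZX u[of X])
    have WQ: "(Z \<oplus> u) \<otimes> (Q \<otimes> Q \<otimes> X) = Q \<otimes> Q \<otimes> X \<otimes> (Z \<oplus> u)"
      by (simp add: m_assoc xQ[of "Z \<oplus> u"] WX)
    have WZ: "(Z \<oplus> u) \<otimes> Z = Z \<otimes> (Z \<oplus> u)" by (simp add: l_distr r_distr u[of Z])
    have Wu: "(Z \<oplus> u) \<otimes> u = u \<otimes> (Z \<oplus> u)" by (rule u) simp
    have "(Z \<oplus> u) \<otimes> E = ((Z \<oplus> u) \<otimes> u \<oplus> ((Z \<oplus> u) \<otimes> (Q \<otimes> Q \<otimes> X) \<oplus> (Z \<oplus> u) \<otimes> X)) \<ominus> (Z \<oplus> u) \<otimes> Z"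
      unfolding E_def by (simp add: r_minus r_distr[of _ _ "Z \<oplus> u"] a_minus_def)
    also have "\<dots> = E \<otimes> (Z \<oplus> u)"
      unfolding WX WQ WZ Wu E_def by (simp add: l_minus l_distr[of _ _ "Z \<oplus> u"] a_minus_def)
    finally show ?thesis .
  qed
  have 4: "(Z \<oplus> u) \<otimes> E = V \<oplus> Q \<otimes> (\<phi> \<otimes> \<phi>)"
  proof -
    have "(Z \<oplus> u) \<otimes> E = (Z \<oplus> u) \<otimes> (u \<oplus> (Q \<otimes> Q \<otimes> X \<oplus> X)) \<ominus> (Z \<oplus> u) \<otimes> Z"
      by (simp add: E_def a_minus_def r_distr[of _ "\<ominus> Z"] r_minus)
    also have "\<dots> = (V \<oplus> (Q \<otimes> Q \<oplus> \<one>) \<otimes> (X \<otimes> Z)) \<ominus> (Z \<otimes> Z \<oplus> Q \<otimes> Q \<otimes> (X \<otimes> X))"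
    proof (rule minus_eq_minusI)
      have cs: "x \<otimes> (c \<otimes> y) = c \<otimes> (x \<otimes> y)" "x \<otimes> (Q \<otimes> y) = Q \<otimes> (x \<otimes> y)"
        if "x \<in> carrier R" "y \<in> carrier R" for x y
        using that by (metis c Q(2) m_assoc assms(3,4))+
      have ZX': "Z \<otimes> (X \<otimes> y) = X \<otimes> (Z \<otimes> y)" if "y \<in> carrier R" for y
        using that ZX by (metis m_assoc \<open>Z \<in> carrier R\<close> assms(2))
      show "(Z \<oplus> u) \<otimes> (u \<oplus> (Q \<otimes> Q \<otimes> X \<oplus> X)) \<oplus> (Z \<otimes> Z \<oplus> Q \<otimes> Q \<otimes> (X \<otimes> X)) =
        V \<oplus> (Q \<otimes> Q \<oplus> \<one>) \<otimes> (X \<otimes> Z) \<oplus> (Z \<oplus> u) \<otimes> Z"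
        by (simp add: V_def u_def l_distr r_distr m_assoc cs(1)[of Z] cs(1)[of X] cs(1)[of Q] cs(2)[of Z] cs(2)[of X]
          Q(2)[of Z] Q(2)[of X] c[of X] c[of Z] c[of Q] ZX ZX' a_ac)
    qed simp_all
    also have "\<dots> = V \<oplus> Q \<otimes> (\<phi> \<otimes> \<phi>)" by (simp add: ids(3) a_minus_def a_assoc)
    finally show ?thesis .
  qed
  \<comment> \<open>Since w inverts X + Qc, the cofactor of Z + u in Q\<phi>^2 is \<phi>w\<phi>.
    Subtracting it from the cofactor \<open>E\<close> of Q\<phi>^2 + V leaves a cofactor for
    V.\<close>
  define F where "F = E \<ominus> \<phi> \<otimes> w \<otimes> \<phi>"
  have F [simp]: "F \<in> carrier R" by (simp add: F_def)
  have "(Z \<oplus> u) \<otimes> F = V"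
    by (simp add: F_def a_minus_def r_distr r_minus 1 4) (simp add: a_assoc r_neg)
  moreover have "F \<otimes> (Z \<oplus> u) = V"
    by (simp add: F_def a_minus_def l_distr l_minus 2 4[unfolded 3]) (simp add: a_assoc r_neg)
  ultimately show ?thesis
    using Units_if_mult_both[of "Z \<oplus> u" F F] V by (simp add: Z_def u_def)
qed

end

section \<open>Jucys--Murphy elements\<close>

text \<open>The Jucys--Murphy computations rest on the presentation by generators. The parameters
  are taken as central elements of the ring, so that everything happens in one noncommutative ring
  without a scalar action.\<close>

locale hecke_generators = ring +
  fixes r :: nat and g :: "nat \<Rightarrow> 'a" and Q :: 'a and Q0 :: 'a
  assumes g_closed [simp]: "i < r \<Longrightarrow> g i \<in> carrier R"
    and Q_closed [simp]: "Q \<in> carrier R" and Q0_closed [simp]: "Q0 \<in> carrier R"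
    and Q_central: "x \<in> carrier R \<Longrightarrow> x \<otimes> Q = Q \<otimes> x"
    and Q0_central: "x \<in> carrier R \<Longrightarrow> x \<otimes> Q0 = Q0 \<otimes> x"
    and g_quadratic: "\<lbrakk>1 \<le> i; i < r\<rbrakk> \<Longrightarrow> g i \<otimes> g i = (Q \<ominus> \<one>) \<otimes> g i \<oplus> Q"
    and g_quadratic_0: "0 < r \<Longrightarrow> g 0 \<otimes> g 0 = (Q0 \<ominus> \<one>) \<otimes> g 0 \<oplus> Q0"
    and g_commute: "\<lbrakk>i + 1 < j; j < r\<rbrakk> \<Longrightarrow> g i \<otimes> g j = g j \<otimes> g i"
    and g_braid: "\<lbrakk>1 \<le> i; i + 1 < r\<rbrakk> \<Longrightarrow> g i \<otimes> g (i + 1) \<otimes> g i = g (i + 1) \<otimes> g i \<otimes> g (i + 1)"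
    and g_braid_0: "1 < r \<Longrightarrow> g 0 \<otimes> g 1 \<otimes> g 0 \<otimes> g 1 = g 1 \<otimes> g 0 \<otimes> g 1 \<otimes> g 0"
begin

definition commutes :: "'a \<Rightarrow> 'a \<Rightarrow> bool" where
  "commutes x y \<longleftrightarrow> x \<otimes> y = y \<otimes> x"

lemma commutes_sym: "commutes x y \<Longrightarrow> commutes y x"
  by (simp add: commutes_def)

lemma commutes_one: "x \<in> carrier R \<Longrightarrow> commutes x \<one>"
  by (simp add: commutes_def)

lemma commutes_mult:
  "\<lbrakk>x \<in> carrier R; y \<in> carrier R; z \<in> carrier R; commutes x y; commutes x z\<rbrakk> \<Longrightarrow> commutes x (y \<otimes> z)"
  unfolding commutes_def by (metis m_assoc)

lemma commutes_add:
  "\<lbrakk>x \<in> carrier R; y \<in> carrier R; z \<in> carrier R; commutes x y; commutes x z\<rbrakk> \<Longrightarrow> commutes x (y \<oplus> z)"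
  by (simp add: commutes_def l_distr r_distr)

lemma commutes_Q: "x \<in> carrier R \<Longrightarrow> commutes x Q" "x \<in> carrier R \<Longrightarrow> commutes x Q0"
  by (simp_all add: commutes_def Q_central Q0_central)

lemma commutes_Q_pow: "x \<in> carrier R \<Longrightarrow> commutes x (Q [^] (n::nat))"
  by (induction n) (auto simp: commutes_one commutes_Q intro!: commutes_mult)

text \<open>With \<open>y = 1\<close> these are the (unnormalized) multiplicative Jucys--Murphy elements of the Hecke
  algebra of the symmetric group, with \<open>y = g 0\<close> those of type \<open>B\<close>; the index is shifted by one.\<close>

primrec JM :: "'a \<Rightarrow> nat \<Rightarrow> 'a" where
  "JM y 0 = y"
| "JM y (Suc k) = g (Suc k) \<otimes> JM y k \<otimes> g (Suc k)"

text \<open>What the start values 1 and \<open>g 0\<close> have in common; it lets the commutation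
  lemmas cover the families of types A and B at once.\<close>

definition JM_start :: "'a \<Rightarrow> bool" where
  "JM_start y \<longleftrightarrow> y \<in> carrier R \<and> (\<forall>j. 2 \<le> j \<and> j < r \<longrightarrow> commutes (g j) y) \<and>
     (1 < r \<longrightarrow> y \<otimes> g 1 \<otimes> y \<otimes> g 1 = g 1 \<otimes> y \<otimes> g 1 \<otimes> y)"

lemma JM_start_one: "JM_start \<one>"
  by (simp add: JM_start_def commutes_one)

lemma JM_start_g: "0 < r \<Longrightarrow> JM_start (g 0)"
  using g_commute[of 0] by (simp add: JM_start_def commutes_def g_braid_0[unfolded One_nat_def])

lemma JM_closed: "\<lbrakk>JM_start y; k = 0 \<or> k < r\<rbrakk> \<Longrightarrow> JM y k \<in> carrier R"
  by (induction k) (auto simp: JM_start_def)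

lemma commutes_g_JM_above:
  "\<lbrakk>JM_start y; k + 1 < j; j < r\<rbrakk> \<Longrightarrow> commutes (g j) (JM y k)"
proof (induction k)
  case (Suc k)
  then have "commutes (g j) (g (Suc k))" using g_commute[of "Suc k" j] by (simp add: commutes_def)
  with Suc show ?case by (auto intro!: commutes_mult JM_closed)
qed (simp add: JM_start_def)

text \<open>The braid relation turns a into b, which passes z, and a second use turns it back into
  a.\<close>

lemma commutes_braid:
  assumes [simp]: "a \<in> carrier R" "b \<in> carrier R" "z \<in> carrier R"
    and ab: "a \<otimes> b \<otimes> a = b \<otimes> a \<otimes> b" and bz: "commutes b z"
  shows "commutes a (b \<otimes> (a \<otimes> z \<otimes> a) \<otimes> b)"
proof -
  have "a \<otimes> (b \<otimes> (a \<otimes> z \<otimes> a) \<otimes> b) = (a \<otimes> b \<otimes> a) \<otimes> z \<otimes> (a \<otimes> b)" by (simp add: m_assoc)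
  also have "\<dots> = b \<otimes> a \<otimes> (b \<otimes> z) \<otimes> (a \<otimes> b)" by (simp add: ab) (simp add: m_assoc)
  also have "\<dots> = b \<otimes> a \<otimes> z \<otimes> (b \<otimes> a \<otimes> b)" using bz by (simp add: commutes_def) (simp add: m_assoc)
  also have "\<dots> = b \<otimes> a \<otimes> z \<otimes> (a \<otimes> b \<otimes> a)" by (simp only: ab)
  also have "\<dots> = b \<otimes> (a \<otimes> z \<otimes> a) \<otimes> b \<otimes> a" by (simp add: m_assoc)
  finally show ?thesis by (simp add: commutes_def)
qed

text \<open>The critical element is the one of index j + 1, obtained from the one of index j - 1 by
  conjugating with g_j and then g_(j+1), where the braid relation applies. All generators that enter
  later commute with g_j.\<close>

lemma commutes_g_JM_below:
  "\<lbrakk>JM_start y; 1 \<le> j; j < k; k < r\<rbrakk> \<Longrightarrow> commutes (g j) (JM y k)"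
proof (induction k)
  case (Suc k)
  show ?case
  proof (cases "j = k")
    case True
    then obtain l where l: "k = Suc l" using Suc by (cases k) auto
    have "commutes (g k) (g (Suc k) \<otimes> (g k \<otimes> JM y l \<otimes> g k) \<otimes> g (Suc k))"
      using Suc.prems True l g_braid[of k] by (intro commutes_braid commutes_g_JM_above JM_closed) auto
    then show ?thesis using True l by simp
  next
    case False
    moreover from this Suc.prems have "commutes (g j) (g (Suc k))"
      using g_commute[of j "Suc k"] by (simp add: commutes_def)
    ultimately show ?thesis using Suc by (auto intro!: commutes_mult JM_closed)
  qed
qed simp

lemma commutes_start_JM: "\<lbrakk>JM_start y; k < r\<rbrakk> \<Longrightarrow> commutes y (JM y k)"
proof (induction k)
  case 0
  then show ?case by (simp add: commutes_def)
next
  case (Suc k)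
  then have y: "y \<in> carrier R" by (simp add: JM_start_def)
  show ?case
  proof (cases "k = 0")
    case True
    then show ?thesis using Suc.prems y by (simp add: JM_start_def commutes_def m_assoc)
  next
    case False
    then have "commutes y (g (Suc k))" using Suc.prems by (auto simp: JM_start_def intro: commutes_sym)
    with Suc y show ?thesis by (auto intro!: commutes_mult JM_closed)
  qed
qed

lemma commutes_JM_JM_less: "\<lbrakk>JM_start y; l < k; k < r\<rbrakk> \<Longrightarrow> commutes (JM y k) (JM y l)"
proof (induction l)
  case 0
  then show ?case by (auto intro: commutes_sym commutes_start_JM)
next
  case (Suc l)
  then have "commutes (JM y k) (g (Suc l))" by (intro commutes_sym[OF commutes_g_JM_below]) auto
  with Suc show ?case by (auto intro!: commutes_mult JM_closed)
qed

text \<open>Commutation of neighbouring Jucys--Murphy elements, rewritten as the braid hypothesis of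
  the intertwiner computations.\<close>

lemma JM_braid:
  assumes "JM_start y" "Suc k < r"
  shows "g (Suc k) \<otimes> JM y k \<otimes> g (Suc k) \<otimes> JM y k = JM y k \<otimes> g (Suc k) \<otimes> JM y k \<otimes> g (Suc k)"
  using commutes_JM_JM_less[OF assms(1) lessI assms(2)] assms
  by (simp add: commutes_def JM_closed m_assoc)

section \<open>The products \<pi> and \<zeta> and the quasi-idempotent relation\<close>

primrec qprod :: "(nat \<Rightarrow> 'a) \<Rightarrow> nat \<Rightarrow> 'a" where
  "qprod f 0 = \<one>"
| "qprod f (Suc a) = qprod f a \<otimes> (Q [^] a \<oplus> f a)"

lemma qprod_closed: "(\<And>i. i < a \<Longrightarrow> f i \<in> carrier R) \<Longrightarrow> qprod f a \<in> carrier R"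
  by (induction a) auto

lemma commutes_qprod:
  "\<lbrakk>x \<in> carrier R; \<And>i. i < a \<Longrightarrow> f i \<in> carrier R; \<And>i. i < a \<Longrightarrow> commutes x (f i)\<rbrakk>
    \<Longrightarrow> commutes x (qprod f a)"
  by (induction a) (auto simp: commutes_one commutes_Q_pow intro!: commutes_mult commutes_add qprod_closed)

definition \<pi> :: "nat \<Rightarrow> 'a" where
  "\<pi> = qprod (JM (g 0))"

lemma JM_g_closed: "k < r \<Longrightarrow> JM (g 0) k \<in> carrier R"
  by (rule JM_closed[OF JM_start_g]) auto

lemma JM_one_closed: "k < r \<Longrightarrow> JM \<one> k \<in> carrier R"
  by (rule JM_closed[OF JM_start_one]) auto

lemma pi_closed: "a \<le> r \<Longrightarrow> \<pi> a \<in> carrier R"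
  unfolding \<pi>_def by (intro qprod_closed JM_g_closed) simp

text \<open>The two factors of indices j - 1 and j commute with g_j as a product, and this uses that
  their constant terms are Q^(j-1) and Q^j; every other factor commutes with g_j on its own. For a =
  j the product would stop between the two.\<close>

lemma commutes_g_pi:
  assumes "1 \<le> j" "j < r" "j \<noteq> a" "a \<le> r"
  shows "commutes (g j) (\<pi> a)"
proof (cases "a < j")
  case True
  then show ?thesis
    unfolding \<pi>_def using assms by (intro commutes_qprod commutes_g_JM_above JM_start_g JM_g_closed) auto
next
  case False
  have "Suc j \<le> a" using False assms by simp
  from this \<open>a \<le> r\<close> show ?thesis
  proof (induction a rule: dec_induct)
    case base
    obtain k where k: "j = Suc k" using assms by (cases j) auto
    define P where "P = Q \<ominus> \<one>"
    have P [simp]: "P \<in> carrier R" by (simp add: P_def)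
    have QP: "Q = P \<oplus> \<one>" by (simp add: P_def a_minus_def a_assoc l_neg)
    have Pc: "x \<otimes> P = P \<otimes> x" if "x \<in> carrier R" for x
      using that Q_central[OF that] by (simp add: P_def a_minus_def l_distr r_distr l_minus r_minus)
    let ?X = "JM (g 0) k" and ?T = "g j"
    have X: "?X \<in> carrier R" using base k by (intro JM_g_closed) simp
    have T: "?T \<in> carrier R" using assms by simp
    have TT: "?T \<otimes> ?T = P \<otimes> ?T \<oplus> (P \<oplus> \<one>)"
      using g_quadratic[OF assms(1,2)] by (simp add: P_def[symmetric] QP[symmetric])
    have br: "?T \<otimes> ?X \<otimes> ?T \<otimes> ?X = ?X \<otimes> ?T \<otimes> ?X \<otimes> ?T"
      using JM_braid[OF JM_start_g, of k] assms k by simp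
    have pow: "x \<otimes> Q [^] k = Q [^] k \<otimes> x" if "x \<in> carrier R" for x
      using commutes_Q_pow[OF that] by (simp add: commutes_def)
    have "commutes ?T ((Q [^] k \<oplus> ?X) \<otimes> (Q \<otimes> Q [^] k \<oplus> ?T \<otimes> ?X \<otimes> ?T))"
      using braid_quadratic_identities(4)[OF T X P Pc[OF T] Pc[OF X] TT br nat_pow_closed[OF Q_closed]
          pow[OF T] pow[OF X] pow[OF P]]
      by (simp add: commutes_def QP[symmetric])
    moreover have "commutes ?T (\<pi> k)"
      unfolding \<pi>_def using assms k by (intro commutes_qprod commutes_g_JM_above JM_start_g JM_g_closed) auto
    ultimately have "commutes ?T (\<pi> k \<otimes> ((Q [^] k \<oplus> ?X) \<otimes> (Q \<otimes> Q [^] k \<oplus> ?T \<otimes> ?X \<otimes> ?T)))"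
      using X T base k by (intro commutes_mult[of _ "\<pi> k"]) (auto intro!: pi_closed)
    then show ?case
      using X T base k pi_closed[of k] by (simp add: \<pi>_def m_assoc pow[OF Q_closed])
  next
    case (step a)
    then show ?case
      unfolding \<pi>_def using assms
      by (auto intro!: commutes_mult commutes_add commutes_g_JM_below JM_start_g JM_g_closed commutes_Q_pow
        qprod_closed)
  qed
qed

text \<open>The quadratic relation gives (1 + g_0) g_0 = Q0 (1 + g_0), and g_0 commutes with all
  later factors.\<close>

lemma pi_g_0:
  assumes "1 \<le> a" "a \<le> r"
  shows "\<pi> a \<otimes> g 0 = Q0 \<otimes> \<pi> a"
  using assms
proof (induction a rule: dec_induct)
  case base
  have [simp]: "g 0 \<in> carrier R" using base by simp
  have "(\<one> \<oplus> g 0) \<otimes> g 0 = g 0 \<oplus> ((Q0 \<ominus> \<one>) \<otimes> g 0 \<oplus> Q0)"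
    using base by (simp add: l_distr g_quadratic_0)
  also have "\<dots> = Q0 \<otimes> (\<one> \<oplus> g 0)"
    by (simp add: l_distr r_distr a_minus_def l_minus a_assoc) (simp add: a_ac r_neg1 r_neg2)
  finally show ?case by (simp add: \<pi>_def)
next
  case (step a)
  have c: "g 0 \<in> carrier R" "\<pi> a \<in> carrier R" "JM (g 0) a \<in> carrier R"
    using step by (auto intro!: pi_closed JM_g_closed)
  have "commutes (g 0) (Q [^] a \<oplus> JM (g 0) a)"
    using step c by (intro commutes_add commutes_start_JM JM_start_g commutes_Q_pow) auto
  then have "\<pi> (Suc a) \<otimes> g 0 = (\<pi> a \<otimes> g 0) \<otimes> (Q [^] a \<oplus> JM (g 0) a)"
    using c by (simp add: \<pi>_def commutes_def m_assoc)
  also have "\<dots> = Q0 \<otimes> \<pi> (Suc a)"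
    using step c by (simp add: \<pi>_def m_assoc)
  finally show ?case .
qed

text \<open>Both elements arise from g_0 and from 1 through the same generators g_1, ..., g_k. These
  commute with \<open>\<pi> a\<close> because k < a, and \<open>\<pi> a\<close> absorbs g_0 into
  Q0.\<close>

lemma pi_JM:
  assumes "a \<le> r" "k < a"
  shows "\<pi> a \<otimes> JM (g 0) k = \<pi> a \<otimes> (Q0 \<otimes> JM \<one> k)"
  using assms(2)
proof (induction k)
  case 0
  then show ?case using assms pi_g_0[of a] Q0_central[OF pi_closed[OF assms(1)]] by simp
next
  case (Suc k)
  let ?T = "g (Suc k)"
  have c [simp]: "?T \<in> carrier R" "\<pi> a \<in> carrier R" "JM (g 0) k \<in> carrier R" "JM \<one> k \<in> carrier R"
    using Suc assms by (auto intro!: pi_closed JM_g_closed JM_one_closed)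
  have "commutes ?T (\<pi> a)" using Suc assms by (intro commutes_g_pi) auto
  then have T: "\<pi> a \<otimes> ?T = ?T \<otimes> \<pi> a" by (simp add: commutes_def)
  have "\<pi> a \<otimes> JM (g 0) (Suc k) = (\<pi> a \<otimes> ?T) \<otimes> JM (g 0) k \<otimes> ?T" by (simp add: m_assoc)
  also have "\<dots> = ?T \<otimes> (\<pi> a \<otimes> JM (g 0) k) \<otimes> ?T" by (simp add: T) (simp add: m_assoc)
  also have "\<dots> = ?T \<otimes> (\<pi> a \<otimes> (Q0 \<otimes> JM \<one> k)) \<otimes> ?T" using Suc by simp
  also have "\<dots> = (?T \<otimes> \<pi> a) \<otimes> Q0 \<otimes> JM \<one> k \<otimes> ?T" by (simp add: m_assoc)
  also have "\<dots> = \<pi> a \<otimes> (?T \<otimes> Q0) \<otimes> JM \<one> k \<otimes> ?T" by (simp add: T[symmetric]) (simp add: m_assoc)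
  also have "\<dots> = \<pi> a \<otimes> (Q0 \<otimes> JM \<one> (Suc k))" unfolding Q0_central[OF c(1)] by (simp add: m_assoc)
  finally show ?case .
qed

lemma commutes_pi_JM_one: "\<lbrakk>k < a; a \<le> r\<rbrakk> \<Longrightarrow> commutes (\<pi> a) (JM \<one> k)"
proof (induction k)
  case (Suc k)
  then have "commutes (\<pi> a) (g (Suc k))" by (intro commutes_sym[OF commutes_g_pi]) auto
  with Suc show ?case by (auto intro!: commutes_mult pi_closed JM_one_closed)
qed (simp add: commutes_one pi_closed)

definition \<zeta> :: "nat \<Rightarrow> 'a" where
  "\<zeta> = qprod (\<lambda>k. Q0 \<otimes> JM \<one> k)"

lemma zeta_closed: "a \<le> r \<Longrightarrow> \<zeta> a \<in> carrier R"
  unfolding \<zeta>_def by (intro qprod_closed) (simp add: JM_one_closed)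

lemma commutes_pi_zeta: "\<lbrakk>k \<le> a; a \<le> r\<rbrakk> \<Longrightarrow> commutes (\<pi> a) (\<zeta> k)"
  unfolding \<zeta>_def
  by (intro commutes_qprod commutes_mult commutes_Q commutes_pi_JM_one m_closed JM_one_closed pi_closed) auto

text \<open>The left factor stays fixed while the right one grows, so \<open>\<pi> a\<close> remains
  available to convert each new type B factor into its type A counterpart. The quasi-idempotent
  relation is the case k = a.\<close>

lemma pi_pi:
  assumes "k \<le> a" "a \<le> r"
  shows "\<pi> a \<otimes> \<pi> k = \<pi> a \<otimes> \<zeta> k"
  using assms(1)
proof (induction k)
  case 0
  then show ?case by (simp add: \<pi>_def \<zeta>_def)
next
  case (Suc k)
  have c [simp]: "\<pi> a \<in> carrier R" "\<pi> k \<in> carrier R" "JM (g 0) k \<in> carrier R" "JM \<one> k \<in> carrier R" "\<zeta> k \<in> carrier R"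
    using Suc assms by (auto intro!: pi_closed JM_g_closed JM_one_closed zeta_closed)
  have z: "\<pi> a \<otimes> \<zeta> k = \<zeta> k \<otimes> \<pi> a" using commutes_pi_zeta[of k a] Suc.prems assms by (simp add: commutes_def)
  have "\<pi> a \<otimes> \<pi> (Suc k) = (\<pi> a \<otimes> \<pi> k) \<otimes> (Q [^] k \<oplus> JM (g 0) k)" by (simp add: \<pi>_def m_assoc[symmetric] c[unfolded \<pi>_def])
  also have "\<dots> = \<zeta> k \<otimes> (\<pi> a \<otimes> (Q [^] k \<oplus> JM (g 0) k))" using Suc by (simp add: z m_assoc)
  also have "\<pi> a \<otimes> (Q [^] k \<oplus> JM (g 0) k) = \<pi> a \<otimes> (Q [^] k \<oplus> Q0 \<otimes> JM \<one> k)"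
    using pi_JM[of a k] Suc.prems assms by (simp add: r_distr)
  also have "\<zeta> k \<otimes> \<dots> = (\<pi> a \<otimes> \<zeta> k) \<otimes> (Q [^] k \<oplus> Q0 \<otimes> JM \<one> k)" by (simp add: z m_assoc)
  also have "\<dots> = \<pi> a \<otimes> \<zeta> (Suc k)" by (simp add: \<zeta>_def m_assoc c[unfolded \<zeta>_def])
  finally show ?case .
qed

text \<open>Generically the eigenvalues of \<open>Q\<^sup>-\<^sup>k JM 1 k\<close> are \<open>Q\<^sup>c\<close> with \<open>\<bar>c\<bar> \<le> k\<close>; the factor \<open>Q\<^bsup>r - 1\<^esup>\<close> only
  serves to avoid negative exponents.\<close>

lemma JM_one_Units:
  assumes Q: "Q \<in> Units R"
    and units: "\<And>n. n < r \<Longrightarrow> Q0 \<oplus> Q [^] n \<in> Units R" "\<And>n. n < r \<Longrightarrow> Q0 \<otimes> Q [^] n \<oplus> \<one> \<in> Units R"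
    and k: "k < r" and m: "2 * k \<le> m" "m \<le> 2 * (r - 1)"
  shows "Q [^] (r - 1) \<otimes> Q0 \<otimes> JM \<one> k \<oplus> Q [^] m \<in> Units R"
  using k m
proof (induction k arbitrary: m)
  case 0
  have Qn: "Q [^] n \<in> Units R" for n :: nat using Q by (rule Units_pow_closed)
  show ?case
  \<comment> \<open>The element is Q^(r-1) Q0 + Q^m. Splitting off the smaller power of Q leaves Q0
    Q^n + 1 or Q0 + Q^n with n < r; over all m in the range these are the 2r - 1 factors of g_r up
    to units.\<close>
  proof (cases "m \<le> r - 1")
    case True
    have "m + (r - 1 - m) = r - 1" using True by simp
    then have "Q [^] m \<otimes> (Q0 \<otimes> Q [^] (r - 1 - m) \<oplus> \<one>) = Q [^] (r - 1) \<otimes> Q0 \<oplus> Q [^] m"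
      using commutes_Q_pow[of Q0 "r - 1 - m"]
      by (simp add: commutes_def r_distr del: diff_diff_left) (simp add: m_assoc[symmetric] nat_pow_mult del: diff_diff_left)
    moreover have "Q [^] m \<otimes> (Q0 \<otimes> Q [^] (r - 1 - m) \<oplus> \<one>) \<in> Units R"
      using 0 by (intro Units_m_closed Qn units) simp
    ultimately show ?thesis by simp
  next
    case False
    have "Q [^] (r - 1) \<otimes> (Q0 \<oplus> Q [^] (m - (r - 1))) = Q [^] (r - 1) \<otimes> Q0 \<oplus> Q [^] m"
      using False by (simp add: r_distr nat_pow_mult)
    moreover have "Q [^] (r - 1) \<otimes> (Q0 \<oplus> Q [^] (m - (r - 1))) \<in> Units R"
      using 0 by (intro Units_m_closed Qn units) simp
    ultimately show ?thesis by simp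
  qed
next
  case (Suc k)
  let ?b = "Q [^] (r - 1) \<otimes> Q0" and ?T = "g (Suc k)" and ?J = "JM \<one> k"
  have [simp]: "?T \<in> carrier R" "?J \<in> carrier R" using Suc.prems by (auto intro!: JM_one_closed)
  have b: "x \<otimes> ?b = ?b \<otimes> x" if "x \<in> carrier R" for x
    using that commutes_mult[OF that _ _ commutes_Q_pow commutes_Q(2)] by (simp add: commutes_def)
  have pow: "x \<otimes> Q [^] n = Q [^] n \<otimes> x" if "x \<in> carrier R" for x and n :: nat
    using commutes_Q_pow[OF that] by (simp add: commutes_def)
  \<comment> \<open>As m \<ge> 2(k + 1), two powers of Q split off. The conjugation lemma is used
    with X = b J and c = Q^n; its three unit conditions are the induction hypothesis at the
    exponents n, n + 1 and n + 2 = m, all of which are at least 2k.\<close>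
  obtain n where n: "m = Suc (Suc n)" using Suc.prems by (cases m; cases "m - 1") auto
  define b where "b = ?b"
  have [simp]: "b \<in> carrier R" by (simp add: b_def)
  have bc: "x \<otimes> b = b \<otimes> x" if "x \<in> carrier R" for x using b[OF that] by (simp add: b_def)
  have bc': "x \<otimes> (b \<otimes> y) = b \<otimes> (x \<otimes> y)" if "x \<in> carrier R" "y \<in> carrier R" for x y
    using that bc[OF that(1)] by (metis \<open>b \<in> carrier R\<close> m_assoc)
  have IH: "b \<otimes> ?J \<oplus> Q [^] l \<in> Units R" if "2 * k \<le> l" "l \<le> 2 * (r - 1)" for l
    using Suc.IH[OF _ that] Suc.prems by (simp add: b_def)
  have QQ: "Q \<otimes> Q [^] n = Q [^] Suc n" "Q \<otimes> Q \<otimes> Q [^] n = Q [^] Suc (Suc n)"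
    by (simp_all add: pow m_assoc)
  have br: "?T \<otimes> (b \<otimes> ?J) \<otimes> ?T \<otimes> (b \<otimes> ?J) = (b \<otimes> ?J) \<otimes> ?T \<otimes> (b \<otimes> ?J) \<otimes> ?T"
  proof -
    have "?T \<otimes> (b \<otimes> ?J) \<otimes> ?T \<otimes> (b \<otimes> ?J) = b \<otimes> (b \<otimes> (?T \<otimes> ?J \<otimes> ?T \<otimes> ?J))"
      by (simp add: m_assoc bc'[of ?T] bc'[of ?J])
    also have "\<dots> = b \<otimes> (b \<otimes> (?J \<otimes> ?T \<otimes> ?J \<otimes> ?T))"
      using JM_braid[OF JM_start_one, of k] Suc.prems by simp
    also have "\<dots> = (b \<otimes> ?J) \<otimes> ?T \<otimes> (b \<otimes> ?J) \<otimes> ?T"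
      by (simp add: m_assoc bc'[of ?T] bc'[of ?J])
    finally show ?thesis .
  qed
  have "?T \<otimes> (b \<otimes> ?J) \<otimes> ?T \<oplus> Q \<otimes> Q \<otimes> Q [^] n \<in> Units R"
  proof (rule conjugate_plus_central_Units[OF _ _ _ _ Q Q_central pow _ br])
    show "?T \<otimes> ?T = (Q \<ominus> \<one>) \<otimes> ?T \<oplus> Q" using Suc.prems by (intro g_quadratic) auto
    show "b \<otimes> ?J \<oplus> Q [^] n \<in> Units R" "b \<otimes> ?J \<oplus> Q \<otimes> Q [^] n \<in> Units R"
      "b \<otimes> ?J \<oplus> Q \<otimes> Q \<otimes> Q [^] n \<in> Units R"
      unfolding QQ using Suc.prems n by (intro IH; simp)+
  qed simp_all
  moreover have "?T \<otimes> (b \<otimes> ?J) \<otimes> ?T = b \<otimes> JM \<one> (Suc k)" by (simp add: m_assoc bc'[of ?T])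
  ultimately show ?case unfolding QQ n b_def by simp
qed

lemma zeta_Units:
  assumes Q: "Q \<in> Units R"
    and units: "\<And>n. n < r \<Longrightarrow> Q0 \<oplus> Q [^] n \<in> Units R" "\<And>n. n < r \<Longrightarrow> Q0 \<otimes> Q [^] n \<oplus> \<one> \<in> Units R"
    and "a \<le> r"
  shows "\<zeta> a \<in> Units R"
  using assms(4)
proof (induction a)
  case 0
  then show ?case by (simp add: \<zeta>_def)
next
  case (Suc k)
  have [simp]: "JM \<one> k \<in> carrier R" using Suc by (simp add: JM_one_closed)
  let ?q = "Q [^] (r - 1)"
  have q: "?q \<in> Units R" using Q by (rule Units_pow_closed)
  \<comment> \<open>The exponent r - 1 + k is admissible: k < r gives 2k \<le> r - 1 + k \<le> 2(r -
    1).\<close>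
  have "Q [^] k \<oplus> Q0 \<otimes> JM \<one> k = inv ?q \<otimes> (?q \<otimes> Q0 \<otimes> JM \<one> k \<oplus> Q [^] (r - 1 + k))"
    using q by (simp add: r_distr m_assoc nat_pow_mult[symmetric] a_comm) (simp add: m_assoc[symmetric])
  also have "\<dots> \<in> Units R"
    using Suc.prems by (intro Units_m_closed Units_inv_Units q JM_one_Units assms) auto
  finally show ?case using Suc by (simp add: \<zeta>_def Units_m_closed)
qed

end

section \<open>Young subgroups\<close>

lemma s_B_image:
  assumes "1 \<le> i" "i \<noteq> a"
  shows "s_B i ` {1..int a} = {1..int a}"
proof -
  have sub: "s_B i ` {1..int a} \<subseteq> {1..int a}" using assms by (auto simp: s_B_pos)
  have "s_B i (s_B i x) = x" for x using s_B_s_B[of i] by (simp add: fun_eq_iff)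
  then have "x \<in> s_B i ` {1..int a}" if "x \<in> {1..int a}" for x
    using sub that by (metis image_eqI image_subset_iff)
  with sub show ?thesis by blast
qed

lemma Wbar_subset:
  assumes "w \<in> Wbar r"
  shows "w \<in> carrier (W_B r) \<and> w ` {1..int r} = {1..int r}"
  using assms unfolding Wbar_def
proof (induction rule: generate.induct)
  case one
  have one: "\<one>\<^bsub>W_B r\<^esub> = id" by (simp add: W_B_def)
  show ?case unfolding one by (rule conjI[OF id_W_B]) simp
next
  case (incl h)
  then obtain i where "h = s_B i" "1 \<le> i" "i < r" by auto
  then show ?case using s_B_image[of i r] by (simp add: s_B_W_B)
next
  case (inv h)
  then obtain i where i: "h = s_B i" "1 \<le> i" "i < r" by auto
  interpret monoid "W_B r"
    using comp_W_B id_W_B by (intro monoidI) (auto simp: W_B_def)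
  have "inv\<^bsub>W_B r\<^esub> h = h"
    by (rule inv_char) (use i s_B_W_B s_B_s_B in \<open>auto simp: W_B_def\<close>)
  then show ?case using i s_B_image[of i r] by (simp add: s_B_W_B)
next
  case (eng h1 h2)
  have "h1 \<otimes>\<^bsub>W_B r\<^esub> h2 = h1 \<circ> h2" by (simp add: W_B_def)
  then show ?case using eng.IH by (metis comp_W_B image_comp)
qed

lemma finite_W_B: "finite (carrier (W_B r))"
proof -
  have "finite {i :: int. i \<noteq> 0 \<and> \<bar>i\<bar> \<le> int r}"
    by (rule finite_subset[of _ "{- int r..int r}"]) auto
  then show ?thesis
    by (intro finite_subset[OF _ finite_permutations]) (auto simp: W_B_def)
qed

lemma finite_Young: "finite (Young r \<mu>)"
  by (rule finite_subset[OF _ finite_W_B[of r]]) (auto simp: Young_def Wbar_subset)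

text \<open>The block condition in recursive form, with \<open>s\<close> the offset of the next
  block, so that empty blocks and concatenation are handled by induction on the list.\<close>

primrec stabilizes :: "(int \<Rightarrow> int) \<Rightarrow> int \<Rightarrow> nat list \<Rightarrow> bool" where
  "stabilizes w s [] \<longleftrightarrow> True"
| "stabilizes w s (m # \<mu>) \<longleftrightarrow> w ` {s + 1..s + int m} = {s + 1..s + int m} \<and> stabilizes w (s + int m) \<mu>"

lemma stabilizes_iff:
  "stabilizes w s \<mu> \<longleftrightarrow> (\<forall>j<length \<mu>. w ` {s + int (sum_list (take j \<mu>)) + 1..s + int (sum_list (take (Suc j) \<mu>))} =
     {s + int (sum_list (take j \<mu>)) + 1..s + int (sum_list (take (Suc j) \<mu>))})"
  by (induction \<mu> arbitrary: s) (simp_all add: All_less_Suc2 add.assoc[symmetric])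

lemma Young_stabilizes: "Young r \<mu> = {w \<in> Wbar r. stabilizes w 0 \<mu>}"
  by (auto simp: Young_def block_def stabilizes_iff)

lemma stabilizes_filter: "stabilizes w s (filter (\<lambda>m. m \<noteq> 0) \<mu>) \<longleftrightarrow> stabilizes w s \<mu>"
  by (induction \<mu> arbitrary: s) auto

lemma Young_cong_filter:
  "filter (\<lambda>m. m \<noteq> 0) \<mu> = filter (\<lambda>m. m \<noteq> 0) \<nu> \<Longrightarrow> Young r \<mu> = Young r \<nu>"
  using stabilizes_filter[of _ 0 \<mu>] stabilizes_filter[of _ 0 \<nu>] by (simp add: Young_stabilizes)

lemma stabilizes_append: "stabilizes w s (\<mu> @ \<nu>) \<longleftrightarrow> stabilizes w s \<mu> \<and> stabilizes w (s + int (sum_list \<mu>)) \<nu>"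
  by (induction \<mu> arbitrary: s) (auto simp: add.assoc)

lemma stabilizes_imp_image:
  "stabilizes w s \<mu> \<Longrightarrow> w ` {s + 1..s + int (sum_list \<mu>)} = {s + 1..s + int (sum_list \<mu>)}"
proof (induction \<mu> arbitrary: s)
  case (Cons m \<mu>)
  have "{s + 1..s + int (sum_list (m # \<mu>))} =
      {s + 1..s + int m} \<union> {s + int m + 1..s + int m + int (sum_list \<mu>)}" by auto
  with Cons show ?case by (simp only: image_Un stabilizes.simps)
qed simp

section \<open>Moving bicompositions into \<open>Pi1B\<close>\<close>

lemma length_filter_le_sum_list: "length (filter (\<lambda>m. m \<noteq> 0) \<mu>) \<le> sum_list (\<mu> :: nat list)"
  by (induction \<mu>) auto

lemma sum_list_filter_nonzero: "sum_list (filter (\<lambda>m. m \<noteq> 0) \<mu>) = sum_list (\<mu> :: nat list)"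
  by (induction \<mu>) auto

text \<open>Zero parts do not affect the Young subgroup, so the nonzero parts of both components can
  be gathered in the second one. For bicompositions of r there are at most r of them, hence they
  fit.\<close>

definition to_Pi1B :: "nat \<Rightarrow> nat list \<times> nat list \<Rightarrow> nat list \<times> nat list" where
  "to_Pi1B r \<mu> = (let \<nu> = filter (\<lambda>m. m \<noteq> 0) (fst \<mu> @ snd \<mu>)
     in (replicate r 0, \<nu> @ replicate (r - length \<nu>) 0))"

lemma to_Pi1B_mem:
  assumes "\<mu> \<in> Pi2 r"
  shows "to_Pi1B r \<mu> \<in> Pi1B r"
proof -
  have "sum_list (fst \<mu> @ snd \<mu>) = r" using assms by (auto simp: Pi2_def compositions_def)
  then have "length (filter (\<lambda>m. m \<noteq> 0) (fst \<mu> @ snd \<mu>)) \<le> r" "sum_list (filter (\<lambda>m. m \<noteq> 0) (fst \<mu> @ snd \<mu>)) = r"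
    using length_filter_le_sum_list[of "fst \<mu> @ snd \<mu>"] sum_list_filter_nonzero[of "fst \<mu> @ snd \<mu>"] by simp_all
  then show ?thesis
    by (auto simp: to_Pi1B_def Let_def Pi1B_def Pi2_def compositions_def sum_list_replicate
      intro!: exI[of _ 0] simp del: filter_append)
qed

lemma Young_to_Pi1B: "Young r (fst (to_Pi1B r \<mu>) @ snd (to_Pi1B r \<mu>)) = Young r (fst \<mu> @ snd \<mu>)"
  by (rule Young_cong_filter) (simp add: to_Pi1B_def Let_def)

lemma finite_Pi2: "finite (Pi2 r)"
proof -
  have "finite (compositions r k)" for k
    by (rule finite_subset[OF _ finite_lists_length_eq[of "{..k}" r]])
      (auto simp: compositions_def member_le_sum_list)
  moreover have "finite {(a, b). a + b = r}"
    by (rule finite_subset[of _ "{..r} \<times> {..r}"]) auto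
  ultimately show ?thesis unfolding Pi2_def by (intro finite_UN_I) auto
qed

section \<open>Quasi-idempotents in the Hecke algebra\<close>

text \<open>Since p commutes with z^(-1), p z^(-1) p = p, so multiplication by z^(-1) splits
  multiplication by p from xH to pxH. The delicate point is that z^(-1) maps pxH into xH.\<close>

lemma (in ring) right_ideal_retract:
  assumes [simp]: "p \<in> carrier R" "x \<in> carrier R" and z: "z \<in> Units R"
    and pp: "p \<otimes> p = p \<otimes> z" and pz: "p \<otimes> z = z \<otimes> p" and px: "p \<otimes> x = x \<otimes> p"
  shows "(\<lambda>y\<in>carrier (right_ideal R x). p \<otimes> y) \<in> rmod_hom R (right_ideal R x) (right_ideal R (p \<otimes> x))"
    and "(\<lambda>y\<in>carrier (right_ideal R (p \<otimes> x)). inv z \<otimes> y) \<in> rmod_hom R (right_ideal R (p \<otimes> x)) (right_ideal R x)"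
    and "y \<in> carrier (right_ideal R (p \<otimes> x)) \<Longrightarrow> p \<otimes> (inv z \<otimes> y) = y"
proof -
  have [simp]: "z \<in> carrier R" "inv z \<in> carrier R" using z by auto
  have px': "p \<otimes> (x \<otimes> h) = x \<otimes> (p \<otimes> h)" if "h \<in> carrier R" for h
    using that px by (simp add: m_assoc[symmetric])
  interpret I: right_module R "right_ideal R x" by (rule right_module_right_ideal[OF ring_axioms]) simp
  interpret J: right_module R "right_ideal R (p \<otimes> x)" by (rule right_module_right_ideal[OF ring_axioms]) simp
  have ops: "u \<oplus>\<^bsub>right_ideal R v\<^esub> w = u \<oplus> w" "u \<lhd>\<^bsub>right_ideal R v\<^esub> w = u \<otimes> w" for u v w
    by (simp_all add: right_ideal_def)
  have sub: "u \<in> carrier R" if "u \<in> carrier (right_ideal R v)" "v \<in> carrier R" for u v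
    using that by (auto simp: right_ideal_def)
  \<comment> \<open>No commutation of z with x is assumed; p mediates: z p x = p^2 x = x p^2 = x p
    z.\<close>
  have zpx: "z \<otimes> (p \<otimes> x) = x \<otimes> p \<otimes> z"
  proof -
    have "z \<otimes> (p \<otimes> x) = p \<otimes> p \<otimes> x" by (simp add: pp pz m_assoc)
    also have "\<dots> = x \<otimes> (p \<otimes> p)" by (simp add: m_assoc px px')
    finally show ?thesis by (simp add: pp m_assoc)
  qed
  have izpx: "inv z \<otimes> (p \<otimes> x) = x \<otimes> p \<otimes> inv z"
  proof -
    have "inv z \<otimes> (p \<otimes> x) = inv z \<otimes> (x \<otimes> p \<otimes> z) \<otimes> inv z" using z by (simp add: m_assoc px)
    also have "\<dots> = x \<otimes> p \<otimes> inv z" using z unfolding zpx[symmetric] by (simp add: m_assoc[symmetric] px)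
    finally show ?thesis .
  qed
  show "(\<lambda>y\<in>carrier (right_ideal R x). p \<otimes> y) \<in> rmod_hom R (right_ideal R x) (right_ideal R (p \<otimes> x))"
  proof (rule rmod_homI)
    show "(\<lambda>y\<in>carrier (right_ideal R x). p \<otimes> y) \<in> carrier (right_ideal R x) \<rightarrow>\<^sub>E carrier (right_ideal R (p \<otimes> x))"
      by (auto simp: right_ideal_def m_assoc[symmetric])
  qed (use sub I.M.a_closed I.ract_closed in \<open>simp_all add: ops r_distr m_assoc\<close>)
  show "(\<lambda>y\<in>carrier (right_ideal R (p \<otimes> x)). inv z \<otimes> y) \<in> rmod_hom R (right_ideal R (p \<otimes> x)) (right_ideal R x)"
  proof (rule rmod_homI)
    have "inv z \<otimes> (p \<otimes> x \<otimes> h) = x \<otimes> (p \<otimes> inv z \<otimes> h)" if "h \<in> carrier R" for h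
    proof -
      have "inv z \<otimes> (p \<otimes> x \<otimes> h) = inv z \<otimes> (p \<otimes> x) \<otimes> h" using that by (simp add: m_assoc)
      then show ?thesis using that unfolding izpx by (simp add: m_assoc)
    qed
    then show "(\<lambda>y\<in>carrier (right_ideal R (p \<otimes> x)). inv z \<otimes> y) \<in>
        carrier (right_ideal R (p \<otimes> x)) \<rightarrow>\<^sub>E carrier (right_ideal R x)"
      by (auto simp: right_ideal_def)
  qed (use sub J.M.a_closed J.ract_closed in \<open>simp_all add: ops r_distr m_assoc\<close>)
  assume "y \<in> carrier (right_ideal R (p \<otimes> x))"
  then obtain h where h: "h \<in> carrier R" "y = p \<otimes> x \<otimes> h" by (auto simp: right_ideal_def)
  have zp: "p \<otimes> inv z = inv z \<otimes> p"
  proof -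
    have "p \<otimes> inv z = inv z \<otimes> (z \<otimes> p) \<otimes> inv z" using z by (simp add: m_assoc[symmetric])
    also have "\<dots> = inv z \<otimes> p" using z by (simp add: pz[symmetric] m_assoc)
    finally show ?thesis .
  qed
  have "p \<otimes> (inv z \<otimes> y) = p \<otimes> inv z \<otimes> p \<otimes> (x \<otimes> h)" using h by (simp add: m_assoc)
  also have "\<dots> = inv z \<otimes> (p \<otimes> p) \<otimes> (x \<otimes> h)" using h by (simp add: zp m_assoc)
  also have "\<dots> = y" using h z by (simp add: pp pz m_assoc[symmetric])
  finally show "p \<otimes> (inv z \<otimes> y) = y" .
qed

section \<open>From the basis \<open>T\<close> to generators and relations\<close>

context hecke_algebra_B
begin

abbreviation scalar :: "'a \<Rightarrow> 'h" where
  "scalar c \<equiv> c \<odot>\<^bsub>H\<^esub> \<one>\<^bsub>H\<^esub>"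

lemma scalar_mult_left: "\<lbrakk>c \<in> carrier R; x \<in> carrier H\<rbrakk> \<Longrightarrow> scalar c \<otimes>\<^bsub>H\<^esub> x = c \<odot>\<^bsub>H\<^esub> x"
  by (simp add: smult_mult_left)

lemma scalar_mult_right: "\<lbrakk>c \<in> carrier R; x \<in> carrier H\<rbrakk> \<Longrightarrow> x \<otimes>\<^bsub>H\<^esub> scalar c = c \<odot>\<^bsub>H\<^esub> x"
  by (simp add: smult_mult_right)

lemma scalar_mult: "\<lbrakk>c \<in> carrier R; d \<in> carrier R\<rbrakk> \<Longrightarrow> scalar (c \<otimes>\<^bsub>R\<^esub> d) = scalar c \<otimes>\<^bsub>H\<^esub> scalar d"
  by (simp add: scalar_mult_left smult_assoc1)

lemma scalar_add: "\<lbrakk>c \<in> carrier R; d \<in> carrier R\<rbrakk> \<Longrightarrow> scalar (c \<oplus>\<^bsub>R\<^esub> d) = scalar c \<oplus>\<^bsub>H\<^esub> scalar d"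
  by (simp add: smult_l_distr)

lemma scalar_pow: "c \<in> carrier R \<Longrightarrow> scalar (c [^]\<^bsub>R\<^esub> (n::nat)) = scalar c [^]\<^bsub>H\<^esub> n"
  by (induction n) (simp_all add: scalar_mult)

lemma scalar_Units:
  assumes "c \<in> Units R"
  shows "scalar c \<in> Units H"
proof -
  obtain d where d: "c \<in> carrier R" "d \<in> carrier R" "d \<otimes>\<^bsub>R\<^esub> c = \<one>\<^bsub>R\<^esub>" "c \<otimes>\<^bsub>R\<^esub> d = \<one>\<^bsub>R\<^esub>"
    using assms by (auto simp: Units_def)
  then have "scalar d \<otimes>\<^bsub>H\<^esub> scalar c = \<one>\<^bsub>H\<^esub>" "scalar c \<otimes>\<^bsub>H\<^esub> scalar d = \<one>\<^bsub>H\<^esub>"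
    by (simp_all add: scalar_mult[symmetric])
  then show ?thesis using d by (auto simp: Units_def)
qed

lemma scalar_minus_one: "c \<in> carrier R \<Longrightarrow> scalar (c \<ominus>\<^bsub>R\<^esub> \<one>\<^bsub>R\<^esub>) = scalar c \<ominus>\<^bsub>H\<^esub> \<one>\<^bsub>H\<^esub>"
  by (simp add: a_minus_def scalar_add smult_l_minus)

lemma T_ascent:
  assumes "w \<in> carrier (W_B r)" "i < r" "ascent w i"
  shows "T w \<otimes>\<^bsub>H\<^esub> T (s_B i) = T (w \<circ> s_B i)"
  using assms by (intro T_mult s_B_W_B) (simp_all add: length_B_ascent length_B_s_B)

lemma T_s_T_s:
  assumes "i < r" "j < r" "i \<noteq> j"
  shows "T (s_B i) \<otimes>\<^bsub>H\<^esub> T (s_B j) = T (s_B i \<circ> s_B j)"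
  using assms
  by (intro T_ascent s_B_W_B) (cases "i = 0"; cases "j = 0"; auto simp: ascent_def s_B_zero s_B_pos)+

lemma generators_commute:
  assumes "i + 1 < j" "j < r"
  shows "T (s_B i) \<otimes>\<^bsub>H\<^esub> T (s_B j) = T (s_B j) \<otimes>\<^bsub>H\<^esub> T (s_B i)"
proof -
  have "s_B i \<circ> s_B j = s_B j \<circ> s_B i"
    using assms by (cases "i = 0") (auto simp: fun_eq_iff s_B_zero s_B_pos)
  then show ?thesis using assms by (simp add: T_s_T_s)
qed

lemma generators_braid:
  assumes "1 \<le> i" "i + 1 < r"
  shows "T (s_B i) \<otimes>\<^bsub>H\<^esub> T (s_B (i + 1)) \<otimes>\<^bsub>H\<^esub> T (s_B i) =
    T (s_B (i + 1)) \<otimes>\<^bsub>H\<^esub> T (s_B i) \<otimes>\<^bsub>H\<^esub> T (s_B (i + 1))"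
proof -
  have "s_B i \<circ> s_B (i + 1) \<circ> s_B i = s_B (i + 1) \<circ> s_B i \<circ> s_B (i + 1)"
    using assms by (auto simp: fun_eq_iff s_B_pos)
  moreover have "ascent (s_B i \<circ> s_B (i + 1)) i" "ascent (s_B (i + 1) \<circ> s_B i) (i + 1)"
    using assms by (auto simp: ascent_def s_B_pos)
  ultimately show ?thesis
    using assms by (simp add: T_s_T_s T_ascent comp_W_B s_B_W_B)
qed

lemma generators_braid_0:
  assumes "1 < r"
  shows "T (s_B 0) \<otimes>\<^bsub>H\<^esub> T (s_B 1) \<otimes>\<^bsub>H\<^esub> T (s_B 0) \<otimes>\<^bsub>H\<^esub> T (s_B 1) =
    T (s_B 1) \<otimes>\<^bsub>H\<^esub> T (s_B 0) \<otimes>\<^bsub>H\<^esub> T (s_B 1) \<otimes>\<^bsub>H\<^esub> T (s_B 0)"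
proof -
  have "s_B 0 \<circ> s_B 1 \<circ> s_B 0 \<circ> s_B 1 = s_B 1 \<circ> s_B 0 \<circ> s_B 1 \<circ> s_B 0"
  proof
    fix x :: int
    consider "x = 1" | "x = - 1" | "x = 2" | "x = - 2" | "x \<notin> {1, - 1, 2, - 2}" by blast
    then show "(s_B 0 \<circ> s_B 1 \<circ> s_B 0 \<circ> s_B 1) x = (s_B 1 \<circ> s_B 0 \<circ> s_B 1 \<circ> s_B 0) x"
      by cases (simp_all add: s_B_pos s_B_zero)
  qed
  moreover have "ascent (s_B 0 \<circ> s_B 1) 0" "ascent (s_B 0 \<circ> s_B 1 \<circ> s_B 0) 1"
    "ascent (s_B 1 \<circ> s_B 0) 1" "ascent (s_B 1 \<circ> s_B 0 \<circ> s_B 1) 0"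
    by (auto simp: ascent_def s_B_pos s_B_zero)
  ultimately show ?thesis
    using assms by (simp add: T_s_T_s T_ascent comp_W_B s_B_W_B)
qed

sublocale gens: hecke_generators H r "\<lambda>i. T (s_B i)" "scalar q" "scalar q0"
proof (unfold_locales, goal_cases)
  case (1 i)
  then show ?case by (simp add: T_closed s_B_W_B)
next
  case (6 i)
  then show ?case
    using T_quadratic[of i] by (simp add: scalar_minus_one[symmetric] scalar_mult_left q_closed T_closed s_B_W_B)
next
  case 7
  then show ?case
    using T_quadratic_0 by (simp add: scalar_minus_one[symmetric] scalar_mult_left q0_closed T_closed s_B_W_B)
next
  case (8 i j)
  then show ?case by (rule generators_commute)
next
  case (9 i)
  then show ?case by (rule generators_braid)
next
  case 10
  then show ?case by (rule generators_braid_0)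
qed (simp_all add: q_closed q0_closed scalar_mult_left scalar_mult_right)

text \<open>Lengths add in two stages: s t is longer than t by the comparison with its inverse, and
  s t s is longer than s t by an ascent.\<close>

lemma T_t_B: "k < r \<Longrightarrow> T (t_B (Suc k)) = gens.JM (T (s_B 0)) k"
proof (induction k)
  case (Suc k)
  let ?s = "s_B (Suc k)" and ?t = "t_B (Suc k)"
  have t: "?t \<in> carrier (W_B r)" and s: "?s \<in> carrier (W_B r)"
    using Suc.prems by (auto intro: t_B_W_B s_B_W_B)
  have "ascent (?s \<circ> ?t) (Suc k)"
    by (auto simp: ascent_def t_B_eq transpose_def s_B_pos)
  then have "T (?s \<circ> ?t \<circ> ?s) = T (?s \<circ> ?t) \<otimes>\<^bsub>H\<^esub> T ?s"
    using Suc.prems by (intro T_ascent[symmetric] comp_W_B s t)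
  also have "T (?s \<circ> ?t) = T ?s \<otimes>\<^bsub>H\<^esub> T ?t"
    using length_B_s_B_t_B[of "Suc k" r] length_B_s_B[of "Suc k" r] Suc.prems
    by (intro T_mult[symmetric] s t) simp
  finally show ?case using Suc by simp
qed simp

lemma pi_elem_eq: "a \<le> r \<Longrightarrow> pi_elem R q H T a = gens.\<pi> a"
  by (induction a) (simp_all add: gens.\<pi>_def scalar_pow q_closed T_t_B)

text \<open>Prepares the base case of the induction over descents in
  \<open>T_commutes_if_image\<close>.\<close>

lemma T_id_commutes_generator:
  assumes "i < r"
  shows "gens.commutes (T id) (T (s_B i))"
proof -
  have "length_B r id = 0" using length_B_inversions[OF id_W_B, of r] by simp
  then show ?thesis
    using assms T_mult[OF id_W_B s_B_W_B[OF assms]] T_mult[OF s_B_W_B[OF assms] id_W_B]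
    by (simp add: gens.commutes_def)
qed

text \<open>Right descents at i \<ge> 1 are stripped until the identity is left. The index a never
  occurs among them: invariance of {1..a} and {1..r} forces w(a) \<le> a < w(a + 1).\<close>

lemma T_commutes_if_image:
  assumes "w \<in> carrier (W_B r)" "w ` {1..int a} = {1..int a}" "w ` {1..int r} = {1..int r}"
    and a: "a \<le> r" and c: "c \<in> carrier H"
    and gen: "\<And>j. \<lbrakk>1 \<le> j; j < r; j \<noteq> a\<rbrakk> \<Longrightarrow> gens.commutes c (T (s_B j))"
    and c_id: "gens.commutes c (T id)"
  shows "gens.commutes c (T w)"
  using assms(1-3)
proof (induction "card (inversions r w)" arbitrary: w rule: less_induct)
  case less
  show ?case
  proof (cases "\<forall>i. 1 \<le> i \<and> i < r \<longrightarrow> ascent w i")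
    case True
    then have "w = id" using less.prems by (intro increasing_imp_id_on) auto
    then show ?thesis using c_id by simp
  next
    case False
    then obtain i where i: "1 \<le> i" "i < r" "\<not> ascent w i" by blast
    have ia: "i \<noteq> a"
    proof
      assume "i = a"
      have mem: "int a \<in> {1..int a}" "int a + 1 \<in> {1..int r}" "int a + 1 \<notin> {1..int a}"
        using i \<open>i = a\<close> by auto
      have "w (int a) \<in> {1..int a}" "w (int a + 1) \<in> {1..int r}"
        using mem less.prems by blast+
      moreover have "w (int a + 1) \<notin> {1..int a}"
        using mem(3) less.prems(2) W_B_inj[OF less.prems(1)] by (metis imageE)
      ultimately show False using i \<open>i = a\<close> by (auto simp: ascent_def)
    qed
    let ?v = "w \<circ> s_B i"
    have v: "?v \<in> carrier (W_B r)" by (intro comp_W_B less.prems s_B_W_B i)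
    have w: "w = ?v \<circ> s_B i" by (simp add: comp_assoc s_B_s_B)
    have asc: "ascent ?v i" using i by (simp add: ascent_s_B[OF less.prems(1)])
    have "card (inversions r (?v \<circ> s_B i)) = card (inversions r ?v) + 2"
      by (intro card_inversions_ascent v i asc)
    then have "card (inversions r ?v) < card (inversions r w)" by (simp add: w[symmetric])
    moreover have "?v ` {1..int a} = {1..int a}" "?v ` {1..int r} = {1..int r}"
      unfolding image_comp[symmetric] using less.prems i s_B_image[OF i(1) ia] s_B_image[of i r] by simp_all
    ultimately have "gens.commutes c (T ?v)" using v by (intro less.hyps)
    then have "gens.commutes c (T ?v \<otimes>\<^bsub>H\<^esub> T (s_B i))"
      using c i ia v by (intro gens.commutes_mult gen) (auto simp: T_closed s_B_W_B)
    then show ?thesis unfolding T_ascent[OF v i(2) asc] using w by simp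
  qed
qed

text \<open>The blocks of the first component fill {1..a}, so every element of the Young subgroup
  preserves this interval and each summand commutes with \<open>\<pi> a\<close>.\<close>

lemma commutes_pi_xbar:
  assumes "\<mu> \<in> Pi2 r"
  shows "gens.commutes (gens.\<pi> (sum_list (fst \<mu>))) (xbar_elem r H T \<mu>)"
proof -
  define a where "a = sum_list (fst \<mu>)"
  have a: "a \<le> r" using assms by (auto simp: Pi2_def compositions_def a_def)
  have p: "gens.\<pi> a \<in> carrier H" by (rule gens.pi_closed[OF a])
  define e where "e = T id"
  have e: "e \<in> carrier H" "\<And>i. i < r \<Longrightarrow> gens.commutes e (T (s_B i))"
    unfolding e_def using T_closed[OF id_W_B] T_id_commutes_generator by blast+
  have JM_id: "gens.commutes e (gens.JM (T (s_B 0)) k)" if "k < r" for k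
    using that
  proof (induction k)
    case (Suc k)
    then show ?case by (auto intro!: gens.commutes_mult gens.JM_g_closed e simp: T_closed s_B_W_B)
  qed (simp add: e)
  have id: "gens.commutes (gens.\<pi> a) (T id)"
    unfolding gens.\<pi>_def e_def[symmetric] using a
    by (intro gens.commutes_sym[OF gens.commutes_qprod]) (auto simp: e JM_id gens.JM_g_closed)
  have comm: "gens.commutes (gens.\<pi> a) (T w)" and w_closed: "T w \<in> carrier H"
    if "w \<in> Young r (fst \<mu> @ snd \<mu>)" for w
  proof -
    have w: "w \<in> carrier (W_B r)" "w ` {1..int r} = {1..int r}"
      using that Wbar_subset[of w r] by (auto simp: Young_def)
    show "T w \<in> carrier H" by (rule T_closed[OF w(1)])
    have "stabilizes w 0 (fst \<mu>)" using that by (simp add: Young_stabilizes stabilizes_append)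
    from stabilizes_imp_image[OF this] have "w ` {1..int a} = {1..int a}" by (simp add: a_def)
    then show "gens.commutes (gens.\<pi> a) (T w)"
      by (intro T_commutes_if_image[OF w(1) _ w(2) a p]) (auto intro!: id gens.commutes_sym[OF gens.commutes_g_pi] a)
  qed
  have "gens.\<pi> a \<otimes>\<^bsub>H\<^esub> xbar_elem r H T \<mu> = (\<Oplus>\<^bsub>H\<^esub> w\<in>Young r (fst \<mu> @ snd \<mu>). gens.\<pi> a \<otimes>\<^bsub>H\<^esub> T w)"
    unfolding xbar_elem_def using w_closed by (intro H.finsum_rdistr finite_Young p) auto
  also have "\<dots> = (\<Oplus>\<^bsub>H\<^esub> w\<in>Young r (fst \<mu> @ snd \<mu>). T w \<otimes>\<^bsub>H\<^esub> gens.\<pi> a)"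
    using w_closed comm p by (intro M.finsum_cong') (auto simp: gens.commutes_def)
  also have "\<dots> = xbar_elem r H T \<mu> \<otimes>\<^bsub>H\<^esub> gens.\<pi> a"
    unfolding xbar_elem_def using w_closed by (intro H.finsum_ldistr[symmetric] finite_Young p) auto
  finally show ?thesis by (simp add: gens.commutes_def a_def)
qed

lemma xbar_closed: "xbar_elem r H T \<mu> \<in> carrier H"
  unfolding xbar_elem_def
  by (intro M.finsum_closed) (auto simp: Young_def Wbar_subset intro!: T_closed)

text \<open>The generator attached to \<open>to_Pi1B r \<mu>\<close> equals
  \<open>xbar_elem r H T \<mu>\<close>, because the Young subgroups agree and the prefactor is 1.
  Thus \<open>right_ideal_retract\<close> applies with p = \<pi> a and z = \<zeta> a.\<close>

lemma Morita_equivalent_qSchur: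
  assumes q: "q \<in> Units R"
    and units: "\<And>n. n < r \<Longrightarrow> q0 \<oplus>\<^bsub>R\<^esub> q [^]\<^bsub>R\<^esub> n \<in> Units R"
      "\<And>n. n < r \<Longrightarrow> q0 \<otimes>\<^bsub>R\<^esub> q [^]\<^bsub>R\<^esub> n \<oplus>\<^bsub>R\<^esub> \<one>\<^bsub>R\<^esub> \<in> Units R"
  shows "Morita_equivalent TYPE('u::infinite) (qSchur2 r R q H T) (qSchur1B r R q H T)"
proof -
  have zeta: "gens.\<zeta> a \<in> Units H" if "a \<le> r" for a
  proof (rule gens.zeta_Units[OF _ _ _ that])
    fix n assume "n < r"
    then show "scalar q0 \<oplus>\<^bsub>H\<^esub> scalar q [^]\<^bsub>H\<^esub> n \<in> Units H"
      "scalar q0 \<otimes>\<^bsub>H\<^esub> scalar q [^]\<^bsub>H\<^esub> n \<oplus>\<^bsub>H\<^esub> \<one>\<^bsub>H\<^esub> \<in> Units H"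
      using units[of n, THEN scalar_Units]
      by (simp_all add: scalar_add scalar_mult scalar_pow q_closed q0_closed)
  qed (use q scalar_Units in auto)
  have le: "sum_list (fst \<mu>) \<le> r" if "\<mu> \<in> Pi2 r" for \<mu>
    using that by (auto simp: Pi2_def compositions_def)
  have sub: "Pi1B r \<subseteq> Pi2 r" by (auto simp: Pi1B_def)
  have x: "x_elem r R q H T \<mu> = gens.\<pi> (sum_list (fst \<mu>)) \<otimes>\<^bsub>H\<^esub> xbar_elem r H T \<mu>" if "\<mu> \<in> Pi2 r" for \<mu>
    by (simp add: x_elem_def pi_elem_eq[OF le[OF that]])
  have x1: "x_elem r R q H T (to_Pi1B r \<mu>) = xbar_elem r H T \<mu>" if "\<mu> \<in> Pi2 r" for \<mu>
  proof -
    have 1: "xbar_elem r H T (to_Pi1B r \<mu>) = xbar_elem r H T \<mu>"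
      by (simp add: xbar_elem_def Young_to_Pi1B)
    have 2: "sum_list (fst (to_Pi1B r \<mu>)) = 0"
      using to_Pi1B_mem[OF that] by (simp add: Pi1B_def)
    show ?thesis unfolding x_elem_def 1 2 by (simp add: xbar_closed)
  qed
  let ?M = "\<lambda>\<mu>. right_ideal H (x_elem r R q H T \<mu>)"
  have pp: "gens.\<pi> a \<otimes>\<^bsub>H\<^esub> gens.\<pi> a = gens.\<pi> a \<otimes>\<^bsub>H\<^esub> gens.\<zeta> a"
    "gens.\<pi> a \<otimes>\<^bsub>H\<^esub> gens.\<zeta> a = gens.\<zeta> a \<otimes>\<^bsub>H\<^esub> gens.\<pi> a" if "a \<le> r" for a
    using gens.pi_pi[OF order.refl that] gens.commutes_pi_zeta[OF order.refl that]
    by (simp_all add: gens.commutes_def)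
  have px: "gens.\<pi> (sum_list (fst \<mu>)) \<otimes>\<^bsub>H\<^esub> xbar_elem r H T \<mu> =
      xbar_elem r H T \<mu> \<otimes>\<^bsub>H\<^esub> gens.\<pi> (sum_list (fst \<mu>))" if "\<mu> \<in> Pi2 r" for \<mu>
    using commutes_pi_xbar[OF that] by (simp add: gens.commutes_def)
  note retract = H.right_ideal_retract[OF gens.pi_closed[OF le] xbar_closed zeta[OF le] pp[OF le] px]
  show ?thesis
    unfolding qSchur2_def qSchur1B_def
  proof (rule Morita_equivalent_direct_sum_retracts[OF H.ring_axioms _ finite_Pi2 sub to_Pi1B_mem, where
      f = "\<lambda>\<mu>. \<lambda>y\<in>carrier (right_ideal H (xbar_elem r H T \<mu>)). gens.\<pi> (sum_list (fst \<mu>)) \<otimes>\<^bsub>H\<^esub> y" and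
      g = "\<lambda>\<mu>. \<lambda>y\<in>carrier (?M \<mu>). inv\<^bsub>H\<^esub> (gens.\<zeta> (sum_list (fst \<mu>))) \<otimes>\<^bsub>H\<^esub> y"])
    fix \<mu> assume \<mu>: "\<mu> \<in> Pi2 r"
    show "right_module H (?M \<mu>)"
      using \<mu> by (intro right_module_right_ideal H.ring_axioms) (simp add: x gens.pi_closed le xbar_closed)
    show "(\<lambda>y\<in>carrier (right_ideal H (xbar_elem r H T \<mu>)). gens.\<pi> (sum_list (fst \<mu>)) \<otimes>\<^bsub>H\<^esub> y)
        \<in> rmod_hom H (?M (to_Pi1B r \<mu>)) (?M \<mu>)"
      using retract(1)[OF \<mu> \<mu> \<mu> \<mu> \<mu>] by (simp add: x[OF \<mu>] x1[OF \<mu>])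
    show g: "(\<lambda>y\<in>carrier (?M \<mu>). inv\<^bsub>H\<^esub> (gens.\<zeta> (sum_list (fst \<mu>))) \<otimes>\<^bsub>H\<^esub> y)
        \<in> rmod_hom H (?M \<mu>) (?M (to_Pi1B r \<mu>))"
      using retract(2)[OF \<mu> \<mu> \<mu> \<mu> \<mu>] by (simp add: x[OF \<mu>] x1[OF \<mu>])
    fix y assume y: "y \<in> carrier (?M \<mu>)"
    have "inv\<^bsub>H\<^esub> (gens.\<zeta> (sum_list (fst \<mu>))) \<otimes>\<^bsub>H\<^esub> y \<in> carrier (right_ideal H (xbar_elem r H T \<mu>))"
      using rmod_hom_closed[OF g y] y by (simp add: x1[OF \<mu>])
    then show "(\<lambda>y\<in>carrier (right_ideal H (xbar_elem r H T \<mu>)). gens.\<pi> (sum_list (fst \<mu>)) \<otimes>\<^bsub>H\<^esub> y)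
        ((\<lambda>y\<in>carrier (?M \<mu>). inv\<^bsub>H\<^esub> (gens.\<zeta> (sum_list (fst \<mu>))) \<otimes>\<^bsub>H\<^esub> y) y) = y"
      using retract(3)[OF \<mu> \<mu> \<mu> \<mu> \<mu>] y by (simp add: x[OF \<mu>])
  qed
qed

end

section \<open>The base rings\<close>

definition poly_fract :: "int poly poly \<Rightarrow> int poly poly fract" where
  "poly_fract f = Fract f 1"

lemma poly_fract_simps:
  "poly_fract (f + g) = poly_fract f + poly_fract g"
  "poly_fract (f * g) = poly_fract f * poly_fract g"
  "poly_fract 1 = 1" "poly_fract f = 0 \<longleftrightarrow> f = 0"
  by (simp_all add: poly_fract_def One_fract_def Zero_fract_def eq_fract)

lemma poly_fract_power: "poly_fract (f ^ n) = poly_fract f ^ n"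
  by (induction n) (simp_all add: poly_fract_simps)

lemma q_var_eq: "q_var = poly_fract [:[:0, 1:]:]" and q0_var_eq: "q0_var = poly_fract [:0, 1:]"
  by (simp_all add: q_var_def q0_var_def poly_fract_def)

lemma q_var_nonzero: "q_var \<noteq> 0" and q0_var_nonzero: "q0_var \<noteq> 0"
  by (simp_all add: q_var_eq q0_var_eq poly_fract_simps)

lemma Laurent_iff: "x \<in> Laurent_q_q0 \<longleftrightarrow> (\<exists>f m n. x = poly_fract f * q_var powi m * q0_var powi n)"
  by (auto simp: Laurent_q_q0_def poly_fract_def)

lemma Laurent_mult:
  assumes "x \<in> Laurent_q_q0" "y \<in> Laurent_q_q0"
  shows "x * y \<in> Laurent_q_q0"
proof -
  obtain f m n f' m' n' where "x = poly_fract f * q_var powi m * q0_var powi n"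
    "y = poly_fract f' * q_var powi m' * q0_var powi n'"
    using assms by (auto simp: Laurent_iff)
  then have "x * y = poly_fract (f * f') * q_var powi (m + m') * q0_var powi (n + n')"
    by (simp add: poly_fract_simps power_int_add q_var_nonzero q0_var_nonzero)
  then show ?thesis by (auto simp: Laurent_iff)
qed

lemma Laurent_poly: "poly_fract f \<in> Laurent_q_q0"
  unfolding Laurent_iff by (intro exI[of _ f] exI[of _ 0]) simp

lemma Laurent_q_powi: "q_var powi m \<in> Laurent_q_q0"
  unfolding Laurent_iff by (intro exI[of _ 1] exI[of _ m] exI[of _ 0]) (simp add: poly_fract_simps)

lemma Laurent_q0_powi: "q0_var powi m \<in> Laurent_q_q0"
  unfolding Laurent_iff by (rule exI[of _ 1], rule exI[of _ 0], rule exI[of _ m]) (simp add: poly_fract_simps)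

lemma Laurent_prod: "(\<And>i. i \<in> S \<Longrightarrow> f i \<in> Laurent_q_q0) \<Longrightarrow> (\<Prod>i\<in>S. f i) \<in> Laurent_q_q0"
  using Laurent_poly[of 1]
  by (induction S rule: infinite_finite_induct) (auto simp: poly_fract_simps intro: Laurent_mult)

lemma q0_plus_q_eq: "q0_var + q_var ^ n = poly_fract ([:0, 1:] + [:[:0, 1:]:] ^ n)"
  by (simp only: q_var_eq q0_var_eq poly_fract_simps poly_fract_power)

lemma q0_times_q_plus_one_eq: "q0_var * q_var ^ n + 1 = poly_fract ([:0, 1:] * [:[:0, 1:]:] ^ n + 1)"
  by (simp only: q_var_eq q0_var_eq poly_fract_simps poly_fract_power)

lemma q0_plus_q_powi_neg: "q0_var + q_var powi (- int n) = (q0_var * q_var ^ n + 1) * q_var powi (- int n)"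
  using q_var_nonzero by (simp add: power_int_minus field_simps)

text \<open>Nonzero because some coefficient in q_0 is 1: the linear one for i = n, and the constant
  one for i = -n after multiplication by q^n.\<close>

lemma g_factor:
  shows "q0_var + q_var powi i \<in> Laurent_q_q0" and "q0_var + q_var powi i \<noteq> 0"
proof -
  have "q0_var + q_var powi i \<in> Laurent_q_q0 \<and> q0_var + q_var powi i \<noteq> 0"
  proof (cases "0 \<le> i")
    case True
    then obtain n where n: "i = int n" using nonneg_int_cases by blast
    have "poly.coeff ([:0, 1:] + [:[:0, 1 :: int:]:] ^ n) 1 = 1" by (simp add: poly_const_pow)
    then have "[:0, 1:] + [:[:0, 1 :: int:]:] ^ n \<noteq> 0" by (metis Polynomial.coeff_0 zero_neq_one)
    then show ?thesis using Laurent_poly by (simp add: n q0_plus_q_eq poly_fract_simps(4))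
  next
    case False
    then have "i = - int (nat (- i))" by simp
    then obtain n where n: "i = - int n" by blast
    have "poly.coeff ([:0, 1:] * [:[:0, 1 :: int:]:] ^ n + 1) 0 = 1" by simp
    then have "[:0, 1:] * [:[:0, 1 :: int:]:] ^ n + 1 \<noteq> 0" by (metis Polynomial.coeff_0 zero_neq_one)
    then show ?thesis
      using Laurent_poly Laurent_q_powi q_var_nonzero
      by (auto simp: n q0_plus_q_powi_neg q0_times_q_plus_one_eq poly_fract_simps(4) intro: Laurent_mult)
  qed
  then show "q0_var + q_var powi i \<in> Laurent_q_q0" "q0_var + q_var powi i \<noteq> 0" by auto
qed

lemma Laurent_Z0g: "x \<in> Laurent_q_q0 \<Longrightarrow> x \<in> carrier (Z0g r)"
  by (simp add: Z0g_def) (metis div_by_1 power_0)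

lemma Laurent_divide_g_Z0g: "x \<in> Laurent_q_q0 \<Longrightarrow> x / g_poly r \<in> carrier (Z0g r)"
  by (simp add: Z0g_def) (metis power_one_right)

text \<open>The inverse is the product of the other factors divided by g_r.\<close>

lemma g_factor_inverse:
  assumes "\<bar>i\<bar> < int r"
  shows "\<exists>y. y \<in> Laurent_q_q0 \<and> (q0_var + q_var powi i) * (y / g_poly r) = 1"
proof -
  let ?I = "{- (int r - 1)..int r - 1}"
  let ?y = "\<Prod>j\<in>?I - {i}. q0_var + q_var powi j"
  have "g_poly r = (q0_var + q_var powi i) * ?y"
    unfolding g_poly_def using assms by (intro prod.remove) auto
  moreover have "g_poly r \<noteq> 0" by (simp add: g_poly_def g_factor(2))
  ultimately have "(q0_var + q_var powi i) * (?y / g_poly r) = 1" by simp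
  moreover have "?y \<in> Laurent_q_q0" by (intro Laurent_prod g_factor(1))
  ultimately show ?thesis by (intro exI[of _ ?y] conjI)
qed

text \<open>Ring homomorphisms preserve units, and q_0 q^n + 1 = q^n (q_0 + q^(-n)) takes care of
  the negative exponents.\<close>

lemma base_units_if_Z0g_hom:
  assumes R: "cring R" and \<phi>: "\<phi> \<in> ring_hom (Z0g r) R" and q: "\<phi> q_var = q" and q0: "\<phi> q0_var = q0"
  shows "q \<in> Units R"
    and "\<And>n. n < r \<Longrightarrow> q0 \<oplus>\<^bsub>R\<^esub> q [^]\<^bsub>R\<^esub> n \<in> Units R"
    and "\<And>n. n < r \<Longrightarrow> q0 \<otimes>\<^bsub>R\<^esub> q [^]\<^bsub>R\<^esub> n \<oplus>\<^bsub>R\<^esub> \<one>\<^bsub>R\<^esub> \<in> Units R"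
proof -
  interpret R: cring R by fact
  have closed: "x \<in> carrier (Z0g r) \<Longrightarrow> \<phi> x \<in> carrier R" for x
    using \<phi> by (auto simp: ring_hom_def)
  have mult: "\<phi> (x * y) = \<phi> x \<otimes>\<^bsub>R\<^esub> \<phi> y" if "x \<in> carrier (Z0g r)" "y \<in> carrier (Z0g r)" for x y
    using ring_hom_mult[OF \<phi> that] by (simp add: Z0g_def)
  have add: "\<phi> (x + y) = \<phi> x \<oplus>\<^bsub>R\<^esub> \<phi> y" if "x \<in> carrier (Z0g r)" "y \<in> carrier (Z0g r)" for x y
    using ring_hom_add[OF \<phi> that] by (simp add: Z0g_def)
  have one: "\<phi> 1 = \<one>\<^bsub>R\<^esub>" using ring_hom_one[OF \<phi>] by (simp add: Z0g_def)
  have unit: "\<phi> x \<in> Units R" if "x \<in> carrier (Z0g r)" "y \<in> carrier (Z0g r)" "x * y = 1" for x y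
  proof -
    have "\<phi> x \<otimes>\<^bsub>R\<^esub> \<phi> y = \<one>\<^bsub>R\<^esub>" using mult[OF that(1,2)] that(3) one by simp
    then show ?thesis using closed that R.m_comm by (auto simp: Units_def intro!: bexI[of _ "\<phi> y"])
  qed
  have q_pow: "q_var ^ n \<in> carrier (Z0g r)" for n
    using Laurent_Z0g[OF Laurent_q_powi[of "int n"]] by simp
  have q_var: "q_var \<in> carrier (Z0g r)" using q_pow[of 1] by simp
  have q0_var: "q0_var \<in> carrier (Z0g r)" using Laurent_Z0g[OF Laurent_q0_powi[of 1]] by simp
  have one_Z: "1 \<in> carrier (Z0g r)" using q_pow[of 0] by simp
  have \<phi>_pow: "\<phi> (q_var ^ n) = q [^]\<^bsub>R\<^esub> n" for n
  proof (induction n)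
    case (Suc n)
    have "\<phi> (q_var ^ Suc n) = \<phi> (q_var ^ n * q_var)" by (simp add: mult.commute)
    also have "\<dots> = q [^]\<^bsub>R\<^esub> Suc n" using Suc mult[OF q_pow q_var] q by simp
    finally show ?case .
  qed (simp add: one)
  show "q \<in> Units R"
    using unit[OF q_var Laurent_Z0g[OF Laurent_q_powi[of "- 1"]]] q_var_nonzero q by simp
  fix n assume n: "n < r"
  obtain y where y: "y \<in> Laurent_q_q0" "(q0_var + q_var powi int n) * (y / g_poly r) = 1"
    using g_factor_inverse[of "int n" r] n by auto
  have "\<phi> (q0_var + q_var ^ n) \<in> Units R"
    using unit[OF Laurent_Z0g[OF g_factor(1)[of "int n"]] Laurent_divide_g_Z0g[OF y(1)] y(2)] by simp
  then show "q0 \<oplus>\<^bsub>R\<^esub> q [^]\<^bsub>R\<^esub> n \<in> Units R"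
    by (simp add: add q0_var q_pow \<phi>_pow q0)
  obtain y where y: "y \<in> Laurent_q_q0" "(q0_var + q_var powi (- int n)) * (y / g_poly r) = 1"
    using g_factor_inverse[of "- int n" r] n by auto
  have "(q0_var * q_var ^ n + 1) * (q_var powi (- int n) * y / g_poly r) =
      (q0_var + q_var powi (- int n)) * (y / g_poly r)"
    unfolding q0_plus_q_powi_neg by (simp only: mult.assoc times_divide_eq_right)
  then have "(q0_var * q_var ^ n + 1) * (q_var powi (- int n) * y / g_poly r) = 1"
    using y(2) by (rule trans)
  moreover have "q0_var * q_var ^ n + 1 \<in> carrier (Z0g r)"
    unfolding q0_times_q_plus_one_eq by (rule Laurent_Z0g[OF Laurent_poly])
  ultimately have "\<phi> (q0_var * q_var ^ n + 1) \<in> Units R"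
    using Laurent_divide_g_Z0g[OF Laurent_mult[OF Laurent_q_powi y(1)]] by (rule_tac unit)
  moreover have "q0_var * q_var ^ n \<in> carrier (Z0g r)"
    using Laurent_Z0g[OF Laurent_mult[OF Laurent_q0_powi[of 1] Laurent_q_powi[of "int n"]]] by simp
  ultimately show "q0 \<otimes>\<^bsub>R\<^esub> q [^]\<^bsub>R\<^esub> n \<oplus>\<^bsub>R\<^esub> \<one>\<^bsub>R\<^esub> \<in> Units R"
    by (simp add: add mult one_Z one q0_var q_pow \<phi>_pow q0)
qed

text \<open>With d the odd order of Q, Q^s = -1 modulo l would give 1 = (Q^d)^s = (Q^s)^d = -1,
  hence l = 2.\<close>

lemma not_dvd_power_plus_one_odd_ord:
  fixes l Q :: nat
  assumes "odd l" "prime l" "odd (ord l Q)"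
  shows "\<not> l dvd Q ^ s + 1"
proof
  assume "l dvd Q ^ s + 1"
  then have "[int Q ^ s = - 1] (mod int l)"
    by (simp add: cong_iff_dvd_diff) (metis of_nat_1 of_nat_add of_nat_dvd_iff of_nat_power add.commute of_nat_Suc)
  then have "[(int Q ^ s) ^ ord l Q = (- 1) ^ ord l Q] (mod int l)" by (rule cong_pow)
  then have 1: "[(int Q ^ ord l Q) ^ s = - 1] (mod int l)"
    using assms(3) by (simp add: power_mult[symmetric] mult.commute)
  have "[int Q ^ ord l Q = 1] (mod int l)"
    using ord[of Q l] by (metis cong_int_iff of_nat_1 of_nat_power)
  then have "[(int Q ^ ord l Q) ^ s = 1] (mod int l)" using cong_pow[of "int Q ^ ord l Q" 1 "int l" s] by simp
  with 1 have "[1 = - 1] (mod int l)" by (metis cong_sym cong_trans)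
  then have "int l dvd 2" by (simp add: cong_iff_dvd_diff)
  then have "l dvd 2" by presburger
  then show False using assms(1,2) by (metis primes_dvd_imp_eq two_is_prime_nat even_numeral dvd_refl)
qed

text \<open>For odd s, Q^s = -1 modulo l would mean (-Q)^s = 1, and an even order would divide
  s.\<close>

lemma not_dvd_power_plus_one_even_ord:
  fixes l Q :: nat
  assumes "prime l" "even (ord l ((l - 1) * Q))" "odd s"
  shows "\<not> l dvd Q ^ s + 1"
proof
  assume "l dvd Q ^ s + 1"
  then have 1: "[int Q ^ s = - 1] (mod int l)"
    by (simp add: cong_iff_dvd_diff) (metis of_nat_1 of_nat_add of_nat_dvd_iff of_nat_power add.commute of_nat_Suc)
  have l: "1 \<le> l" using assms(1) prime_ge_1_nat by blast
  have "[int ((l - 1) * Q) = - int Q] (mod int l)"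
    using l by (simp add: cong_iff_dvd_diff of_nat_diff algebra_simps)
  then have "[int ((l - 1) * Q) ^ s = (- int Q) ^ s] (mod int l)" by (rule cong_pow)
  also have "(- int Q) ^ s = - (int Q ^ s)" using assms(3) by simp
  also have "[- (int Q ^ s) = 1] (mod int l)" using 1 by (metis cong_minus_minus_iff minus_minus)
  finally have "[int (((l - 1) * Q) ^ s) = int 1] (mod int l)" by simp
  then have "[((l - 1) * Q) ^ s = 1] (mod l)" by (simp only: cong_int_iff)
  then have "ord l ((l - 1) * Q) dvd s" by (rule ord_divides[THEN iffD1])
  then show False using assms(2,3) by (meson dvd_trans)
qed

text \<open>The smaller power, prime to l, is split off. Of the truncated differences m - n and n -
  m one is |m - n| and the other 0; the parity clause rules out s = 0 when m + n is odd, as in the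
  unitary case.\<close>

lemma not_dvd_power_plus_power:
  fixes l Q :: nat
  assumes "prime l" "\<not> l dvd Q" "\<And>s. \<lbrakk>s = m - n \<or> s = n - m; even s \<longleftrightarrow> even (m + n)\<rbrakk> \<Longrightarrow> \<not> l dvd Q ^ s + 1"
  shows "\<not> l dvd Q ^ m + Q ^ n"
proof -
  define s where "s = (if m \<le> n then n - m else m - n)"
  have "Q ^ m + Q ^ n = Q ^ min m n * (Q ^ s + 1)"
  proof (cases "m \<le> n")
    case True
    then show ?thesis by (simp add: s_def distrib_left power_add[symmetric] add.commute)
  next
    case False
    then show ?thesis by (simp add: s_def distrib_left power_add[symmetric])
  qed
  moreover have "\<not> l dvd Q ^ s + 1" by (rule assms(3)) (auto simp: s_def)
  moreover have "\<not> l dvd Q ^ min m n" using assms(1,2) prime_dvd_power by blast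
  ultimately show ?thesis using assms(1) by (metis prime_dvd_mult_iff)
qed

lemma base_units_if_linear_prime_case:
  assumes R: "cring R" and lin: "linear_prime_case R q q0"
  shows "q \<in> Units R"
    and "q0 \<oplus>\<^bsub>R\<^esub> q [^]\<^bsub>R\<^esub> (n::nat) \<in> Units R"
    and "q0 \<otimes>\<^bsub>R\<^esub> q [^]\<^bsub>R\<^esub> n \<oplus>\<^bsub>R\<^esub> \<one>\<^bsub>R\<^esub> \<in> Units R"
proof -
  interpret R: cring R by fact
  define \<iota> :: "nat \<Rightarrow> _" where "\<iota> n = [n] \<cdot>\<^bsub>R\<^esub> \<one>\<^bsub>R\<^esub>" for n
  have \<iota>_closed [simp]: "\<iota> n \<in> carrier R" for n by (simp add: \<iota>_def)
  have \<iota>_add: "\<iota> (m + n) = \<iota> m \<oplus>\<^bsub>R\<^esub> \<iota> n" for m n by (simp add: \<iota>_def R.add.nat_pow_mult)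
  have \<iota>_1: "\<iota> 1 = \<one>\<^bsub>R\<^esub>" by (simp add: \<iota>_def)
  have \<iota>_0: "\<iota> 0 = \<zero>\<^bsub>R\<^esub>" by (simp add: \<iota>_def)
  have \<iota>_Suc: "\<iota> (Suc n) = \<iota> n \<oplus>\<^bsub>R\<^esub> \<one>\<^bsub>R\<^esub>" for n by (simp add: \<iota>_def)
  have \<iota>_mult: "\<iota> (m * n) = \<iota> m \<otimes>\<^bsub>R\<^esub> \<iota> n" for m n
    by (induction m) (simp_all add: \<iota>_0 \<iota>_add \<iota>_Suc R.l_distr R.a_comm)
  have \<iota>_pow: "\<iota> (m ^ n) = \<iota> m [^]\<^bsub>R\<^esub> n" for m n
    by (induction n) (simp_all add: \<iota>_1[unfolded One_nat_def] \<iota>_mult R.m_comm)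
  obtain p d l Q where p: "prime p" "Q = p ^ d" and l: "prime l" "l \<noteq> p" "odd l"
    and units: "\<And>n::nat. \<not> l dvd n \<Longrightarrow> \<iota> n \<in> Units R"
    and cases: "odd (ord l Q) \<and> q = \<iota> Q \<and> (\<exists>m. q0 = \<iota> (Q ^ m)) \<or>
       even (ord l ((l - 1) * Q)) \<and> q = \<iota> (Q ^ 2) \<and> (\<exists>m. odd m \<and> q0 = \<iota> (Q ^ m))"
    using lin unfolding linear_prime_case_def \<iota>_def by blast
  have lQ: "\<not> l dvd Q" using p l by (metis prime_dvd_power primes_dvd_imp_eq)
  \<comment> \<open>Both cases are unified by q = Q^a with a = 1 or a = 2. In the second, m is odd,
    so m + 2n and |m - 2n| are odd as well.\<close>
  have "\<exists>a m. q = \<iota> (Q ^ a) \<and> q0 = \<iota> (Q ^ m) \<and> (\<forall>n. \<not> l dvd Q ^ m + Q ^ (a * n) \<and> \<not> l dvd Q ^ (m + a * n) + 1)"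
    using cases
  proof (elim disjE conjE exE, goal_cases)
    case (1 m)
    then show ?case
      using not_dvd_power_plus_one_odd_ord[OF l(3,1)] not_dvd_power_plus_power[OF l(1) lQ]
      by (intro exI[of _ 1] exI[of _ m]) auto
  next
    case (2 m)
    then show ?case
      using not_dvd_power_plus_one_even_ord[OF l(1)] not_dvd_power_plus_power[OF l(1) lQ]
      by (intro exI[of _ 2] exI[of _ m]) auto
  qed
  then obtain a m where am: "q = \<iota> (Q ^ a)" "q0 = \<iota> (Q ^ m)"
    "\<And>n. \<not> l dvd Q ^ m + Q ^ (a * n)" "\<And>n. \<not> l dvd Q ^ (m + a * n) + 1"
    by blast
  have "\<not> l dvd Q ^ k" for k using lQ l(1) prime_dvd_power by blast
  then show "q \<in> Units R" unfolding am by (auto intro: units)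
  show "q0 \<oplus>\<^bsub>R\<^esub> q [^]\<^bsub>R\<^esub> n \<in> Units R"
    using units[OF am(3)[of n]] by (simp add: am(1,2) \<iota>_add \<iota>_pow[symmetric] power_mult[symmetric])
  show "q0 \<otimes>\<^bsub>R\<^esub> q [^]\<^bsub>R\<^esub> n \<oplus>\<^bsub>R\<^esub> \<one>\<^bsub>R\<^esub> \<in> Units R"
    using units[OF am(4)[of n]] by (simp only: am(1,2) \<iota>_add \<iota>_pow[symmetric] power_mult[symmetric] power_add \<iota>_mult \<iota>_1)
qed

text \<open>Both parts reduce to the same unit conditions; in the linear prime case these come from
  congruences modulo l and not from a homomorphism out of \<open>Z0g r\<close>.\<close>

theorem theorem3p5:
  fixes r :: nat
    and R :: "('a, 'c) ring_scheme"
    and q q0 :: 'a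
    and H :: "('a, 'h, 'd) module_scheme"
    and T :: "(int \<Rightarrow> int) \<Rightarrow> 'h"
  assumes "1 \<le> r"
    and "cring R"
    and "hecke_algebra_B r R q q0 H T"
  shows "(\<forall>\<phi> \<in> ring_hom (Z0g r) R. \<phi> q_var = q \<and> \<phi> q0_var = q0 \<longrightarrow>
            Morita_equivalent TYPE('u::infinite) (qSchur2 r R q H T) (qSchur1B r R q H T)) \<and>
         (linear_prime_case R q q0 \<longrightarrow>
            Morita_equivalent TYPE('u) (qSchur2 r R q H T) (qSchur1B r R q H T))"
proof (intro conjI ballI impI)
  interpret hecke_algebra_B r R q q0 H T by fact
  show "Morita_equivalent TYPE('u) (qSchur2 r R q H T) (qSchur1B r R q H T)"
    if "\<phi> \<in> ring_hom (Z0g r) R" "\<phi> q_var = q \<and> \<phi> q0_var = q0" for \<phi>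
    using base_units_if_Z0g_hom[OF assms(2) that(1)] that(2) by (intro Morita_equivalent_qSchur) auto
  show "Morita_equivalent TYPE('u) (qSchur2 r R q H T) (qSchur1B r R q H T)"
    if "linear_prime_case R q q0"
    using base_units_if_linear_prime_case[OF assms(2) that] by (intro Morita_equivalent_qSchur)
qed

end
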